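(* Let $p,q\in\mathbb{C}[w]$ with $p\not\equiv 0$, and set $f(w)=\int_0^w p(t)\,dt$, $g(w)=\int_0^w q(t)\,dt$. Assume $f(0)=f(1)$. Then $$\int_0^1 f^k(w)q(w)\,dw=0\quad\text{for every integer }k\ge 0$$ if and only if $\int_{C_f(t)} g\equiv 0$, where $C_f(t)$ is the cycle of $f$ given by $$C_f(t)=\sum_{i=1}^{n_0} n_1 z_{a_i}(t)-\sum_{i=1}^{n_1} n_0 z_{b_i}(t),$$ with $z_{a_1}(t),\dots,z_{a_{n_0}}(t)$ all the solutions of $f(z)=t$ close to $0$ for $t$ close to $f(0)$, and $z_{b_1}(t),\dots,z_{b_{n_1}}(t)$ all the solutions of $f(z)=t$ close to $1$ for $t$ close to $f(1)=f(0)$. Moreover, the cycle $C_f(t)$ is totally unbalanced.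
   Context: Cycles and integrals. Let $f\in\mathbb{C}[z]$ have degree $m>1$, with set of critical values $\Sigma\subset\mathbb{C}$. For $t\notin\Sigma$, $z_1(t),\dots,z_m(t)$ are the distinct roots of $f(z)=t$, depending analytically on $t$ locally near a base point $t_0\notin\Sigma$. A cycle of $f$ is a formal sum $C(t)=\sum_{i=1}^m n_i z_i(t)$ with $n_i\in\mathbb{Z}$, $\sum_i n_i=0$; it is trivial if all $n_i=0$. For a polynomial $g$, $\int_{C(t)} g:=\sum_{i=1}^m n_i g(z_i(t))$; "$\equiv 0$" means identically zero in $t$. For $C_f(t)$, the base point $t_0$ is taken close to $f(0)$; $n_0$ and $n_1$ are the numbers of solutions near $0$ and near $1$ (the multiplicities of $0$ and $1$ as roots of $f(z)-f(0)$). Monodromy. The monodromy group $G_f$ is the group of permutations of $\{1,\dots,m\}$ (indices of the roots $z_i(t_0)$) induced by analytic continuation along loops in $\pi_1(\mathbb{C}\setminus\Sigma,t_0)$. The loop winding once anti-clockwise around all of $\Sigma$ induces an $m$-cycle $\tau_\infty\in G_f$. $\Gamma_m(f)\subset G_f$ is the conjugacy class of $\tau_\infty$ in $G_f$. Balanced. A cycle $C(t)=\sum n_iz_i(t)$ is balanced if $\sum_{i=1}^m n_{p_i}\epsilon_m^i=0$ for every $m$-cycle $\sigma=(p_1,p_2,\dots,p_m)\in\Gamma_m(f)$ (i.e. $\sigma: p_1\mapsto p_2\mapsto\cdots\mapsto p_m\mapsto p_1$), where $\epsilon_m$ is a primitive $m$-th root of unity. It is unbalanced if it is not balanced. Projected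 cycle. If $f=f_0\circ h$ with $f_0,h\in\mathbb{C}[z]$, let $w_1(t),\dots,w_d(t)$ be the distinct values among $h(z_1(t)),\dots,h(z_m(t))$; these are the roots of $f_0(w)=t$. The projected cycle is the cycle $h(C(t))=\sum_{j=1}^d\tilde n_j w_j(t)$ of $f_0$, with $\tilde n_j=\sum_{i:\,h(z_i(t))=w_j(t)} n_i$. Triviality and balancedness of $h(C)$ are with respect to $f_0$. Totally unbalanced. $C(t)$ is totally unbalanced if for every $f_0,h\in\mathbb{C}[z]$ with $f=f_0\circ h$, the projected cycle $h(C)$ is unbalanced or trivial. *)

theory Defs
  imports "HOL-Complex_Analysis.Complex_Analysis" "HOL-Combinatorics.Cycles"
begin

definition fiber :: "complex poly \<Rightarrow> complex \<Rightarrow> complex set" where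
  "fiber f t = {z. poly f z = t}"

definition critical_values :: "complex poly \<Rightarrow> complex set" where
  "critical_values f = poly f ` {z. poly (pderiv f) z = 0}"

text \<open>
  Cycles: for a regular value \<open>t0\<close>, the roots \<open>z\<^sub>i(t0)\<close> are the elements of \<open>fiber f t0\<close>, and the
  index \<open>i\<close> is replaced by the root \<open>z\<^sub>i(t0)\<close> itself.  A formal sum of the \<open>z\<^sub>i(t)\<close> is thus a weight
  function \<open>n\<close> on \<open>fiber f t0\<close>; its values outside the fiber are irrelevant.
\<close>

definition is_cycle :: "complex poly \<Rightarrow> complex \<Rightarrow> (complex \<Rightarrow> int) \<Rightarrow> bool" where
  "is_cycle f t0 n \<longleftrightarrow> (\<Sum>z\<in>fiber f t0. n z) = 0"

definition trivial_cycle :: "complex poly \<Rightarrow> complex \<Rightarrow> (complex \<Rightarrow> int) \<Rightarrow> bool" where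
  "trivial_cycle f t0 n \<longleftrightarrow> (\<forall>z\<in>fiber f t0. n z = 0)"

text \<open>
  The analytic branch \<open>z\<^sub>i(t)\<close> with \<open>z\<^sub>i(t0) = z\<close>.  For regular \<open>t0\<close> and \<open>z\<close> in the fiber, it exists and
  is unique as a germ at \<open>t0\<close>; only its values near \<open>t0\<close> are meaningful.
\<close>

definition root_branch :: "complex poly \<Rightarrow> complex \<Rightarrow> complex \<Rightarrow> complex \<Rightarrow> complex" where
  "root_branch f t0 z =
     (SOME Z. Z analytic_on {t0} \<and> Z t0 = z \<and> (\<forall>\<^sub>F t in nhds t0. poly f (Z t) = t))"

definition cycle_integral ::
    "complex poly \<Rightarrow> complex \<Rightarrow> (complex \<Rightarrow> int) \<Rightarrow> complex poly \<Rightarrow> complex \<Rightarrow> complex" where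
  "cycle_integral f t0 n g t =
     (\<Sum>z\<in>fiber f t0. of_int (n z) * poly g (root_branch f t0 z t))"

text \<open>
  \<open>\<sigma>\<close> is the permutation of the roots over the base point of the loop \<open>\<gamma>\<close> obtained by continuing
  them along \<open>\<gamma>\<close>.  As \<open>\<gamma>\<close> will avoid the critical values, continuous lifts of \<open>\<gamma>\<close> along \<open>f\<close> are the
  same as analytic continuations of the branches.  By \<open>permutes\<close>, \<open>\<sigma>\<close> is the identity off the fiber.
\<close>

definition induces_perm ::
    "complex poly \<Rightarrow> (real \<Rightarrow> complex) \<Rightarrow> (complex \<Rightarrow> complex) \<Rightarrow> bool" where
  "induces_perm f \<gamma> \<sigma> \<longleftrightarrow>
     \<sigma> permutes fiber f (pathstart \<gamma>) \<and>
     (\<forall>z\<in>fiber f (pathstart \<gamma>). \<exists>\<eta>. path \<eta> \<and> pathstart \<eta> = z \<and> pathfinish \<eta> = \<sigma> z \<and>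
        (\<forall>s\<in>{0..1}. poly f (\<eta> s) = \<gamma> s))"

definition monodromy_group :: "complex poly \<Rightarrow> complex \<Rightarrow> (complex \<Rightarrow> complex) set" where
  "monodromy_group f t0 =
     {\<sigma>. \<exists>\<gamma>. path \<gamma> \<and> path_image \<gamma> \<subseteq> - critical_values f \<and>
           pathstart \<gamma> = t0 \<and> pathfinish \<gamma> = t0 \<and> induces_perm f \<gamma> \<sigma>}"

text \<open>
  \<open>\<tau>\<close> is induced by a loop winding once anti-clockwise around all critical values: go from \<open>t0\<close> to a
  large circle along \<open>\<delta>\<close>, traverse the circle, and return along \<open>\<delta>\<close>.  Prescribing winding numbers
  would not determine the class of such a loop.  Different \<open>\<delta>\<close> give conjugate permutations.
\<close>

definition is_tau_infinity :: "complex poly \<Rightarrow> complex \<Rightarrow> (complex \<Rightarrow> complex) \<Rightarrow> bool" where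
  "is_tau_infinity f t0 \<tau> \<longleftrightarrow>
     (\<exists>R \<delta>. R > 0 \<and> critical_values f \<subseteq> ball 0 R \<and>
        path \<delta> \<and> path_image \<delta> \<subseteq> - critical_values f \<and>
        pathstart \<delta> = t0 \<and> pathfinish \<delta> = complex_of_real R \<and>
        induces_perm f (\<delta> +++ circlepath 0 R +++ reversepath \<delta>) \<tau>)"

definition Gamma_class :: "complex poly \<Rightarrow> complex \<Rightarrow> (complex \<Rightarrow> complex) set" where
  "Gamma_class f t0 =
     {\<sigma> \<circ> \<tau> \<circ> inv \<sigma> | \<sigma> \<tau>. \<sigma> \<in> monodromy_group f t0 \<and> is_tau_infinity f t0 \<tau>}"

text \<open>
  The list \<open>ps\<close> is \<open>(p\<^sub>1, \<dots>, p\<^sub>m)\<close>, indexed from \<open>0\<close>.  The primitive root of unity is \<open>exp (2 \<pi> \<i> / m)\<close>;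
  the weights being integers, any other primitive \<open>m\<close>-th root gives the same notion.
\<close>

definition balanced :: "complex poly \<Rightarrow> complex \<Rightarrow> (complex \<Rightarrow> int) \<Rightarrow> bool" where
  "balanced f t0 n \<longleftrightarrow>
     (\<forall>ps. distinct ps \<and> set ps = fiber f t0 \<and> cycle_of_list ps \<in> Gamma_class f t0 \<longrightarrow>
        (\<Sum>i=1..degree f. of_int (n (ps ! (i - 1))) * cis (2 * pi / real (degree f)) ^ i) = 0)"

definition projected_cycle ::
    "complex poly \<Rightarrow> complex \<Rightarrow> complex poly \<Rightarrow> (complex \<Rightarrow> int) \<Rightarrow> complex \<Rightarrow> int" where
  "projected_cycle f t0 h n w = (\<Sum>z | z \<in> fiber f t0 \<and> poly h z = w. n z)"

definition totally_unbalanced :: "complex poly \<Rightarrow> complex \<Rightarrow> (complex \<Rightarrow> int) \<Rightarrow> bool" where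
  "totally_unbalanced f t0 n \<longleftrightarrow>
     (\<forall>f0 h. f = pcompose f0 h \<longrightarrow>
        \<not> balanced f0 t0 (projected_cycle f t0 h n) \<or>
        trivial_cycle f0 t0 (projected_cycle f t0 h n))"

text \<open>
  The weights of \<open>C\<^sub>f\<close>, for \<open>f(0) = f(1)\<close>.  ``Close to'' \<open>0\<close> or \<open>1\<close> means at distance less than \<open>r\<close>;
  it is meaningful for small \<open>r\<close> and for \<open>t0\<close> sufficiently close to \<open>f(0)\<close> depending on \<open>r\<close>.
\<close>

definition endpoint_mult :: "complex poly \<Rightarrow> complex \<Rightarrow> nat" where
  "endpoint_mult f a = order a (f - [:poly f 0:])"

definition endpoint_cycle :: "complex poly \<Rightarrow> real \<Rightarrow> complex \<Rightarrow> int" where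
  "endpoint_cycle f r z =
     int (endpoint_mult f 1) * of_bool (dist z 0 < r) -
     int (endpoint_mult f 0) * of_bool (dist z 1 < r)"

end

theory Submission
  imports Defs "HOL-Computational_Algebra.Fundamental_Theorem_Algebra"
begin

text \<open>
  Throughout, \<open>f 0 = f 1 = 0\<close>, and the roots of \<open>f z = t\<close> have to be compared for \<open>t\<close> near 0 and for \<open>t\<close>
  near infinity.  The substitution \<open>t = c * exp u\<close> with \<open>\<bar>c\<bar> = 1\<close> makes this possible on one simply
  connected domain \<open>U\<close>: a neighbourhood of the real axis that opens up linearly on both sides, and for
  suitable \<open>c\<close> contains no \<open>u\<close> that corresponds to a critical value.  By covering space theory there
  are \<open>m = degree f\<close> holomorphic branches \<open>Z x\<close> on \<open>U\<close>, indexed by the points \<open>x\<close> of the fiber over \<open>u = 0\<close>.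
  For \<open>Re u\<close> tending to minus infinity, \<open>Z x u\<close> tends to a root \<open>\<zeta> x\<close> of \<open>f\<close>.  The translation of \<open>u\<close> by
  \<open>2 * pi * \<i>\<close> far to the left permutes the branches by the monodromy \<open>\<sigma>\<close> around 0, whose cycles are the
  sets of branches with a common limit; far to the right it permutes them by the \<open>m\<close>-cycle \<open>\<tau>\<close>, the
  monodromy at infinity.  The cycle \<open>C\<^sub>f\<close> has weight \<open>n\<^sub>1\<close> on the \<open>n\<^sub>0\<close> branches from 0, and \<open>- n\<^sub>0\<close> on the
  \<open>n\<^sub>1\<close> branches from 1, so near 0 its integral is the branch sum \<open>\<Psi> u\<close> of the values \<open>g (Z x u)\<close> with
  these weights, and by the identity theorem it vanishes near one point if and only if \<open>\<Psi> = 0\<close> on \<open>U\<close>.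

  If \<open>\<Psi> = 0\<close>, let \<open>G\<close> be a primitive of \<open>f ^ k * q\<close>.  The branch sum of \<open>G\<close> has the derivative
  \<open>(c * exp u) ^ k * \<Psi>' u = 0\<close>.  Its constant value is 0, since the average over \<open>m\<close> turns at infinity is a
  multiple of the sum of the weights; and it is \<open>n\<^sub>0 * n\<^sub>1 * (G 0 - G 1)\<close>, by the limit on the left.  Hence
  the moment \<open>G 1 - G 0\<close> vanishes (\<open>branch_sum_zero_imp_moments\<close>).

  Conversely, if all moments vanish, then so does the integral of \<open>q / (f - t)\<close> over the segment from 0
  to 1 for large \<open>t\<close>.  By partial fractions this integral is a polynomial in \<open>t\<close> plus the sum of
  \<open>q z / f' z * log (1 - 1 / z)\<close> over the roots \<open>z\<close> of \<open>f z = t\<close>.  The relation continues along \<open>U\<close> to small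
  \<open>t\<close>.  There, some number \<open>l\<close> of turns around 0 restores all roots, but it changes the logarithm by
  \<open>- 2 * pi * \<i> * l / n\<^sub>0\<close> for a root close to 0, by \<open>2 * pi * \<i> * l / n\<^sub>1\<close> for a root close to 1, and not at
  all for other roots.  The difference of the relations before and after these turns is \<open>\<Psi>' = 0\<close>, up to a
  factor (\<open>moments_imp_branch_sum_zero\<close>).

  For total unbalancedness, let \<open>f = f0 \<circ> h\<close>.  The branches of \<open>f0\<close> are the images of those of \<open>f\<close>, and the
  monodromy around 0 spreads the branches from 0 evenly over the branches of \<open>f0\<close> from \<open>h 0\<close>, and
  likewise for 1.  So the projected cycle has total weight \<open>n\<^sub>0 * n\<^sub>1\<close>, evenly distributed, on the branches
  from \<open>h 0\<close>, and the opposite of this on those from \<open>h 1\<close>.  It is trivial if \<open>h 0 = h 1\<close>.  Otherwise the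
  two stars that the branches over the positive real multiples of \<open>c\<close> form at \<open>h 0\<close> and \<open>h 1\<close> are disjoint
  in the plane, so in the cyclic order at infinity the branches of the one do not interlace with those
  of the other (\<open>noncrossing\<close>, by winding numbers).  The corresponding sets of roots of unity are separated
  by a line, they have different centroids, and this says that the projected cycle is unbalanced
  (\<open>two_root_cycle_unbalanced\<close>).
\<close>

text \<open>
  The displacement of \<open>u\<close> that corresponds to \<open>l\<close> turns of \<open>exp u\<close> around 0.
\<close>
abbreviation turn :: "nat \<Rightarrow> complex" where "turn l \<equiv> 2 * pi * of_nat l * \<i>"

section \<open>Fibers of a polynomial\<close>

lemma finite_fiber: "degree F > 0 \<Longrightarrow> finite (fiber F t)"
proof -
  assume d: "degree F > 0"
  have "F - [:t:] \<noteq> 0"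
    using d by auto
  moreover have "fiber F t = {z. poly (F - [:t:]) z = 0}"
    by (auto simp: fiber_def)
  ultimately show ?thesis using poly_roots_finite by metis
qed

lemma degree_diff_const: "degree F > 0 \<Longrightarrow> degree (F - [:t:]) = degree F"
  for F :: "complex poly"
  using degree_add_eq_left[of "- [:t:]" F] by (simp del: minus_pCons)

lemma sum_order_eq_degree:
  fixes F :: "complex poly"
  assumes "F \<noteq> 0"
  shows "(\<Sum>z | poly F z = 0. order z F) = degree F"
proof -
  have "degree F = degree (smult (lead_coeff F) (\<Prod>x | poly F x = 0. [:-x, 1:] ^ order x F))"
    by (simp only: complex_poly_decompose)
  also have "\<dots> = (\<Sum>z | poly F z = 0. order z F)"
    using assms by (simp add: degree_prod_sum_eq degree_power_eq)
  finally show ?thesis by simp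
qed

lemma card_fiber_regular:
  assumes "degree F > 0" "t \<notin> critical_values F"
  shows "card (fiber F t) = degree F"
proof -
  have nz: "F - [:t:] \<noteq> 0" using degree_diff_const[OF assms(1), of t] assms(1) by force
  have fib: "fiber F t = {z. poly (F - [:t:]) z = 0}"
    by (auto simp: fiber_def)
  have "rsquarefree (F - [:t:])"
    unfolding rsquarefree_roots
    using assms(2) by (auto simp: critical_values_def pderiv_diff)
  then have ord1: "order z (F - [:t:]) = 1" if "z \<in> fiber F t" for z
    using that nz rsquarefree_root_order[of "F - [:t:]" z] \<open>rsquarefree (F - [:t:])\<close> by (simp add: fib del: diff_pCons)
  have "(\<Sum>z\<in>fiber F t. order z (F - [:t:])) = card (fiber F t)" by (simp add: ord1)
  moreover have "(\<Sum>z\<in>fiber F t. order z (F - [:t:])) = degree F"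
    using sum_order_eq_degree[OF nz] degree_diff_const[OF assms(1)] by (simp only: fib)
  ultimately show ?thesis by simp
qed

lemma fiber_nonempty: "degree F > 0 \<Longrightarrow> fiber F t \<noteq> {}"
  using fundamental_theorem_of_algebra[of "F - [:t:]"] degree_diff_const[of F t]
  by (auto simp: fiber_def constant_degree)

lemma finite_critical_values: "degree F > 0 \<Longrightarrow> finite (critical_values F)"
  unfolding critical_values_def
  by (metis finite_imageI not_gr_zero pderiv_eq_0_iff poly_roots_finite)

text \<open>
  In the factorization of \<open>F\<close> over its roots, every linear factor is at least \<open>r\<close> at a point that is
  far from all roots.
\<close>
lemma small_value_near_root:
  fixes F :: "complex poly"
  assumes "degree F > 0" "r > 0"
  obtains \<rho> where "\<rho> > 0" "\<And>z. norm (poly F z) < \<rho> \<Longrightarrow> \<exists>a. poly F a = 0 \<and> dist z a < r"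
proof
  have F0: "F \<noteq> 0" using assms by auto
  show "norm (lead_coeff F) * r ^ degree F > 0" using F0 assms by simp
  fix z assume z: "norm (poly F z) < norm (lead_coeff F) * r ^ degree F"
  show "\<exists>a. poly F a = 0 \<and> dist z a < r"
  proof (rule ccontr)
    assume "\<not> ?thesis"
    then have far: "r \<le> dist z a" if "poly F a = 0" for a using that by force
    have "r ^ degree F = (\<Prod>x | poly F x = 0. r ^ order x F)"
      by (simp add: sum_order_eq_degree[OF F0] flip: power_sum)
    also have "\<dots> \<le> (\<Prod>x | poly F x = 0. dist z x ^ order x F)"
      using far assms by (intro prod_mono) (auto intro!: power_mono)
    finally have "norm (lead_coeff F) * r ^ degree F \<le> norm (lead_coeff F) * (\<Prod>x | poly F x = 0. dist z x ^ order x F)"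
      by (intro mult_left_mono) auto
    also have "\<dots> = norm (poly (smult (lead_coeff F) (\<Prod>x | poly F x = 0. [:-x, 1:] ^ order x F)) z)"
      by (simp add: norm_mult poly_prod norm_power poly_power dist_norm flip: prod_norm)
    also have "\<dots> = norm (poly F z)" by (simp only: complex_poly_decompose)
    finally show False using z by simp
  qed
qed

section \<open>The covering over the regular values\<close>

lemma poly_locally_invertible:
  fixes F :: "complex poly"
  assumes "poly (pderiv F) z \<noteq> 0"
  obtains r where "r > 0" "inj_on (poly F) (ball z r)"
proof -
  have "deriv (poly F) z = poly (pderiv F) z" by (simp add: DERIV_imp_deriv)
  then show ?thesis
    using has_complex_derivative_locally_invertible[of "poly F" UNIV z] assms that
      poly_holomorphic_on[OF holomorphic_on_ident, of F UNIV] by auto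
qed

lemma fiber_disjoint_invertible_balls:
  assumes "degree F > 0" "t \<notin> critical_values F"
  obtains r where "r > 0" "\<And>z. z \<in> fiber F t \<Longrightarrow> inj_on (poly F) (ball z r)"
    "\<And>z z'. \<lbrakk>z \<in> fiber F t; z' \<in> fiber F t; z \<noteq> z'\<rbrakk> \<Longrightarrow> ball z r \<inter> ball z' r = {}"
proof -
  note fin = finite_fiber[OF assms(1), of t]
  have "\<exists>r>0. inj_on (poly F) (ball z r)" if "z \<in> fiber F t" for z
  proof -
    have "poly (pderiv F) z \<noteq> 0" using that assms(2) by (auto simp: critical_values_def fiber_def)
    then show ?thesis using poly_locally_invertible by metis
  qed
  then obtain \<rho> where \<rho>: "\<And>z. z \<in> fiber F t \<Longrightarrow> \<rho> z > 0 \<and> inj_on (poly F) (ball z (\<rho> z))" by metis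
  define S where "S = \<rho> ` fiber F t \<union> (\<lambda>(z,w). dist z w / 2) ` {(z,w) \<in> fiber F t \<times> fiber F t. z \<noteq> w}"
  have "finite S" unfolding S_def using fin
    by (intro finite_UnI finite_imageI finite_subset[OF _ finite_cartesian_product[OF fin fin]]) auto
  moreover have "S \<noteq> {}" using fiber_nonempty[OF assms(1)] by (auto simp: S_def)
  moreover have "\<forall>s\<in>S. s > 0" using \<rho> by (auto simp: S_def)
  ultimately have M: "Min S > 0" "\<And>s. s \<in> S \<Longrightarrow> Min S \<le> s" by auto
  show ?thesis
  proof
    show "Min S > 0" by (fact M)
    show "inj_on (poly F) (ball z (Min S))" if "z \<in> fiber F t" for z
      by (rule inj_on_subset[of _ "ball z (\<rho> z)"]) (use \<rho> that M(2)[of "\<rho> z"] in \<open>auto simp: S_def\<close>)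
    show "ball z (Min S) \<inter> ball z' (Min S) = {}"
      if "z \<in> fiber F t" "z' \<in> fiber F t" "z \<noteq> z'" for z z'
      using that M(2)[of "dist z z' / 2"] by (intro disjoint_ballI) (fastforce simp: S_def)
  qed
qed

lemma inj_image_eq_if_card_le:
  assumes "finite A" "\<And>z. z \<in> A \<Longrightarrow> g z \<in> B" "inj_on g A" "card B \<le> card A" "finite B"
  shows "g ` A = B"
  using assms by (metis card_image card_seteq finite_imageI image_subsetI)

lemma continuous_on_poly_fun: "continuous_on S (poly F)" for F :: "complex poly"
  by (simp add: continuous_at_imp_continuous_on)

text \<open>
  Near the points of a regular fiber the polynomial is invertible.  The \<open>degree F\<close> local inverses are
  defined on a common neighbourhood \<open>T\<close> and have disjoint images, so over each point of \<open>T\<close> they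
  already account for \<open>degree F\<close> points; nothing of the preimage of \<open>T\<close> is left outside the sheets.
\<close>
lemma regular_covering_space:
  assumes d: "degree F > 0"
  shows "covering_space (poly F -` (- critical_values F)) (poly F) (- critical_values F)"
proof (rule covering_spaceI)
  let ?S = "- critical_values F"
  let ?C = "poly F -` ?S"
  have opS: "open ?S" using finite_critical_values[OF d] by (simp add: finite_imp_closed open_Compl)
  show "continuous_on ?C (poly F)" by (rule continuous_on_poly_fun)
  show "poly F ` ?C = ?S"
  proof safe
    fix t assume "t \<notin> critical_values F"
    moreover obtain z where "t = poly F z" using fiber_nonempty[OF d, of t] unfolding fiber_def by blast
    ultimately show "t \<in> poly F ` ?C" by auto
  qed
  fix t assume t: "t \<in> ?S"
  then have "t \<notin> critical_values F" by simp
  then obtain r where r: "r > 0" "\<And>z. z \<in> fiber F t \<Longrightarrow> inj_on (poly F) (ball z r)"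
    "\<And>z z'. \<lbrakk>z \<in> fiber F t; z' \<in> fiber F t; z \<noteq> z'\<rbrakk> \<Longrightarrow> ball z r \<inter> ball z' r = {}"
    using fiber_disjoint_invertible_balls[OF d] by blast
  define T where "T = ?S \<inter> (\<Inter>z\<in>fiber F t. poly F ` ball z r)"
  have opim: "open (poly F ` W)" if "open W" "W \<subseteq> ball z r" "z \<in> fiber F t" for z W
    by (rule open_mapping_thm3[OF poly_holomorphic_on[OF holomorphic_on_ident] that(1) inj_on_subset[OF r(2)[OF that(3)] that(2)]])
  have opT: "open T" unfolding T_def
    by (intro open_Int opS open_INT finite_fiber[OF d] ballI opim) auto
  have tT: "t \<in> T" using t r(1) by (force simp: T_def fiber_def)
  define V where "V = (\<lambda>z. ball z r \<inter> poly F -` T) ` fiber F t"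
  have opV: "open (ball z r \<inter> poly F -` T)" for z
    by (intro open_Int open_ball open_vimage opT continuous_on_poly_fun)
  have cover: "\<exists>z\<in>fiber F t. w \<in> ball z r" if w: "poly F w \<in> T" for w
  proof -
    have "\<exists>g. \<forall>z\<in>fiber F t. g z \<in> ball z r \<and> poly F (g z) = poly F w"
      using w by (intro bchoice) (force simp: T_def)
    then obtain g where g: "\<And>z. z \<in> fiber F t \<Longrightarrow> g z \<in> ball z r" "\<And>z. z \<in> fiber F t \<Longrightarrow> poly F (g z) = poly F w"
      by blast
    have "g ` fiber F t = fiber F (poly F w)"
    proof (rule inj_image_eq_if_card_le)
      show "inj_on g (fiber F t)" using g(1) r(3) by (metis disjoint_iff inj_onI)
      show "card (fiber F (poly F w)) \<le> card (fiber F t)"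
        using w t by (simp add: card_fiber_regular[OF d] T_def)
    qed (use g finite_fiber[OF d] in \<open>auto simp: fiber_def\<close>)
    then have "w \<in> g ` fiber F t" by (simp add: fiber_def)
    then show ?thesis using g by blast
  qed
  show "\<exists>T. t \<in> T \<and> openin (top_of_set ?S) T \<and>
          (\<exists>v. \<Union> v = ?C \<inter> poly F -` T \<and> (\<forall>u\<in>v. openin (top_of_set ?C) u) \<and>
             pairwise disjnt v \<and> (\<forall>u\<in>v. \<exists>q. homeomorphism u T (poly F) q))"
  proof (intro exI conjI)
    show "t \<in> T" by (fact tT)
    show "openin (top_of_set ?S) T" using opT by (simp add: T_def open_subset)
    show "\<Union> V = ?C \<inter> poly F -` T"
    proof -
      have "T \<subseteq> ?S" by (auto simp: T_def)
      then have "?C \<inter> poly F -` T = poly F -` T" by auto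
      moreover have "\<Union> V = poly F -` T" using cover unfolding V_def by blast
      ultimately show ?thesis by simp
    qed
    show "\<forall>u\<in>V. openin (top_of_set ?C) u"
    proof
      fix u assume "u \<in> V"
      then obtain z where u: "u = ball z r \<inter> poly F -` T" by (auto simp: V_def)
      have "u \<subseteq> ?C" by (auto simp: u T_def)
      then show "openin (top_of_set ?C) u" using opV[of z] u by (metis open_subset)
    qed
    show "pairwise disjnt V"
      unfolding pairwise_def disjnt_def V_def using r(3) by blast
    show "\<forall>u\<in>V. \<exists>q. homeomorphism u T (poly F) q"
    proof
      fix u assume "u \<in> V"
      then obtain z where z: "z \<in> fiber F t" and u: "u = ball z r \<inter> poly F -` T" by (auto simp: V_def)
      have "\<exists>q. homeomorphism u T (poly F) q"
      proof (rule homeomorphism_injective_open_map)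
        show "continuous_on u (poly F)" by (rule continuous_on_poly_fun)
        have "T \<subseteq> poly F ` ball z r" using z by (auto simp: T_def)
        then show "poly F ` u = T" by (auto simp: u)
        show "inj_on (poly F) u" using r(2)[OF z] by (rule inj_on_subset) (simp add: u)
        show "openin (top_of_set T) (poly F ` W)" if W: "openin (top_of_set u) W" for W
        proof -
          have "open W" "W \<subseteq> u" using W opV[of z] by (simp_all add: openin_open_eq u)
          then have "open (poly F ` W)" using opim z u by blast
          moreover have "poly F ` W \<subseteq> T" using \<open>W \<subseteq> u\<close> u by auto
          ultimately show ?thesis by (simp add: open_subset)
        qed
      qed (auto)
      then show "\<exists>q. homeomorphism u T (poly F) q" by blast
    qed
  qed
qed

section \<open>A starlike domain reaching from zero to infinity\<close>

lemma finite_separated: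
  fixes S :: "'a::metric_space set"
  assumes "finite S"
  obtains \<delta> where "\<delta> > 0" "\<And>a b. \<lbrakk>a \<in> S; b \<in> S; a \<noteq> b\<rbrakk> \<Longrightarrow> \<delta> \<le> dist a b"
proof -
  define D where "D = insert 1 ((\<lambda>(a,b). dist a b) ` {(a,b) \<in> S \<times> S. a \<noteq> b})"
  have "finite D" unfolding D_def
    by (intro finite.insertI finite_imageI finite_subset[OF _ finite_cartesian_product[OF assms assms]]) auto
  moreover have "\<forall>d\<in>D. d > 0" by (auto simp: D_def)
  moreover have "dist a b \<in> D" if "a \<in> S" "b \<in> S" "a \<noteq> b" for a b
    using that by (force simp: D_def)
  ultimately show ?thesis using that[of "Min D"] by (auto simp: D_def)
qed

text \<open>
  A neighbourhood of the real axis that opens up linearly at both ends.  It is starlike about 0, hence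
  simply connected, and yet every vertical displacement keeps the points that are far enough to the left
  or to the right inside.
\<close>
definition chart_dom :: "real \<Rightarrow> complex set" where
  "chart_dom \<epsilon> = {u. \<bar>Im u\<bar> < \<epsilon> * (1 + \<bar>Re u\<bar>)}"

lemma open_chart_dom: "open (chart_dom \<epsilon>)"
  unfolding chart_dom_def by (intro open_Collect_less continuous_intros)

lemma real_in_chart_dom: "\<epsilon> > 0 \<Longrightarrow> complex_of_real s \<in> chart_dom \<epsilon>"
  by (simp add: chart_dom_def add_pos_nonneg)

lemma scale_in_chart_dom:
  assumes "u \<in> chart_dom \<epsilon>" "0 \<le> s" "s \<le> 1" "\<epsilon> > 0"
  shows "complex_of_real s * u \<in> chart_dom \<epsilon>"
proof (cases "s = 0")
  case True
  then show ?thesis using real_in_chart_dom[OF assms(4), of 0] by simp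
next
  case False
  have "s * \<bar>Im u\<bar> < s * (\<epsilon> * (1 + \<bar>Re u\<bar>))"
    using assms False by (auto simp: chart_dom_def)
  also have "\<dots> = \<epsilon> * (s + s * \<bar>Re u\<bar>)" by (simp add: algebra_simps)
  also have "\<dots> \<le> \<epsilon> * (1 + s * \<bar>Re u\<bar>)" using assms by simp
  finally show ?thesis using assms by (simp add: chart_dom_def abs_mult)
qed

lemma starlike_chart_dom: "\<epsilon> > 0 \<Longrightarrow> starlike (chart_dom \<epsilon>)"
  unfolding starlike_def using real_in_chart_dom[of \<epsilon> 0]
  by (intro bexI[of _ 0]) (auto simp: closed_segment_def scaleR_conv_of_real intro!: scale_in_chart_dom)

lemma simply_connected_chart_dom: "\<epsilon> > 0 \<Longrightarrow> simply_connected (chart_dom \<epsilon>)"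
  by (rule starlike_imp_simply_connected[OF starlike_chart_dom])

lemma connected_chart_dom: "\<epsilon> > 0 \<Longrightarrow> connected (chart_dom \<epsilon>)"
  by (rule starlike_imp_connected[OF starlike_chart_dom])

lemma convex_chart_left: "convex {u \<in> chart_dom \<epsilon>. Re u < 0}"
proof -
  have "{u \<in> chart_dom \<epsilon>. Re u < 0} =
    {u. Complex \<epsilon> 1 \<bullet> u < \<epsilon>} \<inter> {u. Complex \<epsilon> (-1) \<bullet> u < \<epsilon>} \<inter> {u. 1 \<bullet> u < 0}"
    by (auto simp: chart_dom_def inner_complex_def algebra_simps abs_if split: if_splits)
  then show ?thesis by (simp only: convex_Int convex_halfspace_lt)
qed

lemma convex_chart_right: "convex {u \<in> chart_dom \<epsilon>. Re u > 0}"
proof -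
  have "{u \<in> chart_dom \<epsilon>. Re u > 0} =
    {u. Complex (-\<epsilon>) 1 \<bullet> u < \<epsilon>} \<inter> {u. Complex (-\<epsilon>) (-1) \<bullet> u < \<epsilon>} \<inter> {u. 1 \<bullet> u > 0}"
    by (auto simp: chart_dom_def inner_complex_def algebra_simps abs_if split: if_splits)
  then show ?thesis by (simp only: convex_Int convex_halfspace_lt convex_halfspace_gt)
qed

lemma chart_dom_mono: "\<epsilon> \<le> \<epsilon>' \<Longrightarrow> chart_dom \<epsilon> \<subseteq> chart_dom \<epsilon>'"
  unfolding chart_dom_def
proof
  fix u :: complex
  assume "\<epsilon> \<le> \<epsilon>'" "u \<in> {u. \<bar>Im u\<bar> < \<epsilon> * (1 + \<bar>Re u\<bar>)}"
  moreover from this have "\<epsilon> * (1 + \<bar>Re u\<bar>) \<le> \<epsilon>' * (1 + \<bar>Re u\<bar>)" by (intro mult_right_mono) auto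
  ultimately show "u \<in> {u. \<bar>Im u\<bar> < \<epsilon>' * (1 + \<bar>Re u\<bar>)}" by simp
qed

text \<open>
  A solution of \<open>c * exp u = v\<close> has a fixed real part, and the cosine of its imaginary part is a fixed
  number \<open>k\<close>.  As \<open>v\<close> is not on the ray of \<open>c\<close>, \<open>k < 1\<close>, which keeps the imaginary part away from 0.
\<close>
lemma chart_dom_avoids_value:
  fixes c v :: complex
  assumes "norm c = 1" "v \<noteq> c * norm v"
  obtains \<epsilon> where "\<epsilon> > 0" "\<And>u. u \<in> chart_dom \<epsilon> \<Longrightarrow> c * exp u \<noteq> v"
proof (cases "v = 0")
  case True
  then show ?thesis using that[of 1] assms(1) by force
next
  case False
  define w where "w = v / c"
  have c0: "c \<noteq> 0" using assms(1) by force
  have w: "w \<noteq> norm w" "w \<noteq> 0" using assms False c0 by (auto simp: w_def norm_divide field_simps)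
  define k where "k = Re w / norm w"
  have "k < 1"
  proof -
    have "Re w \<noteq> norm w"
    proof
      assume e: "Re w = norm w"
      then have "Im w = 0" using cmod_power2[of w] by simp
      then show False using e w(1) by (auto simp: complex_eq_iff)
    qed
    then show ?thesis using w complex_Re_le_cmod[of w] by (auto simp: k_def divide_less_eq)
  qed
  have "continuous_on UNIV (cos :: real \<Rightarrow> real)" by (intro continuous_intros)
  then have "open {y::real. k < cos y}" by (intro open_Collect_less continuous_intros)
  then obtain \<eta> where \<eta>: "\<eta> > 0" "ball 0 \<eta> \<subseteq> {y::real. k < cos y}"
    using \<open>k < 1\<close> unfolding open_contains_ball by (metis cos_zero mem_Collect_eq)
  define \<epsilon> where "\<epsilon> = \<eta> / (1 + \<bar>ln (norm w)\<bar>)"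
  show ?thesis
  proof
    show "\<epsilon> > 0" using \<eta> by (simp add: \<epsilon>_def add_pos_nonneg)
    show "c * exp u \<noteq> v" if u: "u \<in> chart_dom \<epsilon>" for u
    proof
      assume "c * exp u = v"
      then have e: "exp u = w" using c0 by (auto simp: w_def)
      then have "Re u = ln (norm w)" using norm_exp_eq_Re[of u] by (metis ln_exp)
      then have "\<bar>Im u\<bar> < \<eta>" using u by (simp add: chart_dom_def \<epsilon>_def)
      then have "cos (Im u) > k" using \<eta>(2) by auto
      moreover have "Re w = norm w * cos (Im u)" using e norm_exp_eq_Re[of u] by (metis Re_exp)
      ultimately show False using w by (simp add: k_def)
    qed
  qed
qed

lemma chart_dom_avoids_finite:
  assumes "finite S"
  obtains c \<epsilon> where "norm c = 1" "\<epsilon> > 0" "\<And>u. u \<in> chart_dom \<epsilon> \<Longrightarrow> c * exp u \<notin> S"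
proof -
  have "infinite (sphere (0::complex) 1)"
  proof
    assume "finite (sphere (0::complex) 1)"
    then have "\<exists>a. sphere (0::complex) 1 \<subseteq> {a}"
      using connected_sphere[of "0::complex" 1] connected_finite_iff_sing[of "sphere (0::complex) 1"] by auto
    moreover have "(1::complex) \<in> sphere 0 1" "(-1::complex) \<in> sphere 0 1" by auto
    ultimately show False by (metis one_neq_neg_one singletonD subsetD)
  qed
  then obtain c :: complex where c: "norm c = 1" "c \<notin> (\<lambda>v. v / norm v) ` S"
    using assms by (metis finite_imageI finite_subset mem_sphere_0 subsetI)
  have "\<exists>\<epsilon>>0. \<forall>u \<in> chart_dom \<epsilon>. c * exp u \<noteq> v" if "v \<in> S" for v
  proof (cases "v = 0")
    case True
    then show ?thesis using c(1) by (intro exI[of _ 1]) auto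
  next
    case False
    then have "v \<noteq> c * norm v" using c(2) that
      by (metis (no_types, lifting) divide_eq_eq image_eqI norm_eq_zero of_real_eq_0_iff)
    then show ?thesis using chart_dom_avoids_value[OF c(1)] by metis
  qed
  then obtain e where e: "\<And>v. v \<in> S \<Longrightarrow> e v > 0 \<and> (\<forall>u \<in> chart_dom (e v). c * exp u \<noteq> v)" by metis
  show ?thesis
  proof
    show "norm c = 1" by (fact c)
    show "Min (insert 1 (e ` S)) > 0" using assms e by auto
    show "c * exp u \<notin> S" if u: "u \<in> chart_dom (Min (insert 1 (e ` S)))" for u
    proof
      assume v: "c * exp u \<in> S"
      then have "Min (insert 1 (e ` S)) \<le> e (c * exp u)" using assms by simp
      then show False using e[OF v] u chart_dom_mono by blast
    qed
  qed
qed

section \<open>Branches of the inverse of a polynomial\<close>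

text \<open>
  The branch is selected by its value \<open>x\<close> at \<open>u = 0\<close>: the points of the fiber over \<open>c\<close> serve as indices
  of the roots, for all values of the parameter.
\<close>
definition branch :: "complex poly \<Rightarrow> complex \<Rightarrow> real \<Rightarrow> complex \<Rightarrow> complex \<Rightarrow> complex" where
  "branch F c \<epsilon> x = (SOME W. continuous_on (chart_dom \<epsilon>) W \<and> W 0 = x \<and>
     (\<forall>u\<in>chart_dom \<epsilon>. poly F (W u) = c * exp u))"

locale slit_chart =
  fixes F :: "complex poly" and c :: complex and \<epsilon> :: real
  assumes degree_pos: "degree F > 0"
    and norm_c: "norm c = 1"
    and eps_pos: "\<epsilon> > 0"
    and regular: "u \<in> chart_dom \<epsilon> \<Longrightarrow> c * exp u \<notin> critical_values F"
begin

abbreviation U :: "complex set" where "U \<equiv> chart_dom \<epsilon>"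
abbreviation E :: "complex \<Rightarrow> complex" where "E \<equiv> \<lambda>u. c * exp u"
abbreviation X :: "complex set" where "X \<equiv> fiber F c"
abbreviation Z :: "complex \<Rightarrow> complex \<Rightarrow> complex" where "Z \<equiv> branch F c \<epsilon>"

lemma c_nonzero: "c \<noteq> 0" using norm_c by force
lemma norm_E: "norm (E u) = exp (Re u)" by (simp add: norm_mult norm_c)
lemma F_nonzero: "F \<noteq> 0" using degree_pos by auto
lemma zero_in_U: "0 \<in> U" using real_in_chart_dom[OF eps_pos, of 0] by simp
lemma finite_X: "finite X" by (rule finite_fiber[OF degree_pos])
lemma E_period: "E (u + turn l) = E u"
proof -
  have "exp (turn l) = (1::complex)"
    using exp_integer_2pi[of "of_nat l"] by (simp add: mult_ac)
  then show ?thesis by (simp add: exp_add)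
qed

lemma card_X: "card X = degree F"
  using card_fiber_regular[OF degree_pos] regular[OF zero_in_U] by simp

lemma branch_exists:
  assumes "x \<in> X"
  shows "continuous_on U (Z x) \<and> Z x 0 = x \<and> (\<forall>u\<in>U. poly F (Z x u) = E u)"
proof -
  have "x \<in> poly F -` (- critical_values F)" using assms regular[OF zero_in_U] by (simp add: fiber_def)
  moreover have "E \<in> U \<rightarrow> - critical_values F" using regular by auto
  moreover have "E 0 = poly F x" using assms by (simp add: fiber_def)
  moreover have "continuous_on U E" by (intro continuous_intros)
  ultimately obtain W where "continuous_on U W" "W 0 = x" "\<And>u. u \<in> U \<Longrightarrow> poly F (W u) = E u"
    using covering_space_lift_strong[OF regular_covering_space[OF degree_pos] _ zero_in_U
        simply_connected_chart_dom[OF eps_pos] open_imp_locally_path_connected[OF open_chart_dom], of x E]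
    by metis
  then show ?thesis unfolding branch_def by (intro someI_ex[of "\<lambda>W. continuous_on U W \<and> W 0 = x \<and> (\<forall>u\<in>U. poly F (W u) = E u)"]) auto
qed

lemma continuous_branch: "x \<in> X \<Longrightarrow> continuous_on U (Z x)"
  and branch_0: "x \<in> X \<Longrightarrow> Z x 0 = x"
  and branch_value: "\<lbrakk>x \<in> X; u \<in> U\<rbrakk> \<Longrightarrow> poly F (Z x u) = E u"
  using branch_exists by auto

lemma derivative_nonzero: "\<lbrakk>u \<in> U; poly F z = E u\<rbrakk> \<Longrightarrow> poly (pderiv F) z \<noteq> 0"
  using regular[of u] unfolding critical_values_def by force

lemma lift_unique:
  assumes "connected V" "V \<subseteq> U" "continuous_on V W" "continuous_on V W'"
    and "\<And>u. u \<in> V \<Longrightarrow> poly F (W u) = E u" "\<And>u. u \<in> V \<Longrightarrow> poly F (W' u) = E u"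
    and "a \<in> V" "W a = W' a" "u \<in> V"
  shows "W u = W' u"
proof (rule covering_space_lift_unique[OF regular_covering_space[OF degree_pos], where f = E and T = V and a = a and ?g1.0 = W and ?g2.0 = W' and x = u])
  have *: "E v \<notin> critical_values F" if "v \<in> V" for v using regular that assms(2) by blast
  show "E \<in> V \<rightarrow> - critical_values F" using * by auto
  show "W \<in> V \<rightarrow> poly F -` (- critical_values F)" using * assms(5) by auto
  show "W' \<in> V \<rightarrow> poly F -` (- critical_values F)" using * assms(6) by auto
  show "continuous_on V E" by (intro continuous_intros)
qed (use assms in auto)

lemma branch_unique:
  assumes "x \<in> X" "connected V" "V \<subseteq> U" "continuous_on V W" "\<And>u. u \<in> V \<Longrightarrow> poly F (W u) = E u"
    and "a \<in> V" "W a = Z x a" "u \<in> V"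
  shows "W u = Z x u"
  using lift_unique[OF assms(2-4) continuous_on_subset[OF continuous_branch[OF assms(1)] assms(3)] assms(5) _ assms(6-8)]
    branch_value[OF assms(1)] assms(3) by blast

lemma inj_branch: "u \<in> U \<Longrightarrow> inj_on (\<lambda>x. Z x u) X"
  using branch_unique[OF _ connected_chart_dom[OF eps_pos] subset_refl continuous_branch branch_value _ _ zero_in_U]
  by (intro inj_onI) (metis branch_0)

lemma bij_branch: "u \<in> U \<Longrightarrow> bij_betw (\<lambda>x. Z x u) X (fiber F (E u))"
  unfolding bij_betw_def using inj_branch[of u] inj_image_eq_if_card_le[OF finite_X, of "\<lambda>x. Z x u" "fiber F (E u)"]
    branch_value[of _ u] card_X card_fiber_regular[OF degree_pos regular, of u] finite_fiber[OF degree_pos]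
  by (auto simp: fiber_def)

lemma branch_through:
  assumes "u \<in> U" "poly F z = E u"
  obtains x where "x \<in> X" "Z x u = z"
  using bij_branch[OF assms(1)] assms(2) unfolding bij_betw_def fiber_def by force

lemma holomorphic_branch:
  assumes x: "x \<in> X"
  shows "Z x holomorphic_on U"
proof -
  have "Z x field_differentiable at u" if u: "u \<in> U" for u
  proof -
    have "poly (pderiv F) (Z x u) \<noteq> 0" using derivative_nonzero[OF u branch_value[OF x u]] .
    then obtain r where r: "r > 0" "inj_on (poly F) (ball (Z x u) r)"
      using poly_locally_invertible by metis
    obtain g where g: "g holomorphic_on poly F ` ball (Z x u) r" "\<And>z. z \<in> ball (Z x u) r \<Longrightarrow> g (poly F z) = z"
      using holomorphic_has_inverse[OF poly_holomorphic_on[OF holomorphic_on_ident] open_ball r(2)] by metis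
    have op: "open (poly F ` ball (Z x u) r)"
      by (rule open_mapping_thm3[OF poly_holomorphic_on[OF holomorphic_on_ident] open_ball r(2)])
    have "open (U \<inter> Z x -` ball (Z x u) r)"
      using continuous_open_preimage[OF continuous_branch[OF x] open_chart_dom open_ball] by simp
    then obtain d where d: "d > 0" "ball u d \<subseteq> U \<inter> Z x -` ball (Z x u) r"
      using u r(1) open_contains_ball by (metis IntI centre_in_ball vimageI)
    have eq: "g (E v) = Z x v" if "v \<in> ball u d" for v
      using g(2)[of "Z x v"] branch_value[OF x, of v] that d(2) by force
    have "(g \<circ> E) holomorphic_on ball u d"
    proof (rule holomorphic_on_compose_gen[OF _ g(1)])
      show "E holomorphic_on ball u d" by (intro holomorphic_intros)
      show "E ` ball u d \<subseteq> poly F ` ball (Z x u) r"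
      proof
        fix w assume "w \<in> E ` ball u d"
        then obtain v where v: "v \<in> ball u d" "w = E v" by blast
        then have "w = poly F (Z x v)" "Z x v \<in> ball (Z x u) r" using branch_value[OF x, of v] d(2) by auto
        then show "w \<in> poly F ` ball (Z x u) r" by blast
      qed
    qed
    then have "Z x holomorphic_on ball u d"
      by (rule holomorphic_transform) (use eq in auto)
    then show ?thesis using d(1) by (metis centre_in_ball holomorphic_on_imp_differentiable_at open_ball)
  qed
  then show ?thesis by (simp add: holomorphic_on_def field_differentiable_at_within)
qed

lemma branch_has_derivative:
  assumes x: "x \<in> X" and u: "u \<in> U"
  shows "(Z x has_field_derivative E u / poly (pderiv F) (Z x u)) (at u)"
proof -
  obtain D where D: "(Z x has_field_derivative D) (at u)"
    using holomorphic_branch[OF x] u open_chart_dom holomorphic_on_imp_differentiable_at field_differentiable_def by metis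
  have "((\<lambda>v. poly F (Z x v)) has_field_derivative poly (pderiv F) (Z x u) * D) (at u)"
    using DERIV_chain2[OF poly_DERIV D] .
  moreover have "((\<lambda>v. poly F (Z x v)) has_field_derivative E u) (at u)"
    by (rule has_field_derivative_transform_within_open[OF _ open_chart_dom u, of E])
      (auto intro!: derivative_eq_intros simp: branch_value[OF x])
  ultimately have "poly (pderiv F) (Z x u) * D = E u" by (rule DERIV_unique)
  then have "D = E u / poly (pderiv F) (Z x u)"
    using derivative_nonzero[OF u branch_value[OF x u]] by (simp add: field_simps)
  then show ?thesis using D by simp
qed

section \<open>Limits of the branches over zero\<close>

text \<open>
  The part of the domain where \<open>\<bar>c * exp u\<bar> < \<rho>\<close> is connected, and the branch maps it into a union of
  disjoint balls around the roots, hence into one of them.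
\<close>
lemma branch_stays_near_root:
  assumes x: "x \<in> X" and "\<rho> \<le> 1" "0 < \<rho>"
    and near: "\<And>z. norm (poly F z) < \<rho> \<Longrightarrow> \<exists>a. poly F a = 0 \<and> dist z a < r"
    and sep: "\<And>a b. \<lbrakk>poly F a = 0; poly F b = 0; a \<noteq> b\<rbrakk> \<Longrightarrow> 2 * r \<le> dist a b"
  obtains a where "poly F a = 0" "\<And>u. \<lbrakk>u \<in> U; norm (E u) < \<rho>\<rbrakk> \<Longrightarrow> dist (Z x u) a < r"
proof -
  define V where "V = {u \<in> U. norm (E u) < \<rho>}"
  have V: "V = {u \<in> U. Re u < 0} \<inter> {u. 1 \<bullet> u < ln \<rho>}"
  proof -
    have "exp (Re u) < \<rho> \<longleftrightarrow> Re u < ln \<rho>" for u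
      using assms(3) by (metis exp_less_cancel_iff exp_ln)
    moreover have "ln \<rho> \<le> 0" using assms by simp
    ultimately show ?thesis by (auto simp: V_def norm_E inner_complex_def)
  qed
  have "connected V" unfolding V
    by (intro convex_connected convex_Int convex_chart_left convex_halfspace_lt)
  have VU: "V \<subseteq> U" by (auto simp: V_def)
  let ?u = "complex_of_real (ln \<rho> - 1)"
  have "ln \<rho> \<le> 0" using assms(2,3) by simp
  then have "?u \<in> {u \<in> U. Re u < 0}" "1 \<bullet> ?u < ln \<rho>"
    using real_in_chart_dom[OF eps_pos, of "ln \<rho> - 1"] by (auto simp: inner_complex_def)
  then have uV: "?u \<in> V" unfolding V by blast
  have cov: "\<exists>a. poly F a = 0 \<and> dist (Z x u) a < r" if "u \<in> V" for u
    using near[of "Z x u"] branch_value[OF x, of u] that by (auto simp: V_def)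
  obtain a where a: "poly F a = 0" "dist (Z x ?u) a < r" using cov[OF uV] by blast
  \<comment> \<open>the balls around the other roots\<close>
  define O2 where "O2 = (\<Union>b\<in>{b. poly F b = 0} - {a}. ball b r)"
  have "connected (Z x ` V)"
    using \<open>connected V\<close> continuous_on_subset[OF continuous_branch[OF x] VU] connected_continuous_image by blast
  moreover have "ball a r \<inter> O2 = {}"
  proof -
    have "ball a r \<inter> ball b r = {}" if "poly F b = 0" "b \<noteq> a" for b
      using sep[OF a(1) that(1)] that by (intro disjoint_ballI) auto
    then show ?thesis by (auto simp: O2_def)
  qed
  moreover have "Z x ` V \<subseteq> ball a r \<union> O2"
  proof
    fix w assume "w \<in> Z x ` V"
    then obtain b where "poly F b = 0" "dist w b < r" using cov by blast
    then show "w \<in> ball a r \<union> O2" by (cases "b = a") (auto simp: O2_def dist_commute)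
  qed
  moreover have "open O2" unfolding O2_def by blast
  moreover have "ball a r \<inter> Z x ` V \<noteq> {}" using a(2) uV by (auto simp: dist_commute)
  ultimately have "O2 \<inter> Z x ` V = {}"
    using connectedD[of "Z x ` V" "ball a r" O2] by (simp add: Int_assoc)
  then have "Z x ` V \<subseteq> ball a r" using \<open>Z x ` V \<subseteq> ball a r \<union> O2\<close> by blast
  then have "dist (Z x u) a < r" if "u \<in> U" "norm (E u) < \<rho>" for u
    using that by (force simp: V_def dist_commute)
  then show ?thesis by (rule that[OF a(1)])
qed

text \<open>
  The balls that belong to different radii have a common center, since each of them contains the
  values of the branch far to the left.
\<close>
lemma branch_tends_to_root:
  assumes x: "x \<in> X"
  shows "\<exists>!a. poly F a = 0 \<and> (\<forall>r>0. \<exists>M>0. \<forall>u\<in>U. Re u < - M \<longrightarrow> dist (Z x u) a < r)"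
proof -
  have fin: "finite {a. poly F a = 0}" using poly_roots_finite[OF F_nonzero] .
  obtain \<delta> where \<delta>: "\<delta> > 0" "\<And>a b. \<lbrakk>poly F a = 0; poly F b = 0; a \<noteq> b\<rbrakk> \<Longrightarrow> \<delta> \<le> dist a b"
    using finite_separated[OF fin] by auto
  have ex: "\<exists>a M. poly F a = 0 \<and> M > 0 \<and> (\<forall>u\<in>U. Re u < - M \<longrightarrow> dist (Z x u) a < r)"
    if r: "r > 0" "2 * r \<le> \<delta>" for r
  proof -
    obtain \<rho> where \<rho>: "\<rho> > 0" "\<And>z. norm (poly F z) < \<rho> \<Longrightarrow> \<exists>a. poly F a = 0 \<and> dist z a < r"
      using small_value_near_root[OF degree_pos r(1)] by metis
    have "min \<rho> 1 > 0" "min \<rho> 1 \<le> 1" using \<rho>(1) by auto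
    then obtain a where a: "poly F a = 0" "\<And>u. \<lbrakk>u \<in> U; norm (E u) < min \<rho> 1\<rbrakk> \<Longrightarrow> dist (Z x u) a < r"
      using branch_stays_near_root[OF x, of "min \<rho> 1" r] \<rho> \<delta> r by (metis min_less_iff_conj order_trans)
    define M where "M = 1 + \<bar>ln (min \<rho> 1)\<bar>"
    have "M > 0" by (simp add: M_def add_pos_nonneg)
    moreover have "norm (E u) < min \<rho> 1" if "Re u < - M" for u
    proof -
      have "Re u < ln (min \<rho> 1)" using that by (simp add: M_def)
      then show ?thesis unfolding norm_E using \<open>min \<rho> 1 > 0\<close> by (metis exp_less_cancel_iff exp_ln)
    qed
    ultimately show ?thesis using a by blast
  qed
  obtain a M0 where a: "poly F a = 0" "M0 > 0" "\<And>u. \<lbrakk>u \<in> U; Re u < - M0\<rbrakk> \<Longrightarrow> dist (Z x u) a < \<delta> / 2"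
    using ex[of "\<delta>/2"] \<delta> by auto
  have lim: "\<exists>M>0. \<forall>u\<in>U. Re u < - M \<longrightarrow> dist (Z x u) a < r" if r: "r > 0" for r
  proof -
    obtain b M where b: "poly F b = 0" "M > 0" "\<And>u. \<lbrakk>u \<in> U; Re u < - M\<rbrakk> \<Longrightarrow> dist (Z x u) b < min r (\<delta>/2)"
      using ex[of "min r (\<delta>/2)"] r \<delta>(1)
      by fastforce
    let ?u = "complex_of_real (- M - M0)"
    have "dist (Z x ?u) a < \<delta> / 2" "dist (Z x ?u) b < \<delta> / 2"
      using a(3)[of ?u] b(3)[of ?u] a(2) b(2) real_in_chart_dom[OF eps_pos, of "-M - M0"] by auto
    then have "dist a b < \<delta>" using dist_triangle_half_r by (metis dist_commute)
    then have "a = b" using \<delta>(2)[OF a(1) b(1)] by linarith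
    then show ?thesis using b by auto
  qed
  show ?thesis
  proof (rule ex1I[of _ a])
    show "poly F a = 0 \<and> (\<forall>r>0. \<exists>M>0. \<forall>u\<in>U. Re u < - M \<longrightarrow> dist (Z x u) a < r)" using a(1) lim by blast
    fix b assume b: "poly F b = 0 \<and> (\<forall>r>0. \<exists>M>0. \<forall>u\<in>U. Re u < - M \<longrightarrow> dist (Z x u) b < r)"
    then obtain M where M: "M > 0" "\<And>u. \<lbrakk>u \<in> U; Re u < - M\<rbrakk> \<Longrightarrow> dist (Z x u) b < \<delta> / 2"
      using \<delta>(1) half_gt_zero by metis
    let ?u = "complex_of_real (- M - M0)"
    have "dist (Z x ?u) a < \<delta> / 2" "dist (Z x ?u) b < \<delta> / 2"
      using a(3)[of ?u] M(2)[of ?u] a(2) M(1) real_in_chart_dom[OF eps_pos, of "-M - M0"] by auto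
    then have "dist a b < \<delta>" using dist_triangle_half_r by (metis dist_commute)
    then show "b = a" using \<delta>(2)[OF a(1), of b] b by force
  qed
qed

end

section \<open>Logarithmic form of a polynomial at a root and at infinity\<close>

text \<open>
  Dividing \<open>Y\<close> by the exponential leaves a continuous function with values among the \<open>\<mu>\<close>-th roots of
  unity.
\<close>
lemma power_exp_representation:
  fixes Y \<kappa> :: "complex \<Rightarrow> complex"
  assumes "connected V" "continuous_on V Y" "continuous_on V \<kappa>" "\<mu> > 0"
    and eq: "\<And>u. u \<in> V \<Longrightarrow> Y u ^ \<mu> = exp (u - \<kappa> u)"
  shows "\<exists>k. k \<noteq> 0 \<and> (\<forall>u\<in>V. Y u = k * exp ((u - \<kappa> u) / of_nat \<mu>))"
proof (cases "V = {}")
  case True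
  then show ?thesis by (intro exI[of _ 1]) simp
next
  case False
  define \<phi> where "\<phi> = (\<lambda>u. Y u * exp (- ((u - \<kappa> u) / of_nat \<mu>)))"
  have pow: "\<phi> u ^ \<mu> = 1" if "u \<in> V" for u
  proof -
    have "exp (- ((u - \<kappa> u) / of_nat \<mu>)) ^ \<mu> = exp (- (u - \<kappa> u))"
      using \<open>\<mu> > 0\<close> by (simp flip: exp_of_nat_mult)
    then show ?thesis using eq[OF that] by (simp add: \<phi>_def power_mult_distrib flip: exp_add)
  qed
  have "finite {z::complex. z ^ \<mu> = 1}" using \<open>\<mu> > 0\<close> by (simp add: finite_roots_unity)
  then have "finite (\<phi> ` V)" by (rule finite_subset[rotated]) (use pow in auto)
  moreover have "continuous_on V \<phi>" unfolding \<phi>_def using assms by (intro continuous_intros) auto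
  ultimately have "\<phi> constant_on V" using continuous_finite_range_constant[OF \<open>connected V\<close>] by blast
  then obtain k where k: "\<And>u. u \<in> V \<Longrightarrow> \<phi> u = k" unfolding constant_on_def by blast
  show ?thesis
  proof (intro exI conjI ballI)
    show "k \<noteq> 0" using False pow k \<open>\<mu> > 0\<close> by (metis ex_in_conv zero_neq_one power_0_left less_numeral_extra(3))
    show "Y u = k * exp ((u - \<kappa> u) / of_nat \<mu>)" if "u \<in> V" for u
      using k[OF that] by (auto simp: \<phi>_def mult.assoc simp flip: exp_add)
  qed
qed

lemma nonzero_poly_local_log:
  fixes q :: "complex poly"
  assumes "poly q a \<noteq> 0"
  obtains r K where "r > 0" "continuous_on (ball a r) K" "\<And>z. z \<in> ball a r \<Longrightarrow> poly q z = exp (K z)"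
proof -
  have "open (poly q -` (- {0}))" by (rule open_vimage[OF _ continuous_on_poly_fun]) auto
  then obtain r where r: "r > 0" "ball a r \<subseteq> poly q -` (- {0})"
    using assms unfolding open_contains_ball by blast
  have nz: "poly q z \<noteq> 0" if "z \<in> ball a r" for z using r(2) that by blast
  obtain K where "K holomorphic_on ball a r" "\<And>z. z \<in> ball a r \<Longrightarrow> poly q z = exp (K z)"
    using contractible_imp_holomorphic_log[OF poly_holomorphic_on[OF holomorphic_on_ident]
        convex_imp_contractible[OF convex_ball] nz] by metis
  then show ?thesis using that r(1) holomorphic_on_imp_continuous_on by blast
qed

lemma poly_form_at_root:
  fixes F :: "complex poly"
  assumes "F \<noteq> 0" "poly F a = 0"
  obtains r K where "r > 0" "continuous_on (ball a r) K"
    "\<And>z. z \<in> ball a r \<Longrightarrow> poly F z = (z - a) ^ order a F * exp (K z)"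
proof -
  obtain q where q: "F = [:-a, 1:] ^ order a F * q" "\<not> [:-a, 1:] dvd q"
    using order_decomp[OF assms(1)] by blast
  then have "poly q a \<noteq> 0" by (simp add: poly_eq_0_iff_dvd)
  then obtain r K where "r > 0" "continuous_on (ball a r) K" "\<And>z. z \<in> ball a r \<Longrightarrow> poly q z = exp (K z)"
    using nonzero_poly_local_log by metis
  moreover have "poly F z = (z - a) ^ order a F * poly q z" for z
    by (subst q(1)) (simp add: poly_power)
  ultimately show ?thesis using that by simp
qed

text \<open>
  The cofactor of \<open>z ^ degree F\<close> is the reflected polynomial at \<open>1 / z\<close>, and it does not vanish for
  \<open>1 / z\<close> near 0.
\<close>
lemma poly_form_at_infinity:
  fixes F :: "complex poly"
  assumes "F \<noteq> 0"
  obtains R K where "R > 0" "continuous_on {z. norm z > R} K"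
    "\<And>z. norm z > R \<Longrightarrow> poly F z = z ^ degree F * exp (K z)"
proof -
  have "poly (reflect_poly F) 0 \<noteq> 0" using assms by simp
  then obtain r K where K: "r > 0" "continuous_on (ball 0 r) K" "\<And>z. z \<in> ball 0 r \<Longrightarrow> poly (reflect_poly F) z = exp (K z)"
    using nonzero_poly_local_log by metis
  have inv: "inverse z \<in> ball 0 r" "z \<noteq> 0" if "norm z > 1 / r" for z :: complex
  proof -
    show "z \<noteq> 0" using that K(1) by force
    then show "inverse z \<in> ball 0 r" using that K(1) by (simp add: norm_inverse inverse_eq_divide norm_divide field_simps)
  qed
  show ?thesis
  proof
    show "1 / r > 0" using K(1) by simp
    show "continuous_on {z. norm z > 1 / r} (\<lambda>z. K (inverse z))"
      by (rule continuous_on_compose2[OF K(2)]) (use inv in \<open>auto intro!: continuous_intros\<close>)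
    show "poly F z = z ^ degree F * exp (K (inverse z))" if "norm z > 1 / r" for z
      using K(3)[OF inv(1)[OF that]] poly_reflect_poly_nz[of "inverse z" F] inv(2)[OF that]
      by (simp add: field_simps)
  qed
qed

lemma poly_large_value_imp_large:
  fixes F :: "complex poly"
  obtains M where "M > 0" "\<And>z. norm (poly F z) > M \<Longrightarrow> norm z > R"
proof -
  have "compact (poly F ` cball 0 R)"
    by (rule compact_continuous_image[OF continuous_on_poly_fun compact_cball])
  then obtain M where "M > 0" "\<forall>w \<in> poly F ` cball 0 R. norm w \<le> M"
    using compact_imp_bounded bounded_pos by blast
  then show ?thesis using that by (force simp: not_less[symmetric])
qed

lemma exp_root_eq_1_imp_dvd:
  assumes "\<mu> > 0" "exp (turn l / of_nat \<mu>) = (1::complex)"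
  shows "\<mu> dvd l"
proof -
  obtain n :: int where "2 * pi * of_nat l / of_nat \<mu> = of_int (2 * n) * pi"
    using assms(2) unfolding exp_eq_1 by auto
  then have "real l = of_int n * real \<mu>" using assms(1) by (simp add: field_simps)
  then have "int l = n * int \<mu>" by (metis of_int_eq_iff of_int_mult of_int_of_nat_eq)
  then show ?thesis by (metis dvd_triv_right int_dvd_int_iff)
qed

lemma equal_root_representation_imp_dvd:
  fixes k u \<kappa> :: complex
  assumes "\<mu> > 0" "k \<noteq> 0" "k * exp ((u - \<kappa>) / of_nat \<mu>) = k * exp ((u + turn l - \<kappa>) / of_nat \<mu>)"
  shows "\<mu> dvd l"
proof (rule exp_root_eq_1_imp_dvd[OF assms(1)])
  have "(u + turn l - \<kappa>) / of_nat \<mu> = (u - \<kappa>) / of_nat \<mu> + turn l / of_nat \<mu>"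
    by (simp add: diff_divide_distrib add_divide_distrib)
  then show "exp (turn l / of_nat \<mu>) = 1" using assms(2,3) by (simp add: exp_add)
qed

lemma funpow_cancel_on_permutes:
  assumes "\<sigma> permutes X" "(\<sigma> ^^ i) x = (\<sigma> ^^ j) x" "i \<le> j"
  shows "(\<sigma> ^^ (j - i)) x = x"
proof -
  have "(\<sigma> ^^ i) ((\<sigma> ^^ (j - i)) x) = (\<sigma> ^^ i) x"
    using assms by (metis funpow_add le_add_diff_inverse o_apply)
  moreover have "inj (\<sigma> ^^ i)" using assms(1) permutes_inj inj_fn by blast
  ultimately show ?thesis by (simp add: inj_eq)
qed

lemma funpow_in_permutes: "\<sigma> permutes X \<Longrightarrow> x \<in> X \<Longrightarrow> (\<sigma> ^^ l) x \<in> X"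
  by (induction l) (auto simp: permutes_in_image)

text \<open>
  The root of \<open>F\<close> from which the branch \<open>x\<close> issues, that is, its limit as \<open>c * exp u\<close> tends to 0.
\<close>
definition root_end :: "complex poly \<Rightarrow> complex \<Rightarrow> real \<Rightarrow> complex \<Rightarrow> complex" where
  "root_end F c \<epsilon> x = (THE a. poly F a = 0 \<and>
     (\<forall>r>0. \<exists>M>0. \<forall>u\<in>chart_dom \<epsilon>. Re u < - M \<longrightarrow> dist (branch F c \<epsilon> x u) a < r))"

text \<open>
  With the part \<open>Re u < 0\<close> for \<open>V\<close>, such a permutation is the monodromy of a small circle around 0; with
  the part \<open>Re u > 0\<close>, it is the monodromy of a large circle, which surrounds all critical values.
\<close>
definition is_shift :: "complex poly \<Rightarrow> complex \<Rightarrow> real \<Rightarrow> complex set \<Rightarrow> (complex \<Rightarrow> complex) \<Rightarrow> bool" where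
  "is_shift F c \<epsilon> V \<sigma> \<longleftrightarrow> \<sigma> permutes fiber F c \<and>
     (\<forall>x\<in>fiber F c. \<forall>l u. u \<in> V \<longrightarrow> u + turn l \<in> V \<longrightarrow>
        branch F c \<epsilon> x (u + turn l) = branch F c \<epsilon> ((\<sigma> ^^ l) x) u)"

definition left_shift :: "complex poly \<Rightarrow> complex \<Rightarrow> real \<Rightarrow> complex \<Rightarrow> complex" where
  "left_shift F c \<epsilon> = (SOME \<sigma>. is_shift F c \<epsilon> {u \<in> chart_dom \<epsilon>. Re u < 0} \<sigma>)"

definition right_shift :: "complex poly \<Rightarrow> complex \<Rightarrow> real \<Rightarrow> complex \<Rightarrow> complex" where
  "right_shift F c \<epsilon> = (SOME \<sigma>. is_shift F c \<epsilon> {u \<in> chart_dom \<epsilon>. Re u > 0} \<sigma>)"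

lemma far_in_chart_dom:
  assumes "\<epsilon> > 0" "\<bar>s\<bar> \<ge> \<bar>Im y\<bar> / \<epsilon> + \<bar>Re y\<bar>"
  shows "complex_of_real s + y \<in> chart_dom \<epsilon>"
proof -
  have "\<bar>Im y\<bar> / \<epsilon> \<le> \<bar>s + Re y\<bar>" using assms(2) by linarith
  then have "\<bar>Im y\<bar> \<le> \<epsilon> * \<bar>s + Re y\<bar>" using assms(1) by (simp add: divide_le_eq mult.commute)
  then show ?thesis using assms(1) by (simp add: chart_dom_def distrib_left)
qed

context slit_chart
begin

abbreviation \<zeta> where "\<zeta> \<equiv> root_end F c \<epsilon>"
abbreviation \<sigma> where "\<sigma> \<equiv> left_shift F c \<epsilon>"
abbreviation \<tau> where "\<tau> \<equiv> right_shift F c \<epsilon>"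

lemma root_end_root: "x \<in> X \<Longrightarrow> poly F (\<zeta> x) = 0"
  and root_end_near: "x \<in> X \<Longrightarrow> r > 0 \<Longrightarrow> \<exists>M>0. \<forall>u\<in>U. Re u < - M \<longrightarrow> dist (Z x u) (\<zeta> x) < r"
  using theI'[OF branch_tends_to_root[of x]] unfolding root_end_def by auto

lemma root_end_near_uniform:
  assumes "r > 0"
  obtains M where "M > 0" "\<And>x u. \<lbrakk>x \<in> X; u \<in> U; Re u < - M\<rbrakk> \<Longrightarrow> dist (Z x u) (\<zeta> x) < r"
proof -
  obtain m where m: "\<And>x. x \<in> X \<Longrightarrow> m x > 0 \<and> (\<forall>u\<in>U. Re u < - m x \<longrightarrow> dist (Z x u) (\<zeta> x) < r)"
    using root_end_near[OF _ assms] by metis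
  have le: "m x \<le> Max (insert 1 (m ` X))" if "x \<in> X" for x using that finite_X by simp
  have "Max (insert 1 (m ` X)) \<ge> 1" using finite_X by simp
  then show ?thesis using that[of "Max (insert 1 (m ` X))"] m le by fastforce
qed

lemma eventually_far_left: "eventually (\<lambda>s. complex_of_real s + y \<in> U \<and> Re (complex_of_real s + y) < - M) at_bot"
proof -
  have "eventually (\<lambda>s. s < - (\<bar>Im y\<bar> / \<epsilon> + \<bar>Re y\<bar> + \<bar>M\<bar>)) at_bot" by (rule eventually_gt_at_bot)
  then show ?thesis
  proof eventually_elim
    case (elim s)
    have "0 \<le> \<bar>Im y\<bar> / \<epsilon>" using eps_pos by simp
    then have "\<bar>s\<bar> \<ge> \<bar>Im y\<bar> / \<epsilon> + \<bar>Re y\<bar>" "s + Re y < - M" using elim by linarith+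
    then show ?case using far_in_chart_dom[OF eps_pos, of y s] by simp
  qed
qed

lemma eventually_far_right: "eventually (\<lambda>s. complex_of_real s + y \<in> U \<and> Re (complex_of_real s + y) > M) at_top"
proof -
  have "eventually (\<lambda>s. s > (\<bar>Im y\<bar> / \<epsilon> + \<bar>Re y\<bar> + \<bar>M\<bar>)) at_top" by (rule eventually_gt_at_top)
  then show ?thesis
  proof eventually_elim
    case (elim s)
    have "0 \<le> \<bar>Im y\<bar> / \<epsilon>" using eps_pos by simp
    then have "\<bar>s\<bar> \<ge> \<bar>Im y\<bar> / \<epsilon> + \<bar>Re y\<bar>" "s + Re y > M" using elim by linarith+
    then show ?case using far_in_chart_dom[OF eps_pos, of y s] by simp
  qed
qed

lemma far_left_real:
  obtains s where "complex_of_real s \<in> U" "s < M" "complex_of_real s + y \<in> U"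
proof -
  define s where "s = - (\<bar>Im y\<bar> / \<epsilon> + \<bar>Re y\<bar> + \<bar>M\<bar> + 1)"
  have "0 \<le> \<bar>Im y\<bar> / \<epsilon>" using eps_pos by simp
  then have "s < M" "\<bar>s\<bar> \<ge> \<bar>Im y\<bar> / \<epsilon> + \<bar>Re y\<bar>" unfolding s_def by linarith+
  then show ?thesis using that real_in_chart_dom[OF eps_pos] far_in_chart_dom[OF eps_pos] by blast
qed

lemma far_right_real:
  obtains s where "complex_of_real s \<in> U" "s > M" "complex_of_real s + y \<in> U"
proof -
  define s where "s = \<bar>Im y\<bar> / \<epsilon> + \<bar>Re y\<bar> + \<bar>M\<bar> + 1"
  have "0 \<le> \<bar>Im y\<bar> / \<epsilon>" using eps_pos by simp
  then have "s > M" "\<bar>s\<bar> \<ge> \<bar>Im y\<bar> / \<epsilon> + \<bar>Re y\<bar>" unfolding s_def by linarith+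
  then show ?thesis using that real_in_chart_dom[OF eps_pos] far_in_chart_dom[OF eps_pos] by blast
qed

lemma root_end_limit: "x \<in> X \<Longrightarrow> ((\<lambda>s. Z x (complex_of_real s + y)) \<longlongrightarrow> \<zeta> x) at_bot"
proof (rule tendstoI)
  fix r :: real assume "x \<in> X" "r > 0"
  then obtain M where "M > 0" "\<forall>u\<in>U. Re u < - M \<longrightarrow> dist (Z x u) (\<zeta> x) < r" using root_end_near by blast
  then show "eventually (\<lambda>s. dist (Z x (complex_of_real s + y)) (\<zeta> x) < r) at_bot"
    using eventually_far_left[of y M] by (auto elim: eventually_mono)
qed

lemma branch_near_root_end:
  assumes x: "x \<in> X" and "\<rho> \<le> 1" "0 < \<rho>"
    and near: "\<And>z. norm (poly F z) < \<rho> \<Longrightarrow> \<exists>a. poly F a = 0 \<and> dist z a < r"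
    and sep: "\<And>a b. \<lbrakk>poly F a = 0; poly F b = 0; a \<noteq> b\<rbrakk> \<Longrightarrow> 2 * r \<le> dist a b"
    and u: "u \<in> U" "norm (E u) < \<rho>"
  shows "dist (Z x u) (\<zeta> x) < r"
proof -
  obtain a where a: "poly F a = 0" "\<And>u. \<lbrakk>u \<in> U; norm (E u) < \<rho>\<rbrakk> \<Longrightarrow> dist (Z x u) a < r"
    using branch_stays_near_root[OF assms(1-5)] by blast
  then have "r > 0" using u by (metis dist_not_less_zero linorder_neqE_linordered_idom order_less_trans)
  have "eventually (\<lambda>s. dist (Z x (complex_of_real s + 0)) (\<zeta> x) < r) at_bot"
    using root_end_limit[OF x, of 0] \<open>r > 0\<close> by (rule tendstoD)
  moreover have "eventually (\<lambda>s. complex_of_real s + 0 \<in> U \<and> Re (complex_of_real s + 0) < - (- ln \<rho>)) at_bot"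
    by (rule eventually_far_left)
  ultimately have "eventually (\<lambda>s::real. dist a (\<zeta> x) < 2 * r) at_bot"
  proof eventually_elim
    case (elim s)
    have "norm (E (complex_of_real s + 0)) < \<rho>"
      unfolding norm_E using elim \<open>0 < \<rho>\<close> by (metis exp_less_cancel_iff exp_ln minus_minus)
    then have "dist (Z x (complex_of_real s + 0)) a < r" using a(2) elim by blast
    then show ?case using elim(1) dist_triangle_less_add by (metis mult_2 dist_commute)
  qed
  then have "dist a (\<zeta> x) < 2 * r" by simp
  then have "a = \<zeta> x" using sep[OF a(1) root_end_root[OF x]] by fastforce
  then show ?thesis using a u by blast
qed

lemma convex_far_left: "M \<ge> 0 \<Longrightarrow> convex {u \<in> U. Re u < - M}"
proof -
  assume "M \<ge> 0"
  then have "{u \<in> U. Re u < - M} = {u \<in> U. Re u < 0} \<inter> {u. 1 \<bullet> u < - M}"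
    by (auto simp: inner_complex_def)
  then show ?thesis by (simp only: convex_Int convex_chart_left convex_halfspace_lt)
qed

lemma convex_far_right: "M \<ge> 0 \<Longrightarrow> convex {u \<in> U. Re u > M}"
proof -
  assume "M \<ge> 0"
  then have "{u \<in> U. Re u > M} = {u \<in> U. Re u > 0} \<inter> {u. 1 \<bullet> u > M}"
    by (auto simp: inner_complex_def)
  then show ?thesis by (simp only: convex_Int convex_chart_right convex_halfspace_gt)
qed

text \<open>
  A closed form of the Puiseux expansion.  The correction \<open>K\<close> is a function of the value of the branch
  alone; if the branch returns to its value after some turns, then so does the correction.
\<close>
lemma branch_representation:
  assumes x: "x \<in> X" and V: "connected V" "V \<subseteq> U" and S: "continuous_on S K" "Z x ` V \<subseteq> S" and "\<mu> > 0"
    and F: "\<And>z. z \<in> S \<Longrightarrow> poly F z = (z - a) ^ \<mu> * exp (K z)"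
  shows "continuous_on V (\<lambda>u. K (Z x u))"
    and "\<exists>k. k \<noteq> 0 \<and> (\<forall>u\<in>V. Z x u - a = k * exp ((u - K (Z x u)) / of_nat \<mu>))"
proof -
  have contZ: "continuous_on V (Z x)" using continuous_branch[OF x] V(2) continuous_on_subset by blast
  show cont: "continuous_on V (\<lambda>u. K (Z x u))"
    by (rule continuous_on_compose2[OF S(1) contZ S(2)])
  obtain \<gamma> where \<gamma>: "c = exp \<gamma>" using c_nonzero exp_Ln by metis
  have "(Z x u - a) ^ \<mu> = exp (u - (K (Z x u) - \<gamma>))" if "u \<in> V" for u
  proof -
    have "(Z x u - a) ^ \<mu> * exp (K (Z x u)) = exp (\<gamma> + u)"
    proof -
      have "Z x u \<in> S" "u \<in> U" using that V(2) S(2) by auto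
      then show ?thesis using F[of "Z x u"] branch_value[OF x, of u] by (simp add: exp_add flip: \<gamma>)
    qed
    then show ?thesis by (simp add: exp_diff exp_add field_simps)
  qed
  then have "\<exists>k. k \<noteq> 0 \<and> (\<forall>u\<in>V. Z x u - a = k * exp ((u - (K (Z x u) - \<gamma>)) / of_nat \<mu>))"
    by (rule power_exp_representation[OF V(1) continuous_on_diff[OF contZ continuous_on_const]
        continuous_on_diff[OF cont continuous_on_const] \<open>\<mu> > 0\<close>])
  then obtain k where k: "k \<noteq> 0" "\<And>u. u \<in> V \<Longrightarrow> Z x u - a = k * exp ((u - (K (Z x u) - \<gamma>)) / of_nat \<mu>)"
    by blast
  have "Z x u - a = (k * exp (\<gamma> / of_nat \<mu>)) * exp ((u - K (Z x u)) / of_nat \<mu>)" if "u \<in> V" for u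
  proof -
    have "(u - (K (Z x u) - \<gamma>)) / of_nat \<mu> = \<gamma> / of_nat \<mu> + (u - K (Z x u)) / of_nat \<mu>"
      by (simp flip: add_divide_distrib)
    then show ?thesis using k(2)[OF that] by (simp add: exp_add)
  qed
  then show "\<exists>k. k \<noteq> 0 \<and> (\<forall>u\<in>V. Z x u - a = k * exp ((u - K (Z x u)) / of_nat \<mu>))"
    using k(1) by (intro exI[of _ "k * exp (\<gamma> / of_nat \<mu>)"]) auto
qed

lemma branch_representation_left:
  assumes a: "poly F a = 0"
  obtains M K where "M > 0"
    "\<And>x. \<lbrakk>x \<in> X; \<zeta> x = a\<rbrakk> \<Longrightarrow> continuous_on {u \<in> U. Re u < - M} (\<lambda>u. K (Z x u))"
    "\<And>x. \<lbrakk>x \<in> X; \<zeta> x = a\<rbrakk> \<Longrightarrow> \<exists>k. k \<noteq> 0 \<and> (\<forall>u\<in>{u \<in> U. Re u < - M}. Z x u - a = k * exp ((u - K (Z x u)) / of_nat (order a F)))"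
proof -
  obtain r K where K: "r > 0" "continuous_on (ball a r) K"
    "\<And>z. z \<in> ball a r \<Longrightarrow> poly F z = (z - a) ^ order a F * exp (K z)"
    using poly_form_at_root[OF F_nonzero a] by metis
  obtain M where M: "M > 0" "\<And>x u. \<lbrakk>x \<in> X; u \<in> U; Re u < - M\<rbrakk> \<Longrightarrow> dist (Z x u) (\<zeta> x) < r"
    using root_end_near_uniform[OF K(1)] by metis
  have conn: "connected {u \<in> U. Re u < - M}" using convex_far_left[of M] M(1) convex_connected by auto
  have ord: "order a F > 0" using a F_nonzero order_root by blast
  have sub: "Z x ` {u \<in> U. Re u < - M} \<subseteq> ball a r" if "x \<in> X" "\<zeta> x = a" for x
    using M(2)[OF that(1)] that(2) by (auto simp: dist_commute)
  have VU: "{u \<in> U. Re u < - M} \<subseteq> U" by auto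
  show ?thesis
  proof (rule that[OF M(1)])
    fix x assume x: "x \<in> X" "\<zeta> x = a"
    show "continuous_on {u \<in> U. Re u < - M} (\<lambda>u. K (Z x u))"
      by (rule branch_representation(1)[OF x(1) conn VU K(2) sub[OF x] ord K(3)])
    show "\<exists>k. k \<noteq> 0 \<and> (\<forall>u\<in>{u \<in> U. Re u < - M}. Z x u - a = k * exp ((u - K (Z x u)) / of_nat (order a F)))"
      by (rule branch_representation(2)[OF x(1) conn VU K(2) sub[OF x] ord K(3)])
  qed
qed

lemma large_right:
  obtains M where "M > 0" "\<And>x u. \<lbrakk>x \<in> X; u \<in> U; Re u > M\<rbrakk> \<Longrightarrow> norm (Z x u) > R"
proof -
  obtain M where M: "M > 0" "\<And>z. norm (poly F z) > M \<Longrightarrow> norm z > R"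
    using poly_large_value_imp_large by metis
  have "norm (Z x u) > R" if "x \<in> X" "u \<in> U" "Re u > M" for x u
  proof (rule M(2))
    have "M < exp (Re u)" using that(3) exp_ge_add_one_self[of "Re u"] by linarith
    then show "norm (poly F (Z x u)) > M" using that by (simp add: branch_value norm_E)
  qed
  then show ?thesis using that M(1) by blast
qed

lemma branch_representation_right:
  obtains M K where "M > 0"
    "\<And>x. x \<in> X \<Longrightarrow> continuous_on {u \<in> U. Re u > M} (\<lambda>u. K (Z x u))"
    "\<And>x. x \<in> X \<Longrightarrow> \<exists>k. k \<noteq> 0 \<and> (\<forall>u\<in>{u \<in> U. Re u > M}. Z x u = k * exp ((u - K (Z x u)) / of_nat (degree F)))"
proof -
  obtain R K where K: "R > 0" "continuous_on {z. norm z > R} K"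
    "\<And>z. norm z > R \<Longrightarrow> poly F z = z ^ degree F * exp (K z)"
    using poly_form_at_infinity[OF F_nonzero] by metis
  obtain M where M: "M > 0" "\<And>x u. \<lbrakk>x \<in> X; u \<in> U; Re u > M\<rbrakk> \<Longrightarrow> norm (Z x u) > R"
    using large_right by metis
  have conn: "connected {u \<in> U. Re u > M}" using convex_far_right[of M] M(1) convex_connected by auto
  have sub: "Z x ` {u \<in> U. Re u > M} \<subseteq> {z. norm z > R}" if "x \<in> X" for x
    using M(2)[OF that] by auto
  have VU: "{u \<in> U. Re u > M} \<subseteq> U" by auto
  have K3: "poly F z = (z - 0) ^ degree F * exp (K z)" if "z \<in> {z. norm z > R}" for z
    using K(3) that by simp
  show ?thesis
  proof (rule that[OF M(1)])
    fix x assume x: "x \<in> X"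
    show "continuous_on {u \<in> U. Re u > M} (\<lambda>u. K (Z x u))"
      by (rule branch_representation(1)[OF x conn VU K(2) sub[OF x] degree_pos K3])
    show "\<exists>k. k \<noteq> 0 \<and> (\<forall>u\<in>{u \<in> U. Re u > M}. Z x u = k * exp ((u - K (Z x u)) / of_nat (degree F)))"
      using branch_representation(2)[OF x conn VU K(2) sub[OF x] degree_pos K3] by simp
  qed
qed

section \<open>Monodromy around zero and around infinity\<close>

text \<open>
  A translate of a branch by \<open>2 * pi * \<i>\<close> solves the same equation, so it is a branch again.  Convexity
  of \<open>V\<close> gives access to the intermediate translates.
\<close>
lemma shift_exists:
  assumes V: "convex V" "V \<subseteq> U" and u0: "u0 \<in> V" "u0 + 2 * pi * \<i> \<in> V"
  shows "\<exists>\<sigma>. is_shift F c \<epsilon> V \<sigma>"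
proof -
  \<comment> \<open>the points of \<open>V\<close> whose translate by one turn lies in \<open>V\<close> as well\<close>
  define V1 where "V1 = V \<inter> (\<lambda>u. - (2 * pi * \<i>) + u) ` V"
  have V1: "u \<in> V1 \<longleftrightarrow> u \<in> V \<and> u + 2 * pi * \<i> \<in> V" for u
    by (auto simp: V1_def image_iff algebra_simps)
  have "convex V1" unfolding V1_def using V(1) by (intro convex_Int convex_translation)
  then have conn: "connected V1" by (rule convex_connected)
  have V1U: "V1 \<subseteq> U" using V by (auto simp: V1)
  have u0U: "u0 \<in> U" "u0 + 2 * pi * \<i> \<in> U" using u0 V(2) by auto
  have E1: "E (u + 2 * pi * \<i>) = E u" for u using E_period[of u 1] by simp
  have "\<exists>y. y \<in> X \<and> Z y u0 = Z x (u0 + 2 * pi * \<i>)" if "x \<in> X" for x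
    using branch_through[OF u0U(1), of "Z x (u0 + 2 * pi * \<i>)"] branch_value[OF that u0U(2)] E1 by metis
  then obtain s where s: "\<And>x. x \<in> X \<Longrightarrow> s x \<in> X \<and> Z (s x) u0 = Z x (u0 + 2 * pi * \<i>)" by metis
  have step: "Z x (u + 2 * pi * \<i>) = Z (s x) u" if x: "x \<in> X" and u: "u \<in> V1" for x u
  proof (rule branch_unique[OF _ conn V1U, of "s x" "\<lambda>u. Z x (u + 2 * pi * \<i>)" u0])
    show "continuous_on V1 (\<lambda>u. Z x (u + 2 * pi * \<i>))"
      by (rule continuous_on_compose2[OF continuous_branch[OF x]]) (use V1 V(2) in \<open>auto intro!: continuous_intros\<close>)
    show "poly F (Z x (u + 2 * pi * \<i>)) = E u" if "u \<in> V1" for u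
      using branch_value[OF x, of "u + 2 * pi * \<i>"] that V1 V(2) E1 by auto
  qed (use s x u0 u in \<open>auto simp: V1\<close>)
  define \<pi> where "\<pi> = (\<lambda>x. if x \<in> X then s x else x)"
  have "inj_on s X"
    using inj_branch[OF u0U(2)] s by (intro inj_onI) (metis inj_on_def)
  then have "bij_betw s X X" unfolding bij_betw_def
    using s finite_X by (metis card_image card_subset_eq image_subsetI)
  then have "bij_betw \<pi> X X" by (rule bij_betw_cong[THEN iffD1, rotated]) (simp add: \<pi>_def)
  then have perm: "\<pi> permutes X" by (rule bij_imp_permutes) (simp add: \<pi>_def)
  have "Z x (u + turn l) = Z ((\<pi> ^^ l) x) u"
    if x: "x \<in> X" and "u \<in> V" "u + turn l \<in> V" for x l u
    using that(2,3)
  proof (induction l arbitrary: u)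
    case (Suc l)
    define w where "w = u + 2 * pi * \<i>"
    have wl: "w + turn l = u + turn (Suc l)" by (simp add: w_def algebra_simps)
    have "(1 - 1 / of_nat (Suc l)) *\<^sub>R u + (1 / of_nat (Suc l)) *\<^sub>R (u + turn (Suc l)) \<in> V"
      by (rule convexD_alt[OF V(1) Suc.prems]) (auto simp: divide_le_eq)
    moreover have "(1 - 1 / of_nat (Suc l)) *\<^sub>R u + (1 / of_nat (Suc l)) *\<^sub>R (u + turn (Suc l)) = w"
      by (simp add: w_def scaleR_conv_of_real field_simps del: of_nat_Suc)
    ultimately have w: "w \<in> V" by metis
    have "Z x (u + turn (Suc l)) = Z ((\<pi> ^^ l) x) w"
      using Suc.IH[OF w] Suc.prems wl by simp
    also have "\<dots> = Z (s ((\<pi> ^^ l) x)) u" unfolding w_def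
      using w Suc.prems funpow_in_permutes[OF perm x] by (intro step) (auto simp: V1 w_def)
    also have "s ((\<pi> ^^ l) x) = (\<pi> ^^ Suc l) x" using funpow_in_permutes[OF perm x, of l] by (simp add: \<pi>_def)
    finally show ?case .
  qed simp
  then show ?thesis using perm unfolding is_shift_def by blast
qed

lemma left_shift_is_shift: "is_shift F c \<epsilon> {u \<in> U. Re u < 0} \<sigma>"
proof -
  obtain s where "complex_of_real s \<in> U" "s < 0" "complex_of_real s + 2 * pi * \<i> \<in> U"
    using far_left_real[of 0 "2 * pi * \<i>"] by blast
  then have "\<exists>\<pi>. is_shift F c \<epsilon> {u \<in> U. Re u < 0} \<pi>"
    by (intro shift_exists[OF convex_chart_left, where ?u0.0 = "complex_of_real s"]) auto
  then show ?thesis unfolding left_shift_def by (rule someI_ex)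
qed

lemma right_shift_is_shift: "is_shift F c \<epsilon> {u \<in> U. Re u > 0} \<tau>"
proof -
  obtain s where "complex_of_real s \<in> U" "s > 0" "complex_of_real s + 2 * pi * \<i> \<in> U"
    using far_right_real[of 0 "2 * pi * \<i>"] by blast
  then have "\<exists>\<pi>. is_shift F c \<epsilon> {u \<in> U. Re u > 0} \<pi>"
    by (intro shift_exists[OF convex_chart_right, where ?u0.0 = "complex_of_real s"]) auto
  then show ?thesis unfolding right_shift_def by (rule someI_ex)
qed

lemma left_shift_permutes: "\<sigma> permutes X" and right_shift_permutes: "\<tau> permutes X"
  using left_shift_is_shift right_shift_is_shift by (auto simp: is_shift_def)

lemma left_shift_branch:
  "\<lbrakk>x \<in> X; u \<in> U; u + turn l \<in> U; Re u < 0\<rbrakk> \<Longrightarrow> Z x (u + turn l) = Z ((\<sigma> ^^ l) x) u"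
  using left_shift_is_shift unfolding is_shift_def by simp

lemma right_shift_branch:
  "\<lbrakk>x \<in> X; u \<in> U; u + turn l \<in> U; Re u > 0\<rbrakk> \<Longrightarrow> Z x (u + turn l) = Z ((\<tau> ^^ l) x) u"
  using right_shift_is_shift unfolding is_shift_def by simp

lemma root_end_left_shift:
  assumes x: "x \<in> X"
  shows "\<zeta> ((\<sigma> ^^ l) x) = \<zeta> x"
proof (rule tendsto_unique[OF trivial_limit_at_bot_linorder])
  show "((\<lambda>s. Z ((\<sigma> ^^ l) x) (complex_of_real s + 0)) \<longlongrightarrow> \<zeta> ((\<sigma> ^^ l) x)) at_bot"
    by (rule root_end_limit[OF funpow_in_permutes[OF left_shift_permutes x]])
  have "eventually (\<lambda>s. Z ((\<sigma> ^^ l) x) (complex_of_real s + 0) = Z x (complex_of_real s + turn l)) at_bot"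
    using eventually_far_left[of 0 0] eventually_far_left[of "turn l" 0]
    by eventually_elim (use left_shift_branch[OF x] in auto)
  then show "((\<lambda>s. Z ((\<sigma> ^^ l) x) (complex_of_real s + 0)) \<longlongrightarrow> \<zeta> x) at_bot"
    using root_end_limit[OF x] by (simp add: tendsto_cong)
qed

text \<open>
  If the branch returns to itself after \<open>l\<close> turns, then the representations at the two ends differ just
  in the factor \<open>exp (turn l / \<mu>)\<close>, where \<open>\<mu>\<close> is the order of the root.
\<close>
lemma left_shift_period:
  assumes x: "x \<in> X" and fixd: "(\<sigma> ^^ l) x = x"
  shows "order (\<zeta> x) F dvd l"
proof -
  obtain M K where M: "M > 0"
    and "\<And>y. \<lbrakk>y \<in> X; \<zeta> y = \<zeta> x\<rbrakk> \<Longrightarrow> continuous_on {u \<in> U. Re u < - M} (\<lambda>u. K (Z y u))"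
    and rep: "\<And>y. \<lbrakk>y \<in> X; \<zeta> y = \<zeta> x\<rbrakk> \<Longrightarrow> \<exists>k. k \<noteq> 0 \<and> (\<forall>u\<in>{u \<in> U. Re u < - M}. Z y u - \<zeta> x = k * exp ((u - K (Z y u)) / of_nat (order (\<zeta> x) F)))"
    by (rule branch_representation_left[OF root_end_root[OF x]]) blast
  obtain k where k: "k \<noteq> 0" "\<And>u. \<lbrakk>u \<in> U; Re u < - M\<rbrakk> \<Longrightarrow> Z x u - \<zeta> x = k * exp ((u - K (Z x u)) / of_nat (order (\<zeta> x) F))"
    using rep[OF x refl] by auto
  obtain s where s: "complex_of_real s \<in> U" "s < - M" "complex_of_real s + turn l \<in> U"
    using far_left_real[of "-M" "turn l"] by blast
  have eq: "Z x (s + turn l) = Z x s"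
    using left_shift_branch[OF x s(1,3)] s(2) M(1) fixd by simp
  have ord: "order (\<zeta> x) F > 0" using root_end_root[OF x] F_nonzero order_root by blast
  show ?thesis
    by (rule equal_root_representation_imp_dvd[OF ord k(1), where u = "complex_of_real s" and l = l and \<kappa> = "K (Z x s)"])
      (use k(2)[OF s(3)] k(2)[OF s(1)] s(2) eq in simp)
qed

lemma right_shift_period:
  assumes x: "x \<in> X" and fixd: "(\<tau> ^^ l) x = x"
  shows "degree F dvd l"
proof -
  obtain M K where M: "M > 0"
    and "\<And>x. x \<in> X \<Longrightarrow> continuous_on {u \<in> U. Re u > M} (\<lambda>u. K (Z x u))"
    and rep: "\<And>x. x \<in> X \<Longrightarrow> \<exists>k. k \<noteq> 0 \<and> (\<forall>u\<in>{u \<in> U. Re u > M}. Z x u = k * exp ((u - K (Z x u)) / of_nat (degree F)))"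
    by (rule branch_representation_right) blast
  obtain k where k: "k \<noteq> 0" "\<And>u. \<lbrakk>u \<in> U; Re u > M\<rbrakk> \<Longrightarrow> Z x u = k * exp ((u - K (Z x u)) / of_nat (degree F))"
    using rep[OF x] by auto
  obtain s where s: "complex_of_real s \<in> U" "s > M" "complex_of_real s + turn l \<in> U"
    using far_right_real[of "M" "turn l"] by blast
  have eq: "Z x (s + turn l) = Z x s"
    using right_shift_branch[OF x s(1,3)] s(2) M(1) fixd by simp
  show ?thesis
    by (rule equal_root_representation_imp_dvd[OF degree_pos k(1), where u = "complex_of_real s" and l = l and \<kappa> = "K (Z x s)"])
      (use k(2)[OF s(3)] k(2)[OF s(1)] s(2) eq in simp)
qed

lemma inj_on_funpow_orbit:
  assumes "\<pi> permutes X" "x \<in> X" "\<And>l. (\<pi> ^^ l) x = x \<Longrightarrow> n dvd l"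
  shows "inj_on (\<lambda>l. (\<pi> ^^ l) x) {..<n}"
proof (rule linorder_inj_onI)
  fix i j assume "i < j" "i \<in> {..<n}" "j \<in> {..<n}"
  then show "(\<pi> ^^ i) x \<noteq> (\<pi> ^^ j) x"
    using funpow_cancel_on_permutes[OF assms(1), of i x j] assms(3)[of "j - i"] dvd_imp_le[of n "j - i"]
    by fastforce
qed auto

lemma right_orbit:
  assumes x: "x \<in> X"
  shows "(\<lambda>l. (\<tau> ^^ l) x) ` {..<degree F} = X"
  using inj_on_funpow_orbit[OF right_shift_permutes x right_shift_period[OF x]] finite_X
    funpow_in_permutes[OF right_shift_permutes x] card_X
  by (intro card_subset_eq) (auto simp: card_image)

lemma left_orbit_le:
  assumes x: "x \<in> X"
  shows "order (\<zeta> x) F \<le> card {y \<in> X. \<zeta> y = \<zeta> x}"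
proof -
  have "card ((\<lambda>l. (\<sigma> ^^ l) x) ` {..<order (\<zeta> x) F}) = order (\<zeta> x) F"
    using inj_on_funpow_orbit[OF left_shift_permutes x left_shift_period[OF x]] by (simp add: card_image)
  moreover have "(\<lambda>l. (\<sigma> ^^ l) x) ` {..<order (\<zeta> x) F} \<subseteq> {y \<in> X. \<zeta> y = \<zeta> x}"
    using funpow_in_permutes[OF left_shift_permutes x] root_end_left_shift[OF x] by auto
  moreover have "finite {y \<in> X. \<zeta> y = \<zeta> x}" using finite_X by simp
  ultimately show ?thesis using card_mono by metis
qed

text \<open>
  A neighbourhood of the root is mapped onto a neighbourhood of 0, which contains values \<open>E u\<close> with \<open>u\<close>
  far to the left.
\<close>
lemma root_is_root_end:
  assumes a: "poly F a = 0"
  shows "\<exists>x\<in>X. \<zeta> x = a"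
proof -
  have fin: "finite {a. poly F a = 0}" using poly_roots_finite[OF F_nonzero] .
  obtain \<delta> where \<delta>: "\<delta> > 0" "\<And>a b. \<lbrakk>poly F a = 0; poly F b = 0; a \<noteq> b\<rbrakk> \<Longrightarrow> \<delta> \<le> dist a b"
    using finite_separated[OF fin] by auto
  obtain M where M: "M > 0" "\<And>x u. \<lbrakk>x \<in> X; u \<in> U; Re u < - M\<rbrakk> \<Longrightarrow> dist (Z x u) (\<zeta> x) < \<delta> / 2"
    using root_end_near_uniform[of "\<delta> / 2"] \<delta>(1) by auto
  have "\<not> poly F constant_on UNIV"
  proof
    assume "poly F constant_on UNIV"
    then obtain k where "\<And>z. poly F z = k" by (auto simp: constant_on_def)
    then have "fiber F (k + 1) = {}" by (auto simp: fiber_def)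
    then show False using fiber_nonempty[OF degree_pos] by blast
  qed
  then have "open (poly F ` ball a (\<delta> / 2))"
    by (intro open_mapping_thm[OF poly_holomorphic_on[OF holomorphic_on_ident] open_UNIV connected_UNIV]) auto
  moreover have "0 \<in> poly F ` ball a (\<delta> / 2)" using a \<delta>(1) by force
  ultimately obtain e where e: "e > 0" "ball 0 e \<subseteq> poly F ` ball a (\<delta> / 2)"
    unfolding open_contains_ball by blast
  obtain s where "complex_of_real s \<in> U" "s < min (- M) (ln e)"
    using far_left_real[of "min (- M) (ln e)" 0] by blast
  then have s: "complex_of_real s \<in> U" "s < - M" "s < ln e" by auto
  have "norm (E s) < e" unfolding norm_E using s(3) e(1) by (metis Re_complex_of_real exp_less_cancel_iff exp_ln)
  then obtain z where z: "dist a z < \<delta> / 2" "poly F z = E s" using e(2) by fastforce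
  obtain x where x: "x \<in> X" "Z x s = z" using branch_through[OF s(1) z(2)] by blast
  have "dist z (\<zeta> x) < \<delta> / 2" using M(2)[OF x(1) s(1)] s(2) x(2) by simp
  then have "dist a (\<zeta> x) < \<delta>" using z(1) dist_triangle[of a "\<zeta> x" z] by linarith
  then have "\<zeta> x = a" using \<delta>(2)[OF a root_end_root[OF x(1)]] by force
  then show ?thesis using x by blast
qed

text \<open>
  At each root, an orbit of the left shift supplies at least as many branches as the order of the
  root.  Both numbers add up to the degree over all roots, so they agree.
\<close>
lemma card_root_end:
  assumes a: "poly F a = 0"
  shows "card {x \<in> X. \<zeta> x = a} = order a F"
proof -
  let ?R = "{a. poly F a = 0}"
  have fin: "finite ?R" using poly_roots_finite[OF F_nonzero] .
  have "card X = (\<Sum>a\<in>?R. card {x \<in> X. \<zeta> x = a})"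
  proof -
    have "card (\<Union>a\<in>?R. {x \<in> X. \<zeta> x = a}) = (\<Sum>a\<in>?R. card {x \<in> X. \<zeta> x = a})"
      using fin finite_X by (intro card_UN_disjoint) auto
    moreover have "(\<Union>a\<in>?R. {x \<in> X. \<zeta> x = a}) = X" using root_end_root by auto
    ultimately show ?thesis by simp
  qed
  then have "(\<Sum>a\<in>?R. order a F) = (\<Sum>a\<in>?R. card {x \<in> X. \<zeta> x = a})"
    using sum_order_eq_degree[OF F_nonzero] card_X by simp
  then have "order a F = card {x \<in> X. \<zeta> x = a}"
    by (rule sum_mono_inv) (use a fin root_is_root_end left_orbit_le in \<open>force+\<close>)
  then show ?thesis by simp
qed

lemma left_orbit:
  assumes "x \<in> X" "y \<in> X" "\<zeta> y = \<zeta> x"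
  obtains l where "y = (\<sigma> ^^ l) x"
proof -
  have "card ((\<lambda>l. (\<sigma> ^^ l) x) ` {..<order (\<zeta> x) F}) = card {y \<in> X. \<zeta> y = \<zeta> x}"
    using inj_on_funpow_orbit[OF left_shift_permutes assms(1) left_shift_period[OF assms(1)]]
      card_root_end[OF root_end_root[OF assms(1)]] by (simp add: card_image)
  then have "(\<lambda>l. (\<sigma> ^^ l) x) ` {..<order (\<zeta> x) F} = {y \<in> X. \<zeta> y = \<zeta> x}"
    using finite_X funpow_in_permutes[OF left_shift_permutes assms(1)] root_end_left_shift[OF assms(1)]
    by (intro card_subset_eq) auto
  then show ?thesis using that assms by blast
qed

end

section \<open>Branches issuing from different roots do not interlace\<close>

lemma log_difference_constant:
  fixes f g :: "'a::topological_space \<Rightarrow> complex"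
  assumes V: "connected V" and cont: "continuous_on V f" "continuous_on V g"
    and eq: "\<And>u. u \<in> V \<Longrightarrow> exp (f u) = exp (g u)" and uv: "u \<in> V" "v \<in> V"
  shows "f u - g u = f v - g v"
proof -
  have "(\<lambda>u. f u - g u) constant_on V"
  proof (rule continuous_discrete_range_constant[OF V])
    show "continuous_on V (\<lambda>u. f u - g u)" using cont by (intro continuous_intros)
    fix x assume x: "x \<in> V"
    have "2 * pi \<le> norm ((f y - g y) - (f x - g x))" if y: "y \<in> V" "f y - g y \<noteq> f x - g x" for y
    proof -
      obtain m n :: int where m: "f x = g x + of_int (2 * m) * pi * \<i>" and n: "f y = g y + of_int (2 * n) * pi * \<i>"
        using eq[OF x] eq[OF y(1)] unfolding exp_eq by blast
      have "(f y - g y) - (f x - g x) = of_real (2 * pi * of_int (n - m)) * \<i>"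
        unfolding m n by (simp add: algebra_simps)
      then have "norm ((f y - g y) - (f x - g x)) = 2 * pi * \<bar>of_int (n - m)\<bar>"
        by (simp add: norm_mult abs_mult del: of_int_diff)
      moreover have "n \<noteq> m" using y(2) m n by auto
      then have "1 \<le> \<bar>real_of_int (n - m)\<bar>" by linarith
      ultimately show ?thesis by (metis mult.right_neutral mult_left_mono pi_ge_zero mult_nonneg_nonneg zero_le_numeral)
    qed
    then show "\<exists>e>0. \<forall>y. y \<in> V \<and> f y - g y \<noteq> f x - g x \<longrightarrow> e \<le> norm ((f y - g y) - (f x - g x))"
      by (intro exI[of _ "2 * pi"]) auto
  qed
  then show ?thesis using uv unfolding constant_on_def by force
qed

lemma unbounded_connected_outside:
  assumes "connected Q" "\<not> bounded Q" "Q \<inter> S = {}" "b \<in> Q"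
  shows "b \<in> outside S"
proof -
  have "Q \<subseteq> connected_component_set (- S) b"
    using assms by (intro connected_component_maximal) auto
  then show ?thesis using assms bounded_subset unfolding outside_def by blast
qed

lemma cos_le_of_far:
  assumes "0 \<le> \<alpha>" "\<alpha> \<le> \<bar>\<theta>\<bar>" "\<bar>\<theta>\<bar> \<le> 2 * pi - \<alpha>"
  shows "cos \<theta> \<le> cos \<alpha>"
proof (cases "\<bar>\<theta>\<bar> \<le> pi")
  case True
  then have "cos \<bar>\<theta>\<bar> \<le> cos \<alpha>" using assms by (intro cos_monotone_0_pi_le) auto
  then show ?thesis by simp
next
  case False
  then have "cos (2 * pi - \<bar>\<theta>\<bar>) \<le> cos \<alpha>" using assms by (intro cos_monotone_0_pi_le) auto
  then show ?thesis by (simp add: cos_diff)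
qed

text \<open>
  The positions in \<open>B\<close> lie in an interval \<open>{p..q}\<close> that contains no element of \<open>A\<close>.  On the unit circle, the
  chord that cuts off the corresponding arc separates the two sets, hence also their centroids.  The
  functional that measures the distance to this chord is \<open>z \<mapsto> Re (w * z)\<close>, where \<open>w\<close> turns the
  midpoint \<open>m\<close> of the interval to 1.
\<close>
lemma noncrossing_centroids_differ:
  fixes A B :: "nat set"
  assumes sub: "A \<subseteq> {..<d}" "B \<subseteq> {..<d}" and disj: "A \<inter> B = {}" and ne: "0 \<in> A" "B \<noteq> {}"
    and noncross: "\<And>i j k. \<lbrakk>i \<in> B; j \<in> A; k \<in> B; i < j; j < k\<rbrakk> \<Longrightarrow> False"
  defines "\<omega> \<equiv> cis (2 * pi / real d)"
  shows "of_nat (card B) * (\<Sum>i\<in>A. \<omega> ^ i) \<noteq> of_nat (card A) * (\<Sum>i\<in>B. \<omega> ^ i)"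
proof
  assume eq: "of_nat (card B) * (\<Sum>i\<in>A. \<omega> ^ i) = of_nat (card A) * (\<Sum>i\<in>B. \<omega> ^ i)"
  have fin: "finite A" "finite B" using sub finite_subset by blast+
  define p q where "p = Min B" and "q = Max B"
  have pq: "p \<in> B" "q \<in> B" "\<And>i. i \<in> B \<Longrightarrow> p \<le> i \<and> i \<le> q"
    using fin ne by (auto simp: p_def q_def)
  define m h where "m = (real p + real q) / 2" and "h = (real q - real p) / 2"
  have p0: "p \<ge> 1" using pq(1) ne(1) disj by (cases p) auto
  have qd: "q < d" using pq(2) sub by auto
  have h0: "h \<ge> 0" using pq(3)[OF pq(1)] by (simp add: h_def)
  have "2 * (h + 1) = real q - real p + 2" by (simp add: h_def field_simps)
  then have hd: "2 * (h + 1) \<le> d" using p0 qd by linarith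
  have dpos: "real d > 0" using qd by simp
  define w where "w = cis (- (2 * pi * m / d))"
  have Re: "Re (w * \<omega> ^ i) = cos (2 * pi * (real i - m) / d)" for i
  proof -
    have "w * \<omega> ^ i = cis (- (2 * pi * m / d) + real i * (2 * pi / d))"
      unfolding w_def \<omega>_def by (simp only: Complex.DeMoivre cis_mult)
    also have "- (2 * pi * m / d) + real i * (2 * pi / d) = 2 * pi * (real i - m) / d"
      by (simp add: algebra_simps diff_divide_distrib)
    finally have "w * \<omega> ^ i = cis (2 * pi * (real i - m) / d)" .
    then show ?thesis by simp
  qed
  have B: "cos (2 * pi * h / d) \<le> Re (w * \<omega> ^ i)" if "i \<in> B" for i
  proof -
    have "\<bar>real i - m\<bar> \<le> h" using pq(3)[OF that] by (simp add: m_def h_def field_simps abs_if)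
    then have "2 * pi * \<bar>real i - m\<bar> / d \<le> 2 * pi * h / d" by (intro divide_right_mono mult_left_mono) auto
    moreover have "2 * pi * h / d \<le> pi" using hd dpos h0 by (simp add: field_simps)
    ultimately have "cos (2 * pi * h / d) \<le> cos (2 * pi * \<bar>real i - m\<bar> / d)"
      by (intro cos_monotone_0_pi_le) auto
    also have "\<dots> = cos \<bar>2 * pi * (real i - m) / d\<bar>" by (simp add: abs_mult)
    finally show ?thesis unfolding Re by (simp only: cos_abs_real)
  qed
  have A: "Re (w * \<omega> ^ i) \<le> cos (2 * pi * (h + 1) / d)" if "i \<in> A" for i
  proof -
    have "i \<noteq> p" "i \<noteq> q" using that disj pq by auto
    then have "i < p \<or> q < i" using noncross[OF pq(1) that pq(2)] by (meson linorder_less_linear)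
    moreover have "i < d" using that sub by auto
    ultimately have far: "h + 1 \<le> \<bar>real i - m\<bar>" "\<bar>real i - m\<bar> \<le> d - (h + 1)"
      using p0 qd pq(3)[OF pq(1)] by (auto simp: m_def h_def field_simps abs_if)
    have abs: "\<bar>2 * pi * (real i - m) / d\<bar> = 2 * pi * \<bar>real i - m\<bar> / d" by (simp add: abs_mult)
    have "2 * pi * \<bar>real i - m\<bar> / d \<le> 2 * pi * (d - (h + 1)) / d"
      using far(2) by (intro divide_right_mono mult_left_mono) auto
    also have "\<dots> = 2 * pi - 2 * pi * (h + 1) / d" using dpos by (simp add: field_simps)
    finally have up: "\<bar>2 * pi * (real i - m) / d\<bar> \<le> 2 * pi - 2 * pi * (h + 1) / d" unfolding abs .
    have low: "2 * pi * (h + 1) / d \<le> \<bar>2 * pi * (real i - m) / d\<bar>"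
      unfolding abs using far(1) by (intro divide_right_mono mult_left_mono) auto
    have "0 \<le> 2 * pi * (h + 1) / d" using h0 by simp
    then show ?thesis unfolding Re using low up by (rule cos_le_of_far)
  qed
  have lt: "cos (2 * pi * (h + 1) / d) < cos (2 * pi * h / d)"
  proof (rule cos_monotone_0_pi)
    have "pi * (2 * (h + 1)) \<le> pi * d" using hd by (intro mult_left_mono) auto
    then show "2 * pi * (h + 1) / d \<le> pi" using dpos by (simp add: field_simps)
    show "2 * pi * h / d < 2 * pi * (h + 1) / d" using dpos by (simp add: field_simps)
  qed (use h0 in simp)
  have cA: "card A > 0" "card B > 0" using fin ne by (auto simp: card_gt_0_iff)
  have "Re (w * (\<Sum>i\<in>A. \<omega> ^ i)) \<le> card A * cos (2 * pi * (h + 1) / d)"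
    unfolding sum_distrib_left Re_sum using A by (rule sum_bounded_above)
  moreover have "card B * cos (2 * pi * h / d) \<le> Re (w * (\<Sum>i\<in>B. \<omega> ^ i))"
    unfolding sum_distrib_left Re_sum using B by (rule sum_bounded_below)
  ultimately have "card B * Re (w * (\<Sum>i\<in>A. \<omega> ^ i)) \<le> card B * (card A * cos (2 * pi * (h + 1) / d))"
    "card A * (card B * cos (2 * pi * h / d)) \<le> card A * Re (w * (\<Sum>i\<in>B. \<omega> ^ i))"
    by (auto intro!: mult_left_mono)
  moreover have "card B * Re (w * (\<Sum>i\<in>A. \<omega> ^ i)) = card A * Re (w * (\<Sum>i\<in>B. \<omega> ^ i))"
  proof -
    have "Re (w * (of_nat (card B) * (\<Sum>i\<in>A. \<omega> ^ i))) = Re (w * (of_nat (card A) * (\<Sum>i\<in>B. \<omega> ^ i)))"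
      using eq by simp
    moreover have "Re (w * (of_nat k * s)) = real k * Re (w * s)" for k s by (simp add: algebra_simps)
    ultimately show ?thesis by metis
  qed
  ultimately have "real (card A * card B) * cos (2 * pi * h / d) \<le> real (card A * card B) * cos (2 * pi * (h + 1) / d)"
    by (simp add: mult_ac)
  then show False using lt cA by (simp add: mult_le_cancel_left)
qed

text \<open>
  The lift of the segment from 0 to \<open>c * exp s\<close> that ends on the branch \<open>x\<close>; at \<open>t = 0\<close> it starts at the
  limit of the branch.
\<close>
definition branch_arc :: "complex poly \<Rightarrow> complex \<Rightarrow> real \<Rightarrow> real \<Rightarrow> complex \<Rightarrow> real \<Rightarrow> complex" where
  "branch_arc F c \<epsilon> s x t = (if t \<le> 0 then root_end F c \<epsilon> x else branch F c \<epsilon> x (complex_of_real (s + ln t)))"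

text \<open>
  The lift of the circle of radius \<open>exp s\<close>, traversed \<open>degree F\<close> times.  It passes through all points of
  the fiber over \<open>c * exp s\<close>, in the cyclic order of the monodromy at infinity.
\<close>
definition branch_loop :: "complex poly \<Rightarrow> complex \<Rightarrow> real \<Rightarrow> real \<Rightarrow> complex \<Rightarrow> real \<Rightarrow> complex" where
  "branch_loop F c \<epsilon> s x t = branch F c \<epsilon> x (complex_of_real s + complex_of_real (2 * pi * degree F * t) * \<i>)"

context slit_chart
begin

abbreviation arc where "arc \<equiv> branch_arc F c \<epsilon>"
abbreviation loop where "loop \<equiv> branch_loop F c \<epsilon>"

lemma real_in_U: "complex_of_real s \<in> U" using real_in_chart_dom[OF eps_pos] .

lemma E_nonzero: "E u \<noteq> 0" using c_nonzero by simp

lemma path_arc: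
  assumes x: "x \<in> X"
  shows "path (arc s x)"
  unfolding path_def continuous_on_eq_continuous_within
proof
  fix t :: real assume t: "t \<in> {0..1}"
  show "continuous (at t within {0..1}) (arc s x)"
  proof (cases "t = 0")
    case True
    have "((\<lambda>s. Z x (complex_of_real s)) \<longlongrightarrow> \<zeta> x) at_bot" using root_end_limit[OF x, of 0] by simp
    moreover have "filterlim (\<lambda>t::real. s + ln t) at_bot (at_right 0)"
      using filterlim_tendsto_add_at_bot_iff[OF tendsto_const] ln_at_0 by blast
    ultimately have "((\<lambda>t. Z x (complex_of_real (s + ln t))) \<longlongrightarrow> \<zeta> x) (at_right 0)"
      by (rule filterlim_compose)
    moreover have "at 0 within {0..1::real} \<le> at_right 0" by (simp add: at_within_Icc_at_right)
    ultimately have "((\<lambda>t. Z x (complex_of_real (s + ln t))) \<longlongrightarrow> \<zeta> x) (at 0 within {0..1})"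
      by (rule tendsto_mono[rotated])
    moreover have "eventually (\<lambda>t. Z x (complex_of_real (s + ln t)) = arc s x t) (at 0 within {0..1})"
      unfolding eventually_at by (intro exI[of _ 1]) (auto simp: branch_arc_def)
    ultimately have "(arc s x \<longlongrightarrow> \<zeta> x) (at 0 within {0..1})" by (rule Lim_transform_eventually)
    then show ?thesis unfolding True continuous_within by (simp add: branch_arc_def)
  next
    case False
    then have "t > 0" using t by simp
    have "continuous_on {0<..} (\<lambda>t. Z x (complex_of_real (s + ln t)))"
      by (rule continuous_on_compose2[OF continuous_branch[OF x]]) (auto intro!: continuous_intros real_in_U simp del: of_real_add)
    then have "continuous_on {0<..} (arc s x)"
      by (rule continuous_on_cong[THEN iffD1, rotated 2]) (auto simp: branch_arc_def)
    then have "isCont (arc s x) t" using \<open>t > 0\<close> by (simp add: continuous_on_eq_continuous_at)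
    then show ?thesis by (rule continuous_at_imp_continuous_at_within)
  qed
qed

lemma pathstart_arc: "pathstart (arc s x) = \<zeta> x"
  and pathfinish_arc: "pathfinish (arc s x) = Z x (complex_of_real s)"
  by (simp_all add: branch_arc_def pathstart_def pathfinish_def)

lemma same_real_value: "E (complex_of_real s) = E (complex_of_real s' + complex_of_real y * \<i>) \<Longrightarrow> s = s'"
proof -
  assume "E (complex_of_real s) = E (complex_of_real s' + complex_of_real y * \<i>)"
  then have "norm (E (complex_of_real s)) = norm (E (complex_of_real s' + complex_of_real y * \<i>))" by (rule arg_cong)
  then show ?thesis by (simp only: norm_E) simp
qed

lemma branch_real_eq:
  assumes "x \<in> X" "y \<in> X" "Z y (complex_of_real s) = Z x (complex_of_real s')"
  shows "y = x"
proof -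
  have "E (complex_of_real s) = E (complex_of_real s')"
    using assms branch_value[OF _ real_in_U] by metis
  then have "s = s'" using same_real_value[of s s' 0] by simp
  then show ?thesis using inj_branch[OF real_in_U] assms by (metis inj_on_def)
qed

lemma branch_notin_arc:
  assumes "x \<in> X" "y \<in> X" "y \<noteq> x"
  shows "Z y (complex_of_real s) \<notin> path_image (arc s' x)"
proof
  assume "Z y (complex_of_real s) \<in> path_image (arc s' x)"
  then obtain t where t: "Z y (complex_of_real s) = arc s' x t" by (auto simp: path_image_def)
  show False
  proof (cases "t \<le> 0")
    case True
    then have "poly F (Z y (complex_of_real s)) = 0" using t root_end_root[OF assms(1)] by (simp add: branch_arc_def)
    then show False using branch_value[OF assms(2) real_in_U] E_nonzero by metis
  next
    case False
    then have "Z y (complex_of_real s) = Z x (complex_of_real (s' + ln t))" using t by (simp add: branch_arc_def)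
    then show False using branch_real_eq[OF assms(1,2)] assms(3) by blast
  qed
qed

lemma root_notin_arc:
  assumes "x \<in> X" "poly F b = 0" "b \<noteq> \<zeta> x"
  shows "b \<notin> path_image (arc s x)"
proof
  assume "b \<in> path_image (arc s x)"
  then obtain t where t: "b = arc s x t" by (auto simp: path_image_def)
  then have "b = Z x (complex_of_real (s + ln t))" using assms(3) by (auto simp: branch_arc_def split: if_splits)
  then show False using branch_value[OF assms(1) real_in_U, of "s + ln t"] E_nonzero assms(2) by metis
qed

definition good_radius :: "real \<Rightarrow> bool" where
  "good_radius s \<longleftrightarrow> s > 0 \<and> (\<forall>y\<in>{0..2 * pi * degree F}. complex_of_real s + complex_of_real y * \<i> \<in> U)"

lemma good_radiusI: "s > 2 * pi * degree F / \<epsilon> \<Longrightarrow> good_radius s"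
proof -
  assume s: "s > 2 * pi * degree F / \<epsilon>"
  have "0 \<le> 2 * pi * degree F / \<epsilon>" using eps_pos by simp
  then have "s > 0" using s by linarith
  moreover have "complex_of_real s + complex_of_real y * \<i> \<in> U" if "y \<in> {0..2 * pi * degree F}" for y
  proof (rule far_in_chart_dom[OF eps_pos])
    have "\<bar>y\<bar> / \<epsilon> \<le> 2 * pi * degree F / \<epsilon>" using that eps_pos by (intro divide_right_mono) auto
    then show "\<bar>Im (complex_of_real y * \<i>)\<bar> / \<epsilon> + \<bar>Re (complex_of_real y * \<i>)\<bar> \<le> \<bar>s\<bar>" using s \<open>s > 0\<close> by simp
  qed
  ultimately show ?thesis by (simp add: good_radius_def)
qed

lemma loop_point_in_U:
  assumes "good_radius s" "t \<in> {0..1}"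
  shows "complex_of_real s + complex_of_real (2 * pi * degree F * t) * \<i> \<in> U"
proof -
  have "2 * pi * degree F * t \<in> {0..2 * pi * degree F}" using assms(2) by (auto intro: mult_left_le)
  then show ?thesis using assms(1) unfolding good_radius_def by blast
qed

lemma path_loop:
  assumes "x \<in> X" "good_radius s"
  shows "path (loop s x)"
  unfolding path_def branch_loop_def
  by (rule continuous_on_compose2[OF continuous_branch[OF assms(1)]])
    (use loop_point_in_U[OF assms(2)] in \<open>auto intro!: continuous_intros\<close>)

lemma loop_value: "\<lbrakk>x \<in> X; good_radius s; t \<in> {0..1}\<rbrakk> \<Longrightarrow>
    poly F (loop s x t) = E (complex_of_real s + complex_of_real (2 * pi * degree F * t) * \<i>)"
  unfolding branch_loop_def by (intro branch_value loop_point_in_U)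

lemma loop_at:
  assumes "x \<in> X" "good_radius s" "l \<le> degree F"
  shows "loop s x (real l / degree F) = Z ((\<tau> ^^ l) x) (complex_of_real s)"
proof -
  have "complex_of_real s + turn l \<in> U"
  proof -
    have "complex_of_real (2 * pi * degree F * (real l / degree F)) = 2 * pi * of_nat l" using degree_pos by simp
    then show ?thesis
      using loop_point_in_U[OF assms(2), of "real l / degree F"] assms(3) degree_pos by (simp only:) (simp add: divide_le_eq)
  qed
  moreover have "s > 0" using assms(2) by (simp add: good_radius_def)
  ultimately have "Z x (complex_of_real s + turn l) = Z ((\<tau> ^^ l) x) (complex_of_real s)"
    using right_shift_branch[OF assms(1) real_in_U, of s l] by simp
  then show ?thesis using degree_pos by (simp add: branch_loop_def mult.assoc)
qed

lemma right_shift_degree: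
  assumes x: "x \<in> X"
  shows "(\<tau> ^^ degree F) x = x"
proof -
  have "(\<tau> ^^ degree F) x \<in> (\<lambda>l. (\<tau> ^^ l) x) ` {..<degree F}"
    using right_orbit[OF x] funpow_in_permutes[OF right_shift_permutes x] by simp
  then obtain l where l: "l < degree F" "(\<tau> ^^ degree F) x = (\<tau> ^^ l) x" by blast
  then have "(\<tau> ^^ (degree F - l)) x = x"
    using funpow_cancel_on_permutes[OF right_shift_permutes, of l x "degree F"] by simp
  then have "degree F dvd degree F - l" by (rule right_shift_period[OF x])
  then have "l = 0" using l(1) dvd_imp_le[of "degree F" "degree F - l"] by linarith
  then show ?thesis using l by simp
qed

lemma right_orbit_inj:
  assumes "x \<in> X" "(\<tau> ^^ i) x = (\<tau> ^^ j) x" "i < degree F" "j < degree F"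
  shows "i = j"
  using inj_on_funpow_orbit[OF right_shift_permutes assms(1) right_shift_period[OF assms(1)]] assms(2-4)
  by (auto simp: inj_on_def)

lemma branch_on_loop:
  fixes t :: real
  assumes x: "x \<in> X" and s: "good_radius s" and y: "y \<in> X" and t: "t \<in> {0..1}"
    and eq: "Z y (complex_of_real s') = loop s x t"
  obtains l where "real l = degree F * t" "l \<le> degree F" "y = (\<tau> ^^ l) x"
proof -
  have E: "E (complex_of_real s') = E (complex_of_real s + complex_of_real (2 * pi * degree F * t) * \<i>)"
    using branch_value[OF y real_in_U] loop_value[OF x s t] eq by metis
  then have s': "s' = s" by (rule same_real_value)
  have "exp (complex_of_real (2 * pi * degree F * t) * \<i>) = 1"
    using E c_nonzero unfolding s' exp_add by simp
  then obtain n :: int where "2 * pi * degree F * t = of_int (2 * n) * pi" unfolding exp_eq_1 by auto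
  then have n: "degree F * t = of_int n" by simp
  then have "0 \<le> n" using t by (metis atLeastAtMost_iff mult_nonneg_nonneg of_int_0_le_iff of_nat_0_le_iff)
  then obtain l where l: "n = int l" using nonneg_int_cases by blast
  have ld: "real l = degree F * t" using n l by simp
  also have "\<dots> \<le> degree F" using t by (auto intro: mult_left_le)
  finally have le: "l \<le> degree F" by simp
  have "t = real l / degree F" using ld degree_pos by simp
  then have "Z y (complex_of_real s) = Z ((\<tau> ^^ l) x) (complex_of_real s)"
    using eq loop_at[OF x s le] s' by simp
  then have "y = (\<tau> ^^ l) x" using branch_real_eq y funpow_in_permutes[OF right_shift_permutes x] by blast
  then show ?thesis using that ld le by blast
qed

text \<open>
  By the representation at infinity, a logarithm of the loop is \<open>u / degree F\<close> up to a function of the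
  value of the loop.  Over \<open>degree F\<close> turns it grows by \<open>2 * pi * \<i>\<close>.  The center may be moved from 0 to \<open>b\<close>,
  since the loop stays outside a disc that contains both.
\<close>
lemma winding_number_loop:
  assumes x: "x \<in> X"
  obtains M where "\<And>s. s > M \<Longrightarrow> good_radius s \<and> b \<notin> path_image (loop s x) \<and> winding_number (loop s x) b = 1"
proof -
  obtain M1 K where M1: "M1 > 0"
    and contK: "\<And>x. x \<in> X \<Longrightarrow> continuous_on {u \<in> U. Re u > M1} (\<lambda>u. K (Z x u))"
    and rep: "\<And>x. x \<in> X \<Longrightarrow> \<exists>k. k \<noteq> 0 \<and> (\<forall>u\<in>{u \<in> U. Re u > M1}. Z x u = k * exp ((u - K (Z x u)) / of_nat (degree F)))"
    by (rule branch_representation_right) blast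
  obtain k where k: "k \<noteq> 0" "\<And>u. \<lbrakk>u \<in> U; Re u > M1\<rbrakk> \<Longrightarrow> Z x u = k * exp ((u - K (Z x u)) / of_nat (degree F))"
    using rep[OF x] by auto
  obtain M2 where M2: "\<And>x u. \<lbrakk>x \<in> X; u \<in> U; Re u > M2\<rbrakk> \<Longrightarrow> norm (Z x u) > norm b + 1"
    using large_right[of "norm b + 1"] by metis
  have "good_radius s \<and> b \<notin> path_image (loop s x) \<and> winding_number (loop s x) b = 1"
    if s: "s > Max {2 * pi * degree F / \<epsilon>, M1, M2}" for s
  proof -
    have g: "good_radius s" using s by (intro good_radiusI) simp
    have s12: "s > M1" "s > M2" using s by auto
    define v where "v = (\<lambda>t::real. complex_of_real s + complex_of_real (2 * pi * degree F * t) * \<i>)"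
    have v: "v t \<in> U" "Re (v t) = s" if "t \<in> {0..1}" for t
      using loop_point_in_U[OF g that] by (auto simp: v_def)
    have lv: "loop s x t = Z x (v t)" for t by (simp add: branch_loop_def v_def)
    have big: "norm (loop s x t) > norm b + 1" if "t \<in> {0..1}" for t
      using M2[OF x v(1)[OF that]] v(2)[OF that] s12 by (simp add: lv)
    have disj: "ball 0 (norm b + 1) \<inter> path_image (loop s x) = {}"
      using big by (fastforce simp: path_image_def)
    have closed: "pathfinish (loop s x) = pathstart (loop s x)"
      using loop_at[OF x g, of "degree F"] loop_at[OF x g, of 0] right_shift_degree[OF x] degree_pos
      by (simp add: pathfinish_def pathstart_def)
    have in_ball: "b \<in> ball 0 (norm b + 1)" "0 \<in> ball 0 (norm b + 1)" by (simp_all add: add_nonneg_pos)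
    then have b: "b \<notin> path_image (loop s x)" and zero: "0 \<notin> path_image (loop s x)"
      using disj by blast+
    have "winding_number (loop s x) b = winding_number (loop s x) 0"
      by (rule winding_number_eq[OF path_loop[OF x g] closed, where S = "ball 0 (norm b + 1)"])
        (use disj in_ball in auto)
    also have "\<dots> = 1"
    proof -
      obtain q where q: "path q" "pathfinish q - pathstart q = 2 * of_real pi * \<i> * winding_number (loop s x) 0"
        "\<And>t. t \<in> {0..1} \<Longrightarrow> loop s x t = 0 + exp (q t)"
        using winding_number_as_continuous_log[OF path_loop[OF x g] zero] by blast
      define p where "p = (\<lambda>t. Ln k + (v t - K (Z x (v t))) / of_nat (degree F))"
      have "continuous_on {0..1} (\<lambda>t. K (Z x (v t)))"
        by (rule continuous_on_compose2[OF contK[OF x]]) (use v s12 in \<open>auto simp: v_def intro!: continuous_intros\<close>)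
      then have contp: "continuous_on {0..1} p" unfolding p_def v_def
        using degree_pos by (intro continuous_intros) auto
      have contq: "continuous_on {0..1} q" using q(1) by (simp add: path_def)
      have "exp (p t) = exp (q t)" if "t \<in> {0..1}" for t
        using k(2)[OF v(1)[OF that]] v(2)[OF that] s12 q(3)[OF that] k(1) by (simp add: lv p_def exp_add)
      then have "p 1 - q 1 = p 0 - q 0"
        using log_difference_constant[OF connected_Icc contp contq, of 1 0] by auto
      then have "2 * of_real pi * \<i> * winding_number (loop s x) 0 = p 1 - p 0"
        using q(2) by (simp add: pathfinish_def pathstart_def algebra_simps)
      also have "\<dots> = (v 1 - v 0) / of_nat (degree F)"
      proof -
        have "Z x (v 1) = Z x (v 0)" using closed by (simp add: pathfinish_def pathstart_def lv)
        then show ?thesis by (simp add: p_def flip: diff_divide_distrib)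
      qed
      also have "\<dots> = 2 * of_real pi * \<i>" using degree_pos by (simp add: v_def)
      finally show ?thesis by simp
    qed
    finally show ?thesis using g b by blast
  qed
  then show ?thesis using that by blast
qed

text \<open>
  The branch \<open>y\<close> connects \<open>\<zeta> y\<close> to infinity without meeting the closed path.
\<close>
lemma winding_zero_by_branch:
  assumes P: "path P" "pathfinish P = pathstart P" and y: "y \<in> X"
    and avoid: "\<And>s. Z y (complex_of_real s) \<notin> path_image P" "\<zeta> y \<notin> path_image P"
  shows "winding_number P (\<zeta> y) = 0"
proof (rule winding_number_zero_in_outside[OF P])
  define R where "R = (\<lambda>s. Z y (complex_of_real s)) ` UNIV"
  have "continuous_on UNIV (\<lambda>s. Z y (complex_of_real s))"
    by (rule continuous_on_compose2[OF continuous_branch[OF y]]) (auto intro!: continuous_intros real_in_U)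
  then have "connected R" unfolding R_def by (rule connected_continuous_image) simp
  moreover have "\<zeta> y \<in> closure R"
  proof (rule Lim_in_closed_set[OF closed_closure])
    show "((\<lambda>s. Z y (complex_of_real s + 0)) \<longlongrightarrow> \<zeta> y) at_bot" by (rule root_end_limit[OF y])
    show "eventually (\<lambda>s. Z y (complex_of_real s + 0) \<in> closure R) at_bot"
      by (intro always_eventually allI subsetD[OF closure_subset]) (simp add: R_def)
  qed simp
  then have "insert (\<zeta> y) R \<subseteq> closure R" using closure_subset[of R] by blast
  ultimately have conn: "connected (insert (\<zeta> y) R)"
    by (intro connected_intermediate_closure[OF _ subset_insertI])
  have "\<not> bounded R"
  proof
    assume "bounded R"
    then obtain B where B: "\<And>z. z \<in> R \<Longrightarrow> norm z \<le> B" unfolding bounded_iff by blast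
    obtain M where M: "\<And>x u. \<lbrakk>x \<in> X; u \<in> U; Re u > M\<rbrakk> \<Longrightarrow> norm (Z x u) > B" using large_right[of B] by metis
    have "norm (Z y (complex_of_real (M + 1))) > B" by (rule M[OF y real_in_U]) simp
    moreover have "Z y (complex_of_real (M + 1)) \<in> R" unfolding R_def by blast
    ultimately show False using B by force
  qed
  then have "\<not> bounded (insert (\<zeta> y) R)" by simp
  then show "\<zeta> y \<in> outside (path_image P)"
    using avoid by (intro unbounded_connected_outside[OF conn]) (auto simp: R_def)
qed

text \<open>
  Follow the branch \<open>(\<tau> ^^ i) x\<close> from its root to the large loop, then the loop to the branch
  \<open>(\<tau> ^^ j) x\<close>, and this branch back to the same root.  The branch \<open>y\<close> is not passed on the loop, so it
  meets none of the three pieces and connects its own root to infinity outside this closed path.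
\<close>
lemma winding_number_between_arcs:
  assumes x: "x \<in> X" and g: "good_radius s" and ij: "i \<le> j" "j \<le> degree F"
    and ends: "\<zeta> ((\<tau> ^^ j) x) = \<zeta> ((\<tau> ^^ i) x)"
    and y: "y \<in> X" "\<zeta> y \<noteq> \<zeta> ((\<tau> ^^ i) x)" and off: "\<And>l. \<lbrakk>i \<le> l; l \<le> j\<rbrakk> \<Longrightarrow> y \<noteq> (\<tau> ^^ l) x"
    and b: "\<zeta> y \<notin> path_image (loop s x)"
  shows "winding_number (arc s ((\<tau> ^^ i) x)) (\<zeta> y) +
      winding_number (subpath (real i / degree F) (real j / degree F) (loop s x)) (\<zeta> y) =
    winding_number (arc s ((\<tau> ^^ j) x)) (\<zeta> y)"
proof -
  define p p' where "p = (\<tau> ^^ i) x" and "p' = (\<tau> ^^ j) x"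
  have pX: "p \<in> X" "p' \<in> X" using funpow_in_permutes[OF right_shift_permutes x] by (auto simp: p_def p'_def)
  define v v' where "v = real i / degree F" and "v' = real j / degree F"
  have v: "v \<in> {0..1}" "v' \<in> {0..1}" "v \<le> v'"
    using ij degree_pos by (auto simp: v_def v'_def divide_right_mono)
  let ?L = "subpath v v' (loop s x)"
  define P where "P = arc s p +++ ?L +++ reversepath (arc s p')"
  have pL: "path ?L" using path_loop[OF x g] v by (auto intro: path_subpath)
  have "pathstart ?L = Z p (complex_of_real s)" "pathfinish ?L = Z p' (complex_of_real s)"
    using loop_at[OF x g, of i] loop_at[OF x g, of j] ij by (auto simp: v_def v'_def p_def p'_def)
  note st = pathstart_arc pathfinish_arc this
  have pa: "path (arc s p)" "path (arc s p')" using path_arc pX by blast+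
  have ba: "\<zeta> y \<notin> path_image (arc s p)" "\<zeta> y \<notin> path_image (arc s p')"
    using root_notin_arc[OF pX(1) root_end_root[OF y(1)]] root_notin_arc[OF pX(2) root_end_root[OF y(1)]] y(2) ends
    by (auto simp: p_def p'_def)
  have bL: "\<zeta> y \<notin> path_image ?L" using b path_image_subpath_subset[OF v(1,2), of "loop s x"] by blast
  have im: "path_image P = path_image (arc s p) \<union> path_image ?L \<union> path_image (arc s p')"
    using st by (auto simp: P_def path_image_join)
  have "winding_number P (\<zeta> y) = 0"
  proof (rule winding_zero_by_branch[OF _ _ y(1)])
    show "path P" "pathfinish P = pathstart P" using st pa pL ends by (auto simp: P_def p_def p'_def)
    show "\<zeta> y \<notin> path_image P" unfolding im using ba bL by blast
    show "Z y (complex_of_real s') \<notin> path_image P" for s'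
    proof -
      have "Z y (complex_of_real s') \<notin> path_image ?L"
      proof
        assume "Z y (complex_of_real s') \<in> path_image ?L"
        then obtain t where t: "v \<le> t" "t \<le> v'" "Z y (complex_of_real s') = loop s x t"
          using v by (auto simp: path_image_subpath)
        then have "t \<in> {0..1}" using v by auto
        then obtain l where l: "real l = degree F * t" "y = (\<tau> ^^ l) x"
          using branch_on_loop[OF x g y(1) _ t(3)] by metis
        have "degree F * v \<le> real l" "real l \<le> degree F * v'" using l(1) t(1,2) by (simp_all add: mult_left_mono)
        then have "i \<le> l" "l \<le> j" using degree_pos by (simp_all add: v_def v'_def)
        then show False using off l(2) by blast
      qed
      moreover have "y \<noteq> p" "y \<noteq> p'" using off ij(1) by (auto simp: p_def p'_def)
      ultimately show ?thesis unfolding im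
        using branch_notin_arc[OF pX(1) y(1)] branch_notin_arc[OF pX(2) y(1)] by blast
    qed
  qed
  moreover have "winding_number P (\<zeta> y) =
      winding_number (arc s p) (\<zeta> y) + (winding_number ?L (\<zeta> y) - winding_number (arc s p') (\<zeta> y))"
    unfolding P_def using st pa pL ba bL
    by (simp add: winding_number_join winding_number_reversepath not_in_path_image_join)
  ultimately show ?thesis unfolding p_def p'_def v_def v'_def by (simp add: algebra_simps)
qed

text \<open>
  The branches \<open>x\<close> and \<open>(\<tau> ^^ j) x\<close> divide the large loop into two parts, and each of these is closed up
  through their common root.  A branch from \<open>b\<close> that ends on one part shows that the path through the
  other part does not wind around \<open>b\<close>.  But the whole loop winds around \<open>b\<close> once.
\<close>
lemma noncrossing:
  assumes x: "x \<in> X" and ord: "0 < i" "i < j" "j < k" "k < degree F"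
    and a: "\<zeta> ((\<tau> ^^ j) x) = \<zeta> x" and b: "\<zeta> ((\<tau> ^^ i) x) = b" "\<zeta> ((\<tau> ^^ k) x) = b" and ne: "\<zeta> x \<noteq> b"
  shows False
proof -
  have orb: "(\<tau> ^^ l) x \<in> X" for l using funpow_in_permutes[OF right_shift_permutes x] .
  obtain M where "\<And>s. s > M \<Longrightarrow> good_radius s \<and> b \<notin> path_image (loop s x) \<and> winding_number (loop s x) b = 1"
    using winding_number_loop[OF x] by blast
  then obtain s where g: "good_radius s" and bl: "b \<notin> path_image (loop s x)" and w1: "winding_number (loop s x) b = 1"
    using gt_ex by metis
  define v where "v = real j / degree F"
  have v: "v \<in> {0..1}" using ord by (simp add: v_def)
  have k: "(\<tau> ^^ k) x \<noteq> (\<tau> ^^ l) x" if "l \<le> j" for l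
    using right_orbit_inj[OF x, of k l] ord that by auto
  have i: "(\<tau> ^^ i) x \<noteq> (\<tau> ^^ l) x" if "j \<le> l" "l \<le> degree F" for l
    using right_orbit_inj[OF x, of i l] right_orbit_inj[OF x, of i 0] right_shift_degree[OF x] ord that degree_pos
    by (cases "l = degree F") auto
  have "winding_number (arc s x) b + winding_number (subpath 0 v (loop s x)) b = winding_number (arc s ((\<tau> ^^ j) x)) b"
    using winding_number_between_arcs[OF x g, of 0 j "(\<tau> ^^ k) x"] ord a b ne orb k bl by (simp add: v_def)
  moreover have "winding_number (arc s ((\<tau> ^^ j) x)) b + winding_number (subpath v 1 (loop s x)) b = winding_number (arc s x) b"
    using winding_number_between_arcs[OF x g, of j "degree F" "(\<tau> ^^ i) x"] ord a b ne orb i bl right_shift_degree[OF x]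
    by (simp add: v_def)
  moreover have "winding_number (subpath 0 v (loop s x)) b + winding_number (subpath v 1 (loop s x)) b = 1"
    using winding_number_subpath_combine[OF path_loop[OF x g] bl, of 0 v 1] v w1 by simp
  ultimately have "winding_number (arc s x) b + 1 = winding_number (arc s x) b" by (metis add.assoc)
  then show False by simp
qed

end

section \<open>The conjugacy class of the monodromy at infinity\<close>

definition lifts_path :: "complex poly \<Rightarrow> (real \<Rightarrow> complex) \<Rightarrow> (real \<Rightarrow> complex) \<Rightarrow> bool" where
  "lifts_path F p \<gamma> \<longleftrightarrow> path p \<and> (\<forall>s\<in>{0..1}. poly F (p s) = \<gamma> s)"

lemma lifts_path_join:
  assumes "lifts_path F p \<gamma>" "lifts_path F p' \<gamma>'" "pathfinish p = pathstart p'"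
  shows "lifts_path F (p +++ p') (\<gamma> +++ \<gamma>')"
proof -
  have "path (p +++ p')" using assms by (simp add: lifts_path_def)
  moreover have "poly F ((p +++ p') s) = (\<gamma> +++ \<gamma>') s" if "s \<in> {0..1}" for s
    using assms(1,2) that by (auto simp: lifts_path_def joinpaths_def)
  ultimately show ?thesis by (simp add: lifts_path_def)
qed

lemma lifts_path_reverse: "lifts_path F p \<gamma> \<Longrightarrow> lifts_path F (reversepath p) (reversepath \<gamma>)"
proof -
  assume p: "lifts_path F p \<gamma>"
  then have "path (reversepath p)" by (simp add: lifts_path_def)
  moreover have "poly F (reversepath p s) = reversepath \<gamma> s" if "s \<in> {0..1}" for s
    using p that by (simp add: lifts_path_def reversepath_def)
  ultimately show ?thesis by (simp add: lifts_path_def)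
qed

text \<open>
  A labelling of the fiber over \<open>t0\<close> by the indices of the branches, obtained by continuation along
  some path that joins \<open>t0\<close> to a point of the chart.  The path makes room for \<open>t0 = 0\<close>, which is not of
  the form \<open>c * exp u\<close> but may well be a regular value.
\<close>
definition marking :: "complex poly \<Rightarrow> complex \<Rightarrow> real \<Rightarrow> complex \<Rightarrow> (complex \<Rightarrow> complex) \<Rightarrow> bool" where
  "marking F c \<epsilon> t0 b \<longleftrightarrow> bij_betw b (fiber F c) (fiber F t0) \<and>
     (\<exists>u0\<in>chart_dom \<epsilon>. \<exists>\<delta> \<eta>. path \<delta> \<and> path_image \<delta> \<subseteq> - critical_values F \<and> pathstart \<delta> = t0 \<and>
        pathfinish \<delta> = c * exp u0 \<and>
        (\<forall>x\<in>fiber F c. lifts_path F (\<eta> x) \<delta> \<and> pathstart (\<eta> x) = b x \<and> pathfinish (\<eta> x) = branch F c \<epsilon> x u0))"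

context slit_chart
begin

lemma marking_regular_point:
  assumes u0: "u0 \<in> U"
  shows "marking F c \<epsilon> (E u0) (\<lambda>x. Z x u0)"
  unfolding marking_def
proof (intro conjI bexI exI ballI)
  show "bij_betw (\<lambda>x. Z x u0) X (fiber F (E u0))" by (rule bij_branch[OF u0])
  show "lifts_path F (linepath (Z x u0) (Z x u0)) (linepath (E u0) (E u0))" if "x \<in> X" for x
  proof -
    have "path (linepath (Z x u0) (Z x u0))" by (rule path_linepath)
    moreover have "linepath (Z x u0) (Z x u0) s = Z x u0" "linepath (E u0) (E u0) s = E u0" for s
      by (simp_all add: linepath_refl)
    ultimately show ?thesis using branch_value[OF that u0] unfolding lifts_path_def by metis
  qed
qed (use regular u0 in auto)

lemma marking_zero:
  assumes reg: "0 \<notin> critical_values F"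
  shows "marking F c \<epsilon> 0 \<zeta>"
  unfolding marking_def
proof (intro conjI bexI exI ballI)
  let ?\<delta> = "linepath 0 (E (complex_of_real 0))"
  have im: "\<zeta> ` X = fiber F 0"
    using root_is_root_end root_end_root by (force simp: fiber_def)
  have "card (fiber F 0) = card X" using card_fiber_regular[OF degree_pos reg] card_X by simp
  then have "inj_on \<zeta> X" using im finite_X by (metis eq_card_imp_inj_on)
  then show "bij_betw \<zeta> X (fiber F 0)" using im by (simp add: bij_betw_def)
  show "path ?\<delta>" "pathstart ?\<delta> = 0" "pathfinish ?\<delta> = E (complex_of_real 0)" by simp_all
  show "complex_of_real 0 \<in> U" by (rule real_in_U)
  have val: "?\<delta> t = E (complex_of_real (ln t))" if "t > 0" for t
    using that exp_of_real[of "ln t", where ?'a = complex] by (simp add: linepath_def scaleR_conv_of_real)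
  show "path_image ?\<delta> \<subseteq> - critical_values F"
  proof
    fix w assume "w \<in> path_image ?\<delta>"
    then obtain t where t: "t \<in> {0..1}" "w = ?\<delta> t" by (auto simp: path_image_def)
    show "w \<in> - critical_values F"
    proof (cases "t = 0")
      case True then show ?thesis using t reg by (simp add: linepath_def)
    next
      case False
      then show ?thesis using t val[of t] regular[OF real_in_U, of "ln t"] by simp
    qed
  qed
  fix x assume x: "x \<in> X"
  show "pathstart (arc 0 x) = \<zeta> x" "pathfinish (arc 0 x) = Z x (complex_of_real 0)"
    by (rule pathstart_arc pathfinish_arc)+
  have "poly F (arc 0 x t) = ?\<delta> t" if t: "t \<in> {0..1}" for t
  proof (cases "t = 0")
    case True then show ?thesis using root_end_root[OF x] by (simp add: branch_arc_def linepath_def)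
  next
    case False
    then have "t > 0" using t by simp
    then show ?thesis using val[of t] branch_value[OF x real_in_U, of "ln t"] by (simp add: branch_arc_def)
  qed
  then show "lifts_path F (arc 0 x) ?\<delta>" using path_arc[OF x] by (simp add: lifts_path_def)
qed

text \<open>
  The circle in the definition of \<open>is_tau_infinity\<close> starts on the positive real axis, so it corresponds
  to the vertical segment above \<open>s - Ln c\<close> for large \<open>s\<close>.
\<close>
lemma base_loop_in_chart:
  obtains u1 R where "R > 0" "critical_values F \<subseteq> ball 0 R" "E u1 = complex_of_real R" "Re u1 > 0"
    "\<And>s. s \<in> {0..1} \<Longrightarrow> u1 + complex_of_real (2 * pi * s) * \<i> \<in> U"
proof -
  obtain M where M: "M > 0" "critical_values F \<subseteq> ball 0 M"
    using finite_imp_bounded[OF finite_critical_values[OF degree_pos]] bounded_subset_ballD by metis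
  have ReLn: "Re (Ln c) = 0" using norm_c c_nonzero by (simp add: Re_Ln)
  have "eventually (\<lambda>s. (complex_of_real s + (- Ln c) \<in> U \<and> Re (complex_of_real s + (- Ln c)) > max 0 (ln M)) \<and>
     (complex_of_real s + (- Ln c + 2 * pi * \<i>) \<in> U \<and> Re (complex_of_real s + (- Ln c + 2 * pi * \<i>)) > 0)) at_top"
    by (intro eventually_conj eventually_far_right)
  then obtain s where s: "complex_of_real s - Ln c \<in> U" "Re (complex_of_real s - Ln c) > max 0 (ln M)"
     "complex_of_real s + (- Ln c + 2 * pi * \<i>) \<in> U" "Re (complex_of_real s + (- Ln c + 2 * pi * \<i>)) > 0"
    unfolding eventually_at_top_linorder by (metis add_uminus_conv_diff order_refl)
  \<comment> \<open>since \<open>\<bar>c\<bar> = 1\<close>, \<open>Ln c\<close> is imaginary and \<open>E u1 = exp s\<close>\<close>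
  define u1 where "u1 = complex_of_real s - Ln c"
  have s': "s > 0" "s > ln M" using s(2) ReLn by auto
  show ?thesis
  proof
    show "exp s > 0" by simp
    have "M < exp s" using s' M(1) by (metis exp_less_cancel_iff exp_ln)
    then show "critical_values F \<subseteq> ball 0 (exp s)" using M(2) by auto
    show "E u1 = complex_of_real (exp s)" using c_nonzero by (simp add: u1_def exp_diff exp_of_real)
    show "Re u1 > 0" using s' ReLn by (simp add: u1_def)
    fix r :: real assume r: "r \<in> {0..1}"
    have "(1 - r) *\<^sub>R u1 + r *\<^sub>R (u1 + 2 * pi * \<i>) \<in> {u \<in> U. Re u > 0}"
      by (rule convexD_alt[OF convex_chart_right]) (use s r s' ReLn in \<open>auto simp: u1_def algebra_simps\<close>)
    moreover have "(1 - r) *\<^sub>R u1 + r *\<^sub>R (u1 + 2 * pi * \<i>) = u1 + complex_of_real (2 * pi * r) * \<i>"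
      by (simp add: scaleR_conv_of_real algebra_simps)
    ultimately show "u1 + complex_of_real (2 * pi * r) * \<i> \<in> U" by simp
  qed
qed

lemma cycle_of_list_nth:
  assumes "distinct ps" "i < length ps"
  shows "cycle_of_list ps (ps ! i) = ps ! (Suc i mod length ps)"
proof -
  have "map (cycle_of_list ps ^^ 1) ps = rotate 1 ps" using cyclic_rotation assms(1) by blast
  then have "map (cycle_of_list ps) ps ! i = rotate 1 ps ! i" by simp
  also have "\<dots> = ps ! (Suc i mod length ps)" using nth_rotate[OF assms(2), of 1] by simp
  finally show ?thesis using assms(2) by simp
qed

text \<open>
  All branches extend over the chart, so the continuation along a path to the large circle, once
  around it, and back moves the index \<open>x\<close> to \<open>\<tau> x\<close>.
\<close>
lemma right_cycle_in_Gamma_class: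
  assumes mark: "marking F c \<epsilon> t0 b" and x0: "x0 \<in> X"
  defines "ps \<equiv> map (\<lambda>i. b ((\<tau> ^^ i) x0)) [0..<degree F]"
  shows "distinct ps \<and> set ps = fiber F t0 \<and> cycle_of_list ps \<in> Gamma_class F t0"
proof -
  have orb: "(\<tau> ^^ l) x0 \<in> X" for l using funpow_in_permutes[OF right_shift_permutes x0] .
  obtain u0 \<delta>0 \<eta> where bij: "bij_betw b X (fiber F t0)" and u0: "u0 \<in> U"
    and \<delta>0: "path \<delta>0" "path_image \<delta>0 \<subseteq> - critical_values F" "pathstart \<delta>0 = t0" "pathfinish \<delta>0 = E u0"
    and \<eta>: "\<And>x. x \<in> X \<Longrightarrow> lifts_path F (\<eta> x) \<delta>0 \<and> pathstart (\<eta> x) = b x \<and> pathfinish (\<eta> x) = Z x u0"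
    using mark unfolding marking_def by blast
  have inj: "inj_on b X" and im: "b ` X = fiber F t0" using bij by (auto simp: bij_betw_def)
  have len: "length ps = degree F" by (simp add: ps_def)
  have nth: "ps ! i = b ((\<tau> ^^ i) x0)" if "i < degree F" for i using that by (simp add: ps_def)
  have dist: "distinct ps" unfolding distinct_conv_nth len
    using nth inj orb right_orbit_inj[OF x0] by (metis inj_on_def)
  have set: "set ps = fiber F t0"
  proof -
    have "set ps = b ` ((\<lambda>l. (\<tau> ^^ l) x0) ` {..<degree F})" by (auto simp: ps_def image_image)
    then show ?thesis using right_orbit[OF x0] im by simp
  qed
  let ?\<tau>b = "cycle_of_list ps"
  have act: "?\<tau>b (b x) = b (\<tau> x)" if x: "x \<in> X" for x
  proof -
    obtain i where i: "i < degree F" "x = (\<tau> ^^ i) x0" using right_orbit[OF x0] x by force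
    have "?\<tau>b (b x) = ps ! (Suc i mod degree F)"
      using cycle_of_list_nth[OF dist, of i] i nth len by simp
    also have "\<dots> = b ((\<tau> ^^ Suc i) x0)"
    proof (cases "Suc i = degree F")
      case True
      then show ?thesis using nth[of 0] degree_pos right_shift_degree[OF x0] by (metis funpow_0 mod_self)
    next
      case False
      then show ?thesis using nth[of "Suc i"] i(1) by simp
    qed
    finally show ?thesis using i(2) by simp
  qed
  obtain u1 R where R: "R > 0" "critical_values F \<subseteq> ball 0 R" "E u1 = complex_of_real R" "Re u1 > 0"
    and circ: "\<And>s. s \<in> {0..1} \<Longrightarrow> u1 + complex_of_real (2 * pi * s) * \<i> \<in> U"
    by (rule base_loop_in_chart) blast
  have u1: "u1 \<in> U" using circ[of 0] by simp
  obtain \<omega> where \<omega>: "path \<omega>" "path_image \<omega> \<subseteq> U" "pathstart \<omega> = u0" "pathfinish \<omega> = u1"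
    using starlike_imp_path_connected[OF starlike_chart_dom[OF eps_pos]] u0 u1 unfolding path_connected_def by blast
  have contE: "continuous_on S E" for S by (intro continuous_intros)
  define \<delta> where "\<delta> = \<delta>0 +++ (E \<circ> \<omega>)"
  have p\<omega>: "path (E \<circ> \<omega>)" by (rule path_continuous_image[OF \<omega>(1) contE])
  have ends\<omega>: "pathstart (E \<circ> \<omega>) = E u0" "pathfinish (E \<circ> \<omega>) = complex_of_real R"
    using \<omega> R(3) by (simp_all add: pathstart_compose pathfinish_compose)
  have \<delta>: "path \<delta>" "pathstart \<delta> = t0" "pathfinish \<delta> = complex_of_real R"
    using \<delta>0 p\<omega> ends\<omega> by (auto simp: \<delta>_def)
  have im\<delta>: "path_image \<delta> \<subseteq> - critical_values F"
  proof -
    have "path_image (E \<circ> \<omega>) \<subseteq> - critical_values F"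
      unfolding path_image_compose using \<omega>(2) regular by auto
    then show ?thesis using \<delta>0 ends\<omega> by (simp add: \<delta>_def path_image_join)
  qed
  define H where "H = (\<lambda>x. \<eta> x +++ (Z x \<circ> \<omega>))"
  have H: "lifts_path F (H x) \<delta>" "pathstart (H x) = b x" "pathfinish (H x) = Z x u1" if x: "x \<in> X" for x
  proof -
    have "path (Z x \<circ> \<omega>)"
      by (rule path_continuous_image[OF \<omega>(1) continuous_on_subset[OF continuous_branch[OF x] \<omega>(2)]])
    moreover have "poly F ((Z x \<circ> \<omega>) s) = (E \<circ> \<omega>) s" if "s \<in> {0..1}" for s
    proof -
      have "\<omega> s \<in> U" using \<omega>(2) that unfolding path_image_def by blast
      then show ?thesis using branch_value[OF x] by simp
    qed
    ultimately have "lifts_path F (Z x \<circ> \<omega>) (E \<circ> \<omega>)" by (simp add: lifts_path_def)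
    then show "lifts_path F (H x) \<delta>" unfolding H_def \<delta>_def
      using \<eta>[OF x] \<omega>(3) by (intro lifts_path_join) (auto simp: pathstart_compose)
    show "pathstart (H x) = b x" "pathfinish (H x) = Z x u1"
      using \<eta>[OF x] \<omega>(4) by (auto simp: H_def pathfinish_compose)
  qed
  define C where "C = (\<lambda>x s. Z x (u1 + complex_of_real (2 * pi * s) * \<i>))"
  have C: "lifts_path F (C x) (circlepath 0 R)" "pathstart (C x) = Z x u1" "pathfinish (C x) = Z (\<tau> x) u1" if x: "x \<in> X" for x
  proof -
    have "path (C x)" unfolding path_def C_def
      by (rule continuous_on_compose2[OF continuous_branch[OF x]]) (use circ in \<open>auto intro!: continuous_intros\<close>)
    moreover have "poly F (C x s) = circlepath 0 R s" if "s \<in> {0..1}" for s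
    proof -
      have "poly F (C x s) = E u1 * exp (complex_of_real (2 * pi * s) * \<i>)"
        using branch_value[OF x circ[OF that]] by (simp add: C_def exp_add)
      then show ?thesis unfolding R(3) by (simp add: circlepath_def part_circlepath_def linepath_def mult_ac)
    qed
    ultimately show "lifts_path F (C x) (circlepath 0 R)" by (simp add: lifts_path_def)
    show "pathstart (C x) = Z x u1" by (simp add: C_def pathstart_def)
    show "pathfinish (C x) = Z (\<tau> x) u1"
      using right_shift_branch[OF x u1, of 1] circ[of 1] R(4) by (simp add: C_def pathfinish_def)
  qed
  have \<tau>X: "\<tau> x \<in> X" if "x \<in> X" for x using permutes_in_image[OF right_shift_permutes] that by blast
  let ?loop = "\<delta> +++ circlepath 0 R +++ reversepath \<delta>"
  have perm: "?\<tau>b permutes fiber F t0" using cycle_permutes[of ps] set by simp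
  have "induces_perm F ?loop ?\<tau>b"
    unfolding induces_perm_def
  proof (intro conjI ballI)
    show "?\<tau>b permutes fiber F (pathstart ?loop)" using perm \<delta>(2) by simp
    fix z assume "z \<in> fiber F (pathstart ?loop)"
    then obtain x where x: "x \<in> X" "z = b x" using im \<delta>(2) by auto
    let ?h = "H x +++ C x +++ reversepath (H (\<tau> x))"
    have "lifts_path F ?h ?loop"
      using H C x \<tau>X by (intro lifts_path_join lifts_path_reverse) auto
    moreover have "pathstart ?h = z" "pathfinish ?h = ?\<tau>b z" using H x \<tau>X act by auto
    ultimately show "\<exists>\<eta>. path \<eta> \<and> pathstart \<eta> = z \<and> pathfinish \<eta> = ?\<tau>b z \<and> (\<forall>s\<in>{0..1}. poly F (\<eta> s) = ?loop s)"
      unfolding lifts_path_def by blast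
  qed
  then have "is_tau_infinity F t0 ?\<tau>b"
    unfolding is_tau_infinity_def using R \<delta> im\<delta> by blast
  moreover have "id \<in> monodromy_group F t0"
    unfolding monodromy_group_def induces_perm_def
  proof (intro CollectI exI conjI ballI)
    show "path (linepath t0 t0)" "pathstart (linepath t0 t0) = t0" "pathfinish (linepath t0 t0) = t0" by simp_all
    show "path_image (linepath t0 t0) \<subseteq> - critical_values F"
      using im\<delta> \<delta>(2) pathstart_in_path_image[of \<delta>] by auto
    show "id permutes fiber F (pathstart (linepath t0 t0))" by (rule permutes_id)
    fix z assume z: "z \<in> fiber F (pathstart (linepath t0 t0))"
    show "path (linepath z z)" "pathstart (linepath z z) = z" "pathfinish (linepath z z) = id z" by simp_all
    show "poly F (linepath z z s) = linepath t0 t0 s" for s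
    proof -
      have "poly F z = t0" using z unfolding fiber_def by (simp del: linepath_refl)
      then show ?thesis by (simp add: linepath_refl)
    qed
  qed
  ultimately have "?\<tau>b \<in> Gamma_class F t0"
    unfolding Gamma_class_def by (intro CollectI exI[of _ id] exI[of _ ?\<tau>b]) auto
  then show ?thesis using dist set by blast
qed

text \<open>
  For the cycle of \<open>right_cycle_in_Gamma_class\<close>, started at a branch from \<open>a\<close>, the sum in the definition
  of balancedness is a nonzero multiple of the difference of the centroids of two sets of roots of
  unity, those at the positions of the branches from \<open>a\<close> and those from \<open>a'\<close>.
\<close>
lemma two_root_cycle_unbalanced:
  assumes mark: "marking F c \<epsilon> t0 b"
    and roots: "poly F a = 0" "poly F a' = 0" "a \<noteq> a'"
    and n: "\<And>x. x \<in> X \<Longrightarrow> n (b x) = (N * of_bool (\<zeta> x = a) - N' * of_bool (\<zeta> x = a') :: int)"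
    and N: "N * int (card {x \<in> X. \<zeta> x = a}) = N' * int (card {x \<in> X. \<zeta> x = a'})" "N \<noteq> 0"
  shows "\<not> balanced F t0 n"
proof
  assume bal: "balanced F t0 n"
  obtain x0 where x0: "x0 \<in> X" "\<zeta> x0 = a" using root_is_root_end[OF roots(1)] by blast
  have orb: "(\<tau> ^^ l) x0 \<in> X" for l using funpow_in_permutes[OF right_shift_permutes x0(1)] .
  let ?ps = "map (\<lambda>i. b ((\<tau> ^^ i) x0)) [0..<degree F]"
  let ?\<omega> = "cis (2 * pi / real (degree F))"
  define A where "A = (\<lambda>a. {i. i < degree F \<and> \<zeta> ((\<tau> ^^ i) x0) = a})"
  have card: "card (A e) = card {x \<in> X. \<zeta> x = e}" for e
  proof -
    have "(\<lambda>l. (\<tau> ^^ l) x0) ` A e = {x \<in> X. \<zeta> x = e}"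
      using right_orbit[OF x0(1)] by (force simp: A_def)
    moreover have "inj_on (\<lambda>l. (\<tau> ^^ l) x0) (A e)"
      using right_orbit_inj[OF x0(1)] by (auto simp: A_def inj_on_def)
    ultimately show ?thesis by (metis card_image)
  qed
  have "0 = (\<Sum>i=1..degree F. of_int (n (?ps ! (i - 1))) * ?\<omega> ^ i)"
    using bal right_cycle_in_Gamma_class[OF mark x0(1)] unfolding balanced_def by simp
  also have "\<dots> = (\<Sum>i<degree F. of_int (n (?ps ! i)) * ?\<omega> ^ Suc i)"
    by (rule sum.reindex_bij_witness[of _ Suc "\<lambda>i. i - 1"]) auto
  also have "\<dots> = ?\<omega> * (\<Sum>i<degree F. of_int (n (b ((\<tau> ^^ i) x0))) * ?\<omega> ^ i)"
    by (simp add: sum_distrib_left mult_ac)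
  finally have "(\<Sum>i<degree F. of_int (n (b ((\<tau> ^^ i) x0))) * ?\<omega> ^ i) = 0"
    by (simp only: mult_eq_0_iff cis_neq_zero simp_thms eq_commute[of 0])
  moreover have "(\<Sum>i<degree F. of_int (n (b ((\<tau> ^^ i) x0))) * ?\<omega> ^ i) =
      of_int N * (\<Sum>i\<in>A a. ?\<omega> ^ i) - of_int N' * (\<Sum>i\<in>A a'. ?\<omega> ^ i)"
  proof -
    have S: "(\<Sum>i\<in>A e. ?\<omega> ^ i) = (\<Sum>i<degree F. of_bool (\<zeta> ((\<tau> ^^ i) x0) = e) * ?\<omega> ^ i)" for e
      unfolding A_def by (intro sum.mono_neutral_cong_left) auto
    show ?thesis unfolding S sum_distrib_left sum_subtractf[symmetric]
      by (intro sum.cong refl) (simp add: n[OF orb] algebra_simps)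
  qed
  ultimately have "of_int N * (\<Sum>i\<in>A a. ?\<omega> ^ i) = of_int N' * (\<Sum>i\<in>A a'. ?\<omega> ^ i)" by simp
  note eqN = this
  have eqc: "of_int N' * of_nat (card (A a')) = (of_int N * of_nat (card (A a)) :: complex)"
    using arg_cong[OF N(1), of "of_int :: int \<Rightarrow> complex"] by (simp only: card of_int_mult of_int_of_nat_eq)
  have "of_int N * k * (k' * SA) = of_int N * k * (k * SB)"
    if "of_int N * SA = of_int N' * SB" "of_int N' * k' = of_int N * k" for SA SB k k' :: complex
    using that by algebra
  note cross = this[OF eqN eqc]
  have "card (A a) > 0" using root_is_root_end[OF roots(1)] finite_X unfolding card by (auto simp: card_gt_0_iff)
  then have eq: "of_nat (card (A a')) * (\<Sum>i\<in>A a. ?\<omega> ^ i) = of_nat (card (A a)) * (\<Sum>i\<in>A a'. ?\<omega> ^ i)"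
    using N(2) cross by simp
  have "of_nat (card (A a')) * (\<Sum>i\<in>A a. ?\<omega> ^ i) \<noteq> of_nat (card (A a)) * (\<Sum>i\<in>A a'. ?\<omega> ^ i)"
  proof (rule noncrossing_centroids_differ)
    show "A a \<subseteq> {..<degree F}" "A a' \<subseteq> {..<degree F}" "A a \<inter> A a' = {}" "0 \<in> A a"
      using roots(3) x0 degree_pos by (auto simp: A_def)
    have "card (A a') > 0" using root_is_root_end[OF roots(2)] finite_X unfolding card by (auto simp: card_gt_0_iff)
    then show "A a' \<noteq> {}" by force
    show False if "i \<in> A a'" "j \<in> A a" "k \<in> A a'" "i < j" "j < k" for i j k
    proof (rule noncrossing[OF x0(1), of i j k a'])
      show "0 < i" using that(1) x0(2) roots(3) by (cases i) (auto simp: A_def)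
    qed (use that roots(3) x0(2) in \<open>auto simp: A_def\<close>)
  qed
  then show False using eq by simp
qed

end

section \<open>Decompositions and projected cycles\<close>

lemma pcompose_factor:
  fixes f0 h :: "complex poly"
  assumes "degree (pcompose f0 h) > 0"
  shows "degree f0 > 0" "degree h > 0" "critical_values f0 \<subseteq> critical_values (pcompose f0 h)"
proof -
  show d: "degree f0 > 0" "degree h > 0" using assms by (auto simp: degree_pcompose)
  show "critical_values f0 \<subseteq> critical_values (pcompose f0 h)"
  proof
    fix v assume "v \<in> critical_values f0"
    then obtain w where w: "poly (pderiv f0) w = 0" "v = poly f0 w" by (auto simp: critical_values_def)
    obtain z where "poly h z = w" using fiber_nonempty[OF d(2), of w] unfolding fiber_def by blast
    then show "v \<in> critical_values (pcompose f0 h)"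
      using w unfolding critical_values_def by (intro image_eqI[of _ _ z]) (auto simp: pderiv_pcompose poly_pcompose)
  qed
qed

text \<open>
  The weights of \<open>endpoint_cycle\<close> in terms of branches, for two arbitrary roots in place of 0 and 1:
  being close to a root is expressed as having it as limit.
\<close>
definition end_weight :: "complex poly \<Rightarrow> complex \<Rightarrow> real \<Rightarrow> complex \<Rightarrow> complex \<Rightarrow> complex \<Rightarrow> int" where
  "end_weight F c \<epsilon> a a' x =
     int (order a' F) * of_bool (root_end F c \<epsilon> x = a) - int (order a F) * of_bool (root_end F c \<epsilon> x = a')"

context slit_chart
begin

text \<open>
  The value 0 is not taken by \<open>E\<close>; if it is regular, then the limits of the branches label its fiber.
\<close>
definition base_point :: "complex \<Rightarrow> (complex \<Rightarrow> complex) \<Rightarrow> bool" where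
  "base_point t0 b \<longleftrightarrow> (t0 = 0 \<and> 0 \<notin> critical_values F \<and> b = \<zeta>) \<or> (\<exists>u0\<in>U. t0 = E u0 \<and> b = (\<lambda>x. Z x u0))"

lemma base_point_marking: "base_point t0 b \<Longrightarrow> marking F c \<epsilon> t0 b"
  using marking_zero marking_regular_point unfolding base_point_def by blast

lemma base_point_bij: "base_point t0 b \<Longrightarrow> bij_betw b X (fiber F t0)"
  using base_point_marking unfolding marking_def by blast

end

locale decomposed_chart = slit_chart f c \<epsilon> + G: slit_chart f0 c \<epsilon>
  for f f0 :: "complex poly" and c \<epsilon> +
  fixes h :: "complex poly"
  assumes decomp: "f = pcompose f0 h"
begin

lemma poly_decomp: "poly f z = poly f0 (poly h z)" by (simp add: decomp poly_pcompose)

lemma image_in_fiber: "x \<in> X \<Longrightarrow> poly h x \<in> G.X" by (simp add: fiber_def poly_decomp)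

lemma image_branch:
  assumes x: "x \<in> X" and u: "u \<in> U"
  shows "poly h (Z x u) = G.Z (poly h x) u"
proof (rule G.branch_unique[OF image_in_fiber[OF x] connected_chart_dom[OF eps_pos] subset_refl _ _ zero_in_U _ u])
  show "continuous_on U (\<lambda>u. poly h (Z x u))"
    by (rule continuous_on_compose2[OF continuous_on_poly_fun[of UNIV] continuous_branch[OF x]]) simp
  show "poly f0 (poly h (Z x u)) = E u" if "u \<in> U" for u
    using branch_value[OF x that] by (simp add: poly_decomp)
  show "poly h (Z x 0) = G.Z (poly h x) 0" by (simp add: branch_0[OF x] G.branch_0[OF image_in_fiber[OF x]])
qed

lemma image_root_end:
  assumes x: "x \<in> X"
  shows "G.\<zeta> (poly h x) = poly h (\<zeta> x)"
proof (rule tendsto_unique[OF trivial_limit_at_bot_linorder])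
  show "((\<lambda>s. G.Z (poly h x) (complex_of_real s + 0)) \<longlongrightarrow> G.\<zeta> (poly h x)) at_bot"
    by (rule G.root_end_limit[OF image_in_fiber[OF x]])
  have "((\<lambda>s. poly h (Z x (complex_of_real s + 0))) \<longlongrightarrow> poly h (\<zeta> x)) at_bot"
    by (rule tendsto_poly[OF root_end_limit[OF x]])
  then show "((\<lambda>s. G.Z (poly h x) (complex_of_real s + 0)) \<longlongrightarrow> poly h (\<zeta> x)) at_bot"
    using image_branch[OF x real_in_U] by simp
qed

lemma image_left_shift:
  assumes x: "x \<in> X"
  shows "(G.\<sigma> ^^ l) (poly h x) = poly h ((\<sigma> ^^ l) x)"
proof -
  note hx = image_in_fiber[OF x]
  have sx: "(\<sigma> ^^ l) x \<in> X" by (rule funpow_in_permutes[OF left_shift_permutes x])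
  obtain s where s: "complex_of_real s \<in> U" "s < 0" "complex_of_real s + turn l \<in> U"
    using far_left_real[of 0 "turn l"] by blast
  have "G.Z ((G.\<sigma> ^^ l) (poly h x)) (complex_of_real s) = poly h (Z x (complex_of_real s + turn l))"
    using G.left_shift_branch[OF hx s(1,3)] s(2) image_branch[OF x s(3)] by simp
  also have "\<dots> = G.Z (poly h ((\<sigma> ^^ l) x)) (complex_of_real s)"
    using left_shift_branch[OF x s(1,3)] s(2) image_branch[OF sx s(1)] by simp
  finally show ?thesis
    using G.inj_branch[OF s(1)] funpow_in_permutes[OF G.left_shift_permutes hx] image_in_fiber[OF sx]
    by (simp add: inj_on_def)
qed

text \<open>
  The branches of \<open>f\<close> that issue from \<open>a\<close> and are sent to the branch \<open>y\<close> of \<open>f0\<close> by \<open>h\<close>.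
\<close>
definition over :: "complex \<Rightarrow> complex \<Rightarrow> complex set" where
  "over a y = {x \<in> X. \<zeta> x = a \<and> poly h x = y}"

lemma finite_over: "finite (over a y)" using finite_X by (simp add: over_def)

lemma card_over_le:
  assumes y: "y \<in> G.X" and y': "y' \<in> G.X" and e: "G.\<zeta> y' = G.\<zeta> y"
  shows "card (over a y) \<le> card (over a y')"
proof -
  obtain l where l: "y' = (G.\<sigma> ^^ l) y" using G.left_orbit[OF y y' e] by blast
  have "(\<sigma> ^^ l) ` over a y \<subseteq> over a y'"
    using funpow_in_permutes[OF left_shift_permutes] root_end_left_shift image_left_shift l by (auto simp: over_def)
  moreover have "inj_on (\<sigma> ^^ l) (over a y)"
    using inj_fn[OF permutes_inj[OF left_shift_permutes]] inj_on_subset by blast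
  ultimately show ?thesis using card_inj_on_le finite_over by blast
qed

text \<open>
  The left shift commutes with \<open>h\<close> and permutes the branches of \<open>f0\<close> from \<open>h a\<close> transitively, so the
  branches of \<open>f\<close> from \<open>a\<close> are distributed evenly among them.
\<close>
lemma card_over_mult:
  assumes a: "poly f a = 0" and y: "y \<in> G.X" "G.\<zeta> y = poly h a"
  shows "card (over a y) * card {y \<in> G.X. G.\<zeta> y = poly h a} = order a f"
proof -
  let ?Y = "{y \<in> G.X. G.\<zeta> y = poly h a}"
  have "{x \<in> X. \<zeta> x = a} = (\<Union>y'\<in>?Y. over a y')"
    using image_in_fiber image_root_end by (auto simp: over_def)
  moreover have "card (\<Union>y'\<in>?Y. over a y') = (\<Sum>y'\<in>?Y. card (over a y'))"
    using G.finite_X finite_over by (intro card_UN_disjoint) (auto simp: over_def)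
  moreover have "card (over a y') = card (over a y)" if "y' \<in> ?Y" for y'
    using that y by (intro antisym card_over_le) auto
  ultimately show ?thesis using card_root_end[OF a] by (simp add: mult.commute)
qed

lemma over_empty: "G.\<zeta> y \<noteq> poly h a \<Longrightarrow> over a y = {}"
  using image_root_end by (auto simp: over_def)

lemma base_point_image:
  assumes "base_point t0 b"
  obtains b0 where "marking f0 c \<epsilon> t0 b0" "\<And>x. x \<in> X \<Longrightarrow> b0 (poly h x) = poly h (b x)"
proof (cases "t0 = 0 \<and> 0 \<notin> critical_values f \<and> b = \<zeta>")
  case True
  then have "0 \<notin> critical_values f0" using pcompose_factor(3)[of f0 h] degree_pos decomp by auto
  then show ?thesis using that[of G.\<zeta>] G.marking_zero image_root_end True by simp
next
  case False
  then obtain u0 where "u0 \<in> U" "t0 = E u0" "b = (\<lambda>x. Z x u0)" using assms unfolding base_point_def by blast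
  then show ?thesis using that[of "\<lambda>y. G.Z y u0"] G.marking_regular_point image_branch by simp
qed

text \<open>
  The projected weights are constant on the branches from \<open>h a\<close> and on those from \<open>h a'\<close>, and on either
  set they have the total \<open>order a f * order a' f\<close>, with opposite signs.  If \<open>h a = h a'\<close>, then they
  cancel; otherwise the weights are those of \<open>two_root_cycle_unbalanced\<close>.
\<close>
lemma projected_unbalanced_or_trivial:
  assumes bp: "base_point t0 b" and roots: "poly f a = 0" "poly f a' = 0"
    and n: "\<And>x. x \<in> X \<Longrightarrow> n (b x) = end_weight f c \<epsilon> a a' x"
  shows "\<not> balanced f0 t0 (projected_cycle f t0 h n) \<or> trivial_cycle f0 t0 (projected_cycle f t0 h n)"
proof -
  obtain b0 where b0: "marking f0 c \<epsilon> t0 b0" "\<And>x. x \<in> X \<Longrightarrow> b0 (poly h x) = poly h (b x)"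
    using base_point_image[OF bp] by blast
  have bij0: "bij_betw b0 G.X (fiber f0 t0)" using b0(1) by (simp add: marking_def)
  have bij: "bij_betw b X (fiber f t0)" by (rule base_point_bij[OF bp])
  have proj: "projected_cycle f t0 h n (b0 y) = int (order a' f) * int (card (over a y)) - int (order a f) * int (card (over a' y))"
    if y: "y \<in> G.X" for y
  proof -
    have cnt: "(\<Sum>x | x \<in> X \<and> poly h x = y. of_bool (\<zeta> x = e)) = int (card (over e y))" for e :: complex
    proof -
      have "(\<Sum>x | x \<in> X \<and> poly h x = y. of_bool (\<zeta> x = e)) = (\<Sum>x\<in>over e y. 1::int)"
        using finite_X by (intro sum.mono_neutral_cong_right) (auto simp: over_def)
      then show ?thesis by simp
    qed
    have "{z \<in> fiber f t0. poly h z = b0 y} = b ` {x \<in> X. poly h x = y}"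
    proof -
      have "b0 (poly h x) = b0 y \<longleftrightarrow> poly h x = y" if "x \<in> X" for x
        using bij0 image_in_fiber[OF that] y by (auto simp: bij_betw_def inj_on_def)
      then show ?thesis using bij b0(2) unfolding bij_betw_def by force
    qed
    then have "projected_cycle f t0 h n (b0 y) = (\<Sum>z\<in>b ` {x \<in> X. poly h x = y}. n z)"
      by (simp add: projected_cycle_def)
    also have "\<dots> = (\<Sum>x | x \<in> X \<and> poly h x = y. n (b x))"
      by (subst sum.reindex) (use bij in \<open>auto simp: bij_betw_def inj_on_def\<close>)
    also have "\<dots> = (\<Sum>x | x \<in> X \<and> poly h x = y. int (order a' f) * of_bool (\<zeta> x = a) - int (order a f) * of_bool (\<zeta> x = a'))"
      by (intro sum.cong) (auto simp: n end_weight_def)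
    also have "\<dots> = int (order a' f) * (\<Sum>x | x \<in> X \<and> poly h x = y. of_bool (\<zeta> x = a)) -
        int (order a f) * (\<Sum>x | x \<in> X \<and> poly h x = y. of_bool (\<zeta> x = a'))"
      by (simp add: sum_subtractf sum_distrib_left)
    finally show ?thesis by (simp only: cnt)
  qed
  obtain y0 y1 where y0: "y0 \<in> G.X" "G.\<zeta> y0 = poly h a" and y1: "y1 \<in> G.X" "G.\<zeta> y1 = poly h a'"
  proof -
    obtain x0 x1 where x: "x0 \<in> X" "\<zeta> x0 = a" "x1 \<in> X" "\<zeta> x1 = a'"
      using root_is_root_end[OF roots(1)] root_is_root_end[OF roots(2)] by blast
    show ?thesis
      by (rule that[OF image_in_fiber[OF x(1)] _ image_in_fiber[OF x(3)]]) (simp_all add: image_root_end x)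
  qed
  define k k' where "k = card (over a y0)" and "k' = card (over a' y1)"
  let ?e = "card {y \<in> G.X. G.\<zeta> y = poly h a}" and ?e' = "card {y \<in> G.X. G.\<zeta> y = poly h a'}"
  have k: "k * ?e = order a f" "k' * ?e' = order a' f"
    using card_over_mult[OF roots(1) y0] card_over_mult[OF roots(2) y1] by (simp_all add: k_def k'_def)
  have co: "card (over a y) = (if G.\<zeta> y = poly h a then k else 0)" if "y \<in> G.X" for y
    using over_empty[of y a] that y0 unfolding k_def by (auto intro!: antisym card_over_le)
  have co': "card (over a' y) = (if G.\<zeta> y = poly h a' then k' else 0)" if "y \<in> G.X" for y
    using over_empty[of y a'] that y1 unfolding k'_def by (auto intro!: antisym card_over_le)
  have ord: "order a f > 0" "order a' f > 0" using roots F_nonzero order_root by blast+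
  let ?N = "int (order a' f * k)" and ?N' = "int (order a f * k')"
  have proj': "projected_cycle f t0 h n (b0 y) = ?N * of_bool (G.\<zeta> y = poly h a) - ?N' * of_bool (G.\<zeta> y = poly h a')"
    if "y \<in> G.X" for y
    using proj[OF that] co[OF that] co'[OF that] by simp
  have cross: "order a' f * k * ?e = order a f * k' * ?e'" unfolding mult.assoc k by (rule mult.commute)
  have pos: "?e \<noteq> 0" "k \<noteq> 0"
  proof -
    show "?e \<noteq> 0"
    proof
      assume "?e = 0"
      then show False using k(1) ord(1) by simp
    qed
    show "k \<noteq> 0" using k(1) ord(1) by (intro notI) simp
  qed
  show ?thesis
  proof (cases "poly h a = poly h a'")
    case True
    then have "order a' f * k * ?e = order a f * k' * ?e" using cross by simp
    then have "order a' f * k = order a f * k'" using pos(1) by simp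
    then have "projected_cycle f t0 h n w = 0" if "w \<in> fiber f0 t0" for w
      using proj' True bij0 that unfolding bij_betw_def by force
    then show ?thesis by (simp add: trivial_cycle_def)
  next
    case False
    have "\<not> balanced f0 t0 (projected_cycle f t0 h n)"
    proof (rule G.two_root_cycle_unbalanced[OF b0(1) _ _ False proj'])
      show "poly f0 (poly h a) = 0" "poly f0 (poly h a') = 0" using roots by (simp_all add: poly_decomp)
      show "?N * int ?e = ?N' * int ?e'" using cross by (simp only: of_nat_mult[symmetric])
      show "?N \<noteq> 0" using pos(2) ord by simp
    qed
    then show ?thesis by blast
  qed
qed

end

context slit_chart
begin

lemma two_root_cycle_totally_unbalanced:
  assumes bp: "base_point t0 b" and roots: "poly F a = 0" "poly F a' = 0"
    and n: "\<And>x. x \<in> X \<Longrightarrow> n (b x) = end_weight F c \<epsilon> a a' x"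
  shows "totally_unbalanced F t0 n"
  unfolding totally_unbalanced_def
proof (intro allI impI)
  fix f0 h assume d: "F = pcompose f0 h"
  interpret G: slit_chart f0 c \<epsilon>
    using pcompose_factor[of f0 h] degree_pos norm_c eps_pos regular unfolding d by unfold_locales auto
  interpret decomposed_chart F f0 c \<epsilon> h by unfold_locales (fact d)
  show "\<not> balanced f0 t0 (projected_cycle F t0 h n) \<or> trivial_cycle f0 t0 (projected_cycle F t0 h n)"
    by (rule projected_unbalanced_or_trivial[OF bp roots n])
qed

lemma sum_end_weight:
  assumes roots: "poly F a = 0" "poly F a' = 0"
  shows "(\<Sum>x\<in>X. of_int (end_weight F c \<epsilon> a a' x) * (G (\<zeta> x) :: complex)) = of_nat (order a F * order a' F) * (G a - G a')"
proof -
  have *: "(\<Sum>x\<in>X. of_bool (\<zeta> x = e) * G (\<zeta> x)) = of_nat (order e F) * G e" if "poly F e = 0" for e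
  proof -
    have "(\<Sum>x\<in>X. of_bool (\<zeta> x = e) * G (\<zeta> x)) = (\<Sum>x\<in>{x \<in> X. \<zeta> x = e}. G e)"
      using finite_X by (intro sum.mono_neutral_cong_right) auto
    then show ?thesis using card_root_end[OF that] by simp
  qed
  have "(\<Sum>x\<in>X. of_int (end_weight F c \<epsilon> a a' x) * G (\<zeta> x)) =
     of_nat (order a' F) * (\<Sum>x\<in>X. of_bool (\<zeta> x = a) * G (\<zeta> x)) - of_nat (order a F) * (\<Sum>x\<in>X. of_bool (\<zeta> x = a') * G (\<zeta> x))"
    unfolding sum_distrib_left sum_subtractf[symmetric]
    by (intro sum.cong refl) (simp add: end_weight_def algebra_simps)
  then show ?thesis unfolding *[OF roots(1)] *[OF roots(2)] by (simp add: algebra_simps)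
qed

lemma sum_end_weight_eq_0:
  assumes roots: "poly F a = 0" "poly F a' = 0"
  shows "(\<Sum>x\<in>X. end_weight F c \<epsilon> a a' x) = 0"
proof -
  have "(\<Sum>x\<in>X. of_int (end_weight F c \<epsilon> a a' x) * (1::complex)) = 0"
    using sum_end_weight[OF roots, of "\<lambda>_. 1"] by simp
  then have "complex_of_int (\<Sum>x\<in>X. end_weight F c \<epsilon> a a' x) = 0" by simp
  then show ?thesis by (simp only: of_int_eq_0_iff)
qed

end

section \<open>The resolvent integral\<close>

lemma lagrange_partial_fractions:
  fixes F q :: "complex poly"
  assumes d: "degree F > 0" and deg: "degree q < degree F" and t: "t \<notin> critical_values F" and w: "poly F w \<noteq> t"
  shows "poly q w / (poly F w - t) = (\<Sum>z\<in>fiber F t. poly q z / poly (pderiv F) z * (1 / (w - z)))"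
proof -
  have fin: "finite (fiber F t)" by (rule finite_fiber[OF d])
  define H where "H = (\<lambda>z. (F - [:t:]) div [:-z, 1:])"
  have H: "F - [:t:] = [:-z, 1:] * H z" if "z \<in> fiber F t" for z
  proof -
    have "[:-z, 1:] dvd F - [:t:]" using that by (simp add: fiber_def poly_eq_0_iff_dvd[symmetric])
    then show ?thesis by (simp only: H_def dvd_mult_div_cancel)
  qed
  have Hval: "(v - z) * poly (H z) v = poly F v - t" if "z \<in> fiber F t" for z v
    using arg_cong[OF H[OF that], of "\<lambda>p. poly p v"] by (simp add: algebra_simps)
  have F'z: "poly (pderiv F) z \<noteq> 0" if "z \<in> fiber F t" for z
    using t that by (auto simp: critical_values_def fiber_def)
  have Hdiag: "poly (H z) z = poly (pderiv F) z" if "z \<in> fiber F t" for z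
  proof -
    have "pderiv F = pderiv (F - [:t:])" by (simp add: pderiv_diff)
    also have "\<dots> = pderiv ([:-z, 1:] * H z)" using H[OF that] by simp
    finally show ?thesis by (simp add: pderiv_mult pderiv_pCons del: mult_pCons_left)
  qed
  have Hoff: "poly (H z) v = 0" if "z \<in> fiber F t" "v \<in> fiber F t" "v \<noteq> z" for z v
    using Hval[OF that(1), of v] that by (simp add: fiber_def)
  have Hdeg: "degree (H z) < degree F" if "z \<in> fiber F t" for z
  proof -
    have "F - [:t:] \<noteq> 0" using degree_diff_const[OF d, of t] d by force
    then have "H z \<noteq> 0" using H[OF that] by auto
    then have "degree (F - [:t:]) = 1 + degree (H z)" using H[OF that] using degree_mult_eq[of "[:-z, 1:]" "H z"] by (simp del: mult_pCons_left)
    then show ?thesis using degree_diff_const[OF d, of t] by simp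
  qed
  \<comment> \<open>the difference to the interpolating polynomial has too many zeros\<close>
  define D where "D = q - (\<Sum>z\<in>fiber F t. smult (poly q z / poly (pderiv F) z) (H z))"
  have "degree (\<Sum>z\<in>fiber F t. smult (poly q z / poly (pderiv F) z) (H z)) \<le> degree F - 1"
    by (rule degree_sum_le[OF fin]) (use Hdeg in \<open>force intro: order_trans[OF degree_smult_le]\<close>)
  then have "degree D \<le> degree F - 1" unfolding D_def using deg by (intro degree_diff_le) auto
  then have Ddeg: "degree D < degree F" using d by simp
  have "poly D v = 0" if v: "v \<in> fiber F t" for v
  proof -
    have "(\<Sum>z\<in>fiber F t. poly q z / poly (pderiv F) z * poly (H z) v) = (\<Sum>z\<in>{v}. poly q z / poly (pderiv F) z * poly (H z) v)"
      using fin v Hoff by (intro sum.mono_neutral_right) auto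
    also have "\<dots> = poly q v" using F'z[OF v] Hdiag[OF v] by simp
    finally show ?thesis by (simp add: D_def poly_sum)
  qed
  then have sub: "fiber F t \<subseteq> {v. poly D v = 0}" by blast
  have "D = 0"
  proof (rule ccontr)
    assume "D \<noteq> 0"
    then have "card (fiber F t) \<le> card {v. poly D v = 0}" using sub by (intro card_mono poly_roots_finite)
    also have "\<dots> \<le> degree D" using card_poly_roots_bound[OF \<open>D \<noteq> 0\<close>] by simp
    finally show False using card_fiber_regular[OF d t] Ddeg by simp
  qed
  then have "poly q w = (\<Sum>z\<in>fiber F t. poly q z / poly (pderiv F) z * poly (H z) w)"
  proof -
    have "q = (\<Sum>z\<in>fiber F t. smult (poly q z / poly (pderiv F) z) (H z))" using \<open>D = 0\<close> by (simp add: D_def)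
    from arg_cong[OF this, of "\<lambda>p. poly p w"] show ?thesis by (simp only: poly_sum poly_smult)
  qed
  also have "\<dots> = (\<Sum>z\<in>fiber F t. poly q z / poly (pderiv F) z * (1 / (w - z))) * (poly F w - t)"
    unfolding sum_distrib_right
  proof (rule sum.cong[OF refl])
    fix z assume z: "z \<in> fiber F t"
    then have "w \<noteq> z" using w by (auto simp: fiber_def)
    then have "poly (H z) w = (poly F w - t) / (w - z)" using Hval[OF z, of w] by (simp add: field_simps)
    then show "poly q z / poly (pderiv F) z * poly (H z) w = poly q z / poly (pderiv F) z * (1 / (w - z)) * (poly F w - t)"
      by simp
  qed
  finally show ?thesis using w by (simp add: divide_eq_eq)
qed

text \<open>
  The integral of \<open>1 / (w - z)\<close> over the segment from \<open>a\<close> to \<open>a'\<close>, if \<open>z\<close> is further from 0 than both.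
\<close>
definition segment_log :: "complex \<Rightarrow> complex \<Rightarrow> complex \<Rightarrow> complex" where
  "segment_log a a' z = Ln (1 - a' / z) - Ln (1 - a / z)"

lemma one_minus_quotient_Re_pos:
  fixes w z :: complex
  assumes "norm w < norm z"
  shows "Re (1 - w / z) > 0"
proof -
  have "norm (w / z) < 1" using assms by (simp add: norm_divide divide_less_eq)
  then show ?thesis using abs_Re_le_cmod[of "w / z"] by simp
qed

lemma integral_simple_pole:
  assumes "norm a < norm z" "norm a' < norm z"
  shows "((\<lambda>w. 1 / (w - z)) has_contour_integral segment_log a a' z) (linepath a a')"
proof -
  have z0: "z \<noteq> 0" using assms by force
  have "((\<lambda>w. 1 / (w - z)) has_contour_integral
      (Ln (1 - pathfinish (linepath a a') / z) - Ln (1 - pathstart (linepath a a') / z))) (linepath a a')"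
  proof (rule contour_integral_primitive[where S = "ball 0 (norm z)"])
    fix w :: complex assume "w \<in> ball 0 (norm z)"
    then have w: "norm w < norm z" by simp
    then have "1 - w / z \<notin> \<real>\<^sub>\<le>\<^sub>0" using one_minus_quotient_Re_pos complex_nonpos_Reals_iff by force
    moreover have "z \<noteq> w" using w by auto
    ultimately show "((\<lambda>w. Ln (1 - w / z)) has_field_derivative 1 / (w - z)) (at w within ball 0 (norm z))"
      using z0 by (auto intro!: derivative_eq_intros simp: divide_simps)
  next
    show "path_image (linepath a a') \<subseteq> ball 0 (norm z)"
      using assms by (simp add: closed_segment_subset)
  qed simp
  then show ?thesis by (simp add: segment_log_def)
qed

lemma divide_shifted:
  fixes x y z t :: complex
  assumes "y \<noteq> t"
  shows "(x * y + z) / (y - t) = x + (t * (x / (y - t)) + z / (y - t))"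
proof -
  have "x * y + z = x * (y - t) + (t * x + z)" by (simp add: algebra_simps)
  then show ?thesis using assms by (simp add: add_divide_distrib)
qed

text \<open>
  The polynomial \<open>P\<close> accounts for numerators of large degree: a division \<open>q = A * F + B\<close> turns
  \<open>q / (F - t)\<close> into \<open>A + (t * A + B) / (F - t)\<close>, and \<open>A\<close> has smaller degree than \<open>q\<close>.
\<close>
lemma resolvent_integral:
  fixes F q :: "complex poly"
  assumes d: "degree F > 0"
  shows "\<exists>P::complex poly. \<forall>t. t \<notin> critical_values F \<and> (\<forall>z\<in>fiber F t. norm z > norm a \<and> norm z > norm a') \<longrightarrow>
     contour_integral (linepath a a') (\<lambda>w. poly q w / (poly F w - t)) =
       poly P t + (\<Sum>z\<in>fiber F t. poly q z / poly (pderiv F) z * segment_log a a' z)"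
proof (induction "degree q" arbitrary: q rule: less_induct)
  case less
  have ne: "poly F w \<noteq> t" if "\<forall>z\<in>fiber F t. norm z > norm a \<and> norm z > norm a'" "w \<in> closed_segment a a'" for t w
  proof
    assume "poly F w = t"
    then have "norm w > norm a" "norm w > norm a'" using that(1) by (auto simp: fiber_def)
    moreover have "closed_segment a a' \<subseteq> cball 0 (max (norm a) (norm a'))" by (intro closed_segment_subset) auto
    ultimately show False using that(2) by auto
  qed
  have small: "contour_integral (linepath a a') (\<lambda>w. poly q w / (poly F w - t)) =
      (\<Sum>z\<in>fiber F t. poly q z / poly (pderiv F) z * segment_log a a' z)"
    if "degree q < degree F" and t: "t \<notin> critical_values F" "\<forall>z\<in>fiber F t. norm z > norm a \<and> norm z > norm a'" for q t
  proof (rule contour_integral_unique)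
    have "((\<lambda>w. \<Sum>z\<in>fiber F t. poly q z / poly (pderiv F) z * (1 / (w - z))) has_contour_integral
        (\<Sum>z\<in>fiber F t. poly q z / poly (pderiv F) z * segment_log a a' z)) (linepath a a')"
      using t(2) by (intro has_contour_integral_sum finite_fiber[OF d] has_contour_integral_lmul integral_simple_pole) auto
    then show "((\<lambda>w. poly q w / (poly F w - t)) has_contour_integral
        (\<Sum>z\<in>fiber F t. poly q z / poly (pderiv F) z * segment_log a a' z)) (linepath a a')"
      by (rule has_contour_integral_eq)
        (use lagrange_partial_fractions[OF d that(1) t(1)] ne[OF t(2)] in auto)
  qed
  show ?case
  proof (cases "degree q < degree F")
    case True
    then show ?thesis using small by (intro exI[of _ 0]) auto
  next
    case False
    define A B where "A = q div F" and "B = q mod F"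
    have q: "q = A * F + B" by (simp add: A_def B_def)
    have "F \<noteq> 0" using d by auto
    then have degB: "degree B < degree F" unfolding B_def using degree_mod_less'[of F q] d by (cases "q mod F = 0") auto
    have degA: "degree A < degree q"
    proof (cases "A = 0")
      case True then show ?thesis using False d by simp
    next
      case False
      then have "degree (A * F) = degree A + degree F" using \<open>F \<noteq> 0\<close> by (rule degree_mult_eq)
      moreover from this have "degree q = degree (A * F)" unfolding q using degB by (intro degree_add_eq_left) simp
      ultimately show ?thesis using d by simp
    qed
    obtain P where P: "\<And>t. t \<notin> critical_values F \<Longrightarrow> (\<forall>z\<in>fiber F t. norm z > norm a \<and> norm z > norm a') \<Longrightarrow>
      contour_integral (linepath a a') (\<lambda>w. poly A w / (poly F w - t)) =
       poly P t + (\<Sum>z\<in>fiber F t. poly A z / poly (pderiv F) z * segment_log a a' z)"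
      using less[OF degA] by blast
    let ?c = "contour_integral (linepath a a') (poly A)"
    show ?thesis
    proof (intro exI allI impI)
      fix t assume t: "t \<notin> critical_values F \<and> (\<forall>z\<in>fiber F t. norm z > norm a \<and> norm z > norm a')"
      have int: "(\<lambda>w. poly p w / (poly F w - t)) contour_integrable_on linepath a a'" for p
        using ne t by (intro contour_integrable_continuous_linepath continuous_intros) auto
      have intA: "poly A contour_integrable_on linepath a a'"
        by (intro contour_integrable_continuous_linepath continuous_on_poly_fun)
      have "contour_integral (linepath a a') (\<lambda>w. poly q w / (poly F w - t)) =
         contour_integral (linepath a a') (\<lambda>w. poly A w + (t * (poly A w / (poly F w - t)) + poly B w / (poly F w - t)))"
      proof (rule contour_integral_eq)
        fix w assume "w \<in> path_image (linepath a a')"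
        then have "poly F w \<noteq> t" using ne t by simp
        then show "poly q w / (poly F w - t) = poly A w + (t * (poly A w / (poly F w - t)) + poly B w / (poly F w - t))"
          unfolding q poly_add poly_mult by (rule divide_shifted)
      qed
      also have "\<dots> = ?c + (t * contour_integral (linepath a a') (\<lambda>w. poly A w / (poly F w - t)) +
          contour_integral (linepath a a') (\<lambda>w. poly B w / (poly F w - t)))"
        unfolding contour_integral_add[OF intA contour_integrable_add[OF contour_integrable_lmul[OF int] int]]
          contour_integral_add[OF contour_integrable_lmul[OF int] int] contour_integral_lmul[OF int] by (rule refl)
      also have "\<dots> = poly ([:?c:] + [:0, 1:] * P) t + (t * (\<Sum>z\<in>fiber F t. poly A z / poly (pderiv F) z * segment_log a a' z) +
          (\<Sum>z\<in>fiber F t. poly B z / poly (pderiv F) z * segment_log a a' z))"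
        using P[of t] small[OF degB, of t] t by (simp add: algebra_simps)
      also have "t * (\<Sum>z\<in>fiber F t. poly A z / poly (pderiv F) z * segment_log a a' z) +
          (\<Sum>z\<in>fiber F t. poly B z / poly (pderiv F) z * segment_log a a' z) =
          (\<Sum>z\<in>fiber F t. poly q z / poly (pderiv F) z * segment_log a a' z)"
        unfolding sum_distrib_left sum.distrib[symmetric]
        by (rule sum.cong[OF refl]) (simp add: fiber_def q add_divide_distrib distrib_left distrib_right mult_ac del: div_mult_mod_eq)
      finally show "contour_integral (linepath a a') (\<lambda>w. poly q w / (poly F w - t)) =
         poly ([:?c:] + [:0, 1:] * P) t + (\<Sum>z\<in>fiber F t. poly q z / poly (pderiv F) z * segment_log a a' z)" .
    qed
  qed
qed

text \<open>
  If the moments vanish, then an additional factor \<open>F\<close> in the numerator multiplies the integral by \<open>t\<close>.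
  The integrals with \<open>F ^ n\<close> grow like \<open>B ^ n\<close> at most, which for \<open>\<bar>t\<bar> > B\<close> forces all of them to vanish.
\<close>
lemma vanishing_moments_resolvent:
  fixes F q :: "complex poly"
  assumes mom: "\<And>k. contour_integral (linepath a a') (\<lambda>w. poly F w ^ k * poly q w) = 0"
  obtains B where "\<And>t. norm t > B \<Longrightarrow> contour_integral (linepath a a') (\<lambda>w. poly q w / (poly F w - t)) = 0"
proof -
  have "compact (poly F ` closed_segment a a')" "compact (poly q ` closed_segment a a')"
    by (intro compact_continuous_image continuous_on_poly_fun compact_segment)+
  then obtain B C where B: "B > 0" "\<And>w. w \<in> closed_segment a a' \<Longrightarrow> norm (poly F w) \<le> B"
    and C: "C > 0" "\<And>w. w \<in> closed_segment a a' \<Longrightarrow> norm (poly q w) \<le> C"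
    using compact_imp_bounded bounded_pos by (metis imageI)
  have "contour_integral (linepath a a') (\<lambda>w. poly q w / (poly F w - t)) = 0" if t: "norm t > B" for t
  proof -
    have t0: "norm t > 0" using t B(1) by linarith
    have far: "norm t - B \<le> norm (poly F w - t)" if "w \<in> closed_segment a a'" for w
      using B(2)[OF that] norm_triangle_ineq2[of t "poly F w"] by (simp add: norm_minus_commute)
    then have ne: "poly F w \<noteq> t" if "w \<in> closed_segment a a'" for w using that t by force
    define J where "J = (\<lambda>n. contour_integral (linepath a a') (\<lambda>w. poly F w ^ n * poly q w / (poly F w - t)))"
    have int: "(\<lambda>w. poly F w ^ n * poly q w / (poly F w - t)) contour_integrable_on linepath a a'" for n
      using ne by (intro contour_integrable_continuous_linepath continuous_intros) auto
    have int': "(\<lambda>w. poly F w ^ n * poly q w) contour_integrable_on linepath a a'" for n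
      by (intro contour_integrable_continuous_linepath continuous_intros)
    have step: "J (Suc n) = t * J n" for n
    proof -
      have "J (Suc n) = contour_integral (linepath a a') (\<lambda>w. poly F w ^ n * poly q w + t * (poly F w ^ n * poly q w / (poly F w - t)))"
        unfolding J_def
      proof (rule contour_integral_eq)
        fix w assume "w \<in> path_image (linepath a a')"
        then have "poly F w \<noteq> t" using ne by simp
        then show "poly F w ^ Suc n * poly q w / (poly F w - t) =
            poly F w ^ n * poly q w + t * (poly F w ^ n * poly q w / (poly F w - t))"
          by (simp add: field_simps)
      qed
      also have "\<dots> = t * J n"
        unfolding contour_integral_add[OF int' contour_integrable_lmul[OF int]] contour_integral_lmul[OF int] mom
        by (simp add: J_def)
      finally show ?thesis .
    qed
    have Jn: "J n = t ^ n * J 0" for n by (induction n) (simp_all add: step)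
    define D where "D = C / (norm t - B) * norm (a' - a)"
    have bound: "norm (J n) \<le> B ^ n * D" for n
    proof -
      have "norm (J n) \<le> (B ^ n * C / (norm t - B)) * norm (a' - a)"
        unfolding J_def
      proof (rule contour_integral_bound_linepath[OF int])
        show "0 \<le> B ^ n * C / (norm t - B)" using B(1) C(1) t by simp
        fix w assume w: "w \<in> closed_segment a a'"
        have "norm (poly F w) ^ n * norm (poly q w) \<le> B ^ n * C"
          using B C w by (intro mult_mono power_mono) auto
        then show "norm (poly F w ^ n * poly q w / (poly F w - t)) \<le> B ^ n * C / (norm t - B)"
          using far[OF w] t B(1) C(1) by (simp add: norm_divide norm_mult norm_power) (intro frac_le, auto)
      qed
      then show ?thesis by (simp add: D_def)
    qed
    have "norm (J 0) \<le> (B / norm t) ^ n * D" for n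
      using bound[of n] t0 unfolding Jn[of n] by (simp add: norm_mult norm_power power_divide field_simps)
    moreover have "(\<lambda>n. (B / norm t) ^ n * D) \<longlonglongrightarrow> 0 * D"
      using t t0 B(1) by (intro tendsto_intros LIMSEQ_power_zero) (simp add: norm_divide)
    ultimately have "norm (J 0) \<le> 0" using LIMSEQ_le_const[of "\<lambda>n. (B / norm t) ^ n * D" "0 * D" "norm (J 0)"] by simp
    then show ?thesis by (simp add: J_def)
  qed
  then show ?thesis using that by blast
qed

section \<open>Vanishing moments and vanishing branch sums\<close>

context slit_chart
begin

lemma derivative_of_branch_sum:
  fixes N :: "complex \<Rightarrow> complex"
  assumes G: "\<And>z. (G has_field_derivative q z) (at z)" and u: "u \<in> U"
  shows "((\<lambda>u. \<Sum>x\<in>X. N x * G (Z x u)) has_field_derivative (\<Sum>x\<in>X. N x * (q (Z x u) * (E u / poly (pderiv F) (Z x u))))) (at u)"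
  by (intro DERIV_sum DERIV_cmult DERIV_chain2[OF G] branch_has_derivative) (use u in auto)

lemma limit_of_branch_sum:
  fixes N :: "complex \<Rightarrow> complex"
  assumes G: "continuous_on UNIV G" and const: "\<And>u. u \<in> U \<Longrightarrow> (\<Sum>x\<in>X. N x * G (Z x u)) = k"
  shows "(\<Sum>x\<in>X. N x * G (\<zeta> x)) = k"
proof (rule tendsto_unique[OF trivial_limit_at_bot_linorder])
  show "((\<lambda>s. \<Sum>x\<in>X. N x * G (Z x (complex_of_real s + 0))) \<longlongrightarrow> (\<Sum>x\<in>X. N x * G (\<zeta> x))) at_bot"
    using G by (intro tendsto_sum tendsto_mult tendsto_const isCont_tendsto_compose[OF _ root_end_limit])
      (auto simp: continuous_on_eq_continuous_at)
  show "((\<lambda>s. \<Sum>x\<in>X. N x * G (Z x (complex_of_real s + 0))) \<longlongrightarrow> k) at_bot"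
    using const real_in_U by simp
qed

text \<open>
  Under \<open>degree F\<close> successive turns at infinity each branch runs through the whole fiber.  The average
  of the sum over these turns is therefore a multiple of the sum of the weights.
\<close>
lemma branch_sum_constant_imp_zero:
  fixes N :: "complex \<Rightarrow> complex"
  assumes N: "(\<Sum>x\<in>X. N x) = 0" and const: "\<And>u. u \<in> U \<Longrightarrow> (\<Sum>x\<in>X. N x * G (Z x u)) = k"
  shows "k = 0"
proof -
  obtain s where s: "good_radius s" using good_radiusI gt_ex by blast
  have pt: "complex_of_real s + turn l \<in> U" if "l < degree F" for l
    using loop_point_in_U[OF s, of "real l / degree F"] that degree_pos by (simp add: divide_le_eq mult.assoc)
  have "s > 0" using s by (simp add: good_radius_def)
  define T where "T = (\<Sum>y\<in>X. G (Z y (complex_of_real s)))"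
  have orbit_sum: "(\<Sum>l<degree F. G (Z x (complex_of_real s + turn l))) = T" if x: "x \<in> X" for x
  proof -
    have inj: "inj_on (\<lambda>l. (\<tau> ^^ l) x) {..<degree F}"
      by (rule inj_on_funpow_orbit[OF right_shift_permutes x right_shift_period[OF x]])
    have "(\<Sum>l<degree F. G (Z x (complex_of_real s + turn l))) = (\<Sum>l<degree F. G (Z ((\<tau> ^^ l) x) (complex_of_real s)))"
      using right_shift_branch[OF x real_in_U pt] \<open>s > 0\<close> by simp
    also have "\<dots> = (\<Sum>y\<in>(\<lambda>l. (\<tau> ^^ l) x) ` {..<degree F}. G (Z y (complex_of_real s)))"
      by (simp add: sum.reindex[OF inj])
    finally show ?thesis using right_orbit[OF x] by (simp add: T_def)
  qed
  have "of_nat (degree F) * k = (\<Sum>l<degree F. \<Sum>x\<in>X. N x * G (Z x (complex_of_real s + turn l)))"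
    using const pt by simp
  also have "\<dots> = (\<Sum>x\<in>X. N x * (\<Sum>l<degree F. G (Z x (complex_of_real s + turn l))))"
    by (subst sum.swap) (simp add: sum_distrib_left)
  also have "\<dots> = (\<Sum>x\<in>X. N x) * T" unfolding sum_distrib_right by (rule sum.cong[OF refl]) (simp only: orbit_sum)
  finally show ?thesis using N degree_pos by simp
qed

text \<open>
  Let \<open>G\<close> be a primitive of \<open>F ^ k * q\<close>.  The branch sum of \<open>G\<close> has derivative \<open>E ^ k\<close> times that of the
  branch sum of \<open>g\<close>, so it is constant, hence 0.  Its limit on the left is a nonzero multiple of
  \<open>G a - G a'\<close>.
\<close>
lemma branch_sum_zero_imp_moments:
  assumes roots: "poly F a = 0" "poly F a' = 0"
    and g: "\<And>z. (g has_field_derivative poly q z) (at z)"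
    and zero: "\<And>u. u \<in> U \<Longrightarrow> (\<Sum>x\<in>X. of_int (end_weight F c \<epsilon> a a' x) * g (Z x u)) = 0"
  shows "contour_integral (linepath a a') (\<lambda>w. poly F w ^ k * poly q w) = 0"
proof -
  let ?N = "\<lambda>x. of_int (end_weight F c \<epsilon> a a' x) :: complex"
  have "(\<lambda>w. poly F w ^ k * poly q w) holomorphic_on UNIV"
    by (intro holomorphic_intros)
  then obtain G where G: "\<And>z. (G has_field_derivative poly F z ^ k * poly q z) (at z)"
    using holomorphic_convex_primitive'[OF convex_UNIV open_UNIV, of "\<lambda>w. poly F w ^ k * poly q w"] by auto
  have "(\<lambda>u. \<Sum>x\<in>X. ?N x * G (Z x u)) constant_on U"
  proof (rule has_field_derivative_0_imp_constant_on[OF _ connected_chart_dom[OF eps_pos] open_chart_dom])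
    fix u assume u: "u \<in> U"
    have "((\<lambda>u. \<Sum>x\<in>X. ?N x * g (Z x u)) has_field_derivative 0) (at u)"
      by (rule has_field_derivative_transform_within_open[OF DERIV_const[of 0] open_chart_dom u]) (simp add: zero)
    then have "(\<Sum>x\<in>X. ?N x * (poly q (Z x u) * (E u / poly (pderiv F) (Z x u)))) = 0"
      by (rule DERIV_unique[OF derivative_of_branch_sum[OF g u, of ?N]])
    then have "0 = E u ^ k * (\<Sum>x\<in>X. ?N x * (poly q (Z x u) * (E u / poly (pderiv F) (Z x u))))" by simp
    also have "\<dots> = (\<Sum>x\<in>X. ?N x * ((poly F (Z x u) ^ k * poly q (Z x u)) * (E u / poly (pderiv F) (Z x u))))"
      unfolding sum_distrib_left by (rule sum.cong[OF refl]) (simp add: branch_value[OF _ u])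
    finally show "((\<lambda>u. \<Sum>x\<in>X. ?N x * G (Z x u)) has_field_derivative 0) (at u)"
      using derivative_of_branch_sum[OF G u, of ?N] by simp
  qed
  then obtain C where C: "\<And>u. u \<in> U \<Longrightarrow> (\<Sum>x\<in>X. ?N x * G (Z x u)) = C" unfolding constant_on_def by blast
  have "(\<Sum>x\<in>X. ?N x) = 0" using sum_end_weight_eq_0[OF roots] by (simp flip: of_int_sum)
  then have "C = 0" by (rule branch_sum_constant_imp_zero[OF _ C])
  have "continuous_on UNIV G" using DERIV_isCont[OF G] by (simp add: continuous_on_eq_continuous_at)
  then have "(\<Sum>x\<in>X. ?N x * G (\<zeta> x)) = C" using C by (rule limit_of_branch_sum)
  then have "of_nat (order a F * order a' F) * (G a - G a') = 0" using sum_end_weight[OF roots, of G] \<open>C = 0\<close> by simp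
  moreover have "order a F > 0" "order a' F > 0" using roots F_nonzero order_root by blast+
  ultimately have "G a = G a'" by simp
  moreover have "((\<lambda>w. poly F w ^ k * poly q w) has_contour_integral (G (pathfinish (linepath a a')) - G (pathstart (linepath a a')))) (linepath a a')"
    by (rule contour_integral_primitive[where S = UNIV]) (use G in auto)
  ultimately show ?thesis using contour_integral_unique by force
qed

end

context slit_chart
begin

text \<open>
  During \<open>l\<close> turns around 0 that restore the branch, it winds \<open>l / \<mu>\<close> times around its own root \<open>\<zeta> x\<close>, where
  \<open>\<mu>\<close> is the order of this root, and around no other root.
\<close>
lemma branch_log_left_shift:
  assumes x: "x \<in> X" and e: "poly F e = 0"
    and \<l>: "continuous_on U \<l>" "\<And>u. u \<in> U \<Longrightarrow> Z x u - e = exp (\<l> u)"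
  shows "\<exists>M>0. \<forall>u l. u \<in> U \<and> Re u < - M \<and> u + turn l \<in> U \<and> (\<sigma> ^^ l) x = x \<longrightarrow>
     \<l> (u + turn l) - \<l> u = of_bool (\<zeta> x = e) * turn l / of_nat (order e F)"
proof (cases "\<zeta> x = e")
  case True
  obtain M K where M: "M > 0"
    and contK: "\<And>y. \<lbrakk>y \<in> X; \<zeta> y = e\<rbrakk> \<Longrightarrow> continuous_on {u \<in> U. Re u < - M} (\<lambda>u. K (Z y u))"
    and rep: "\<And>y. \<lbrakk>y \<in> X; \<zeta> y = e\<rbrakk> \<Longrightarrow> \<exists>k. k \<noteq> 0 \<and> (\<forall>u\<in>{u \<in> U. Re u < - M}. Z y u - e = k * exp ((u - K (Z y u)) / of_nat (order e F)))"
    by (rule branch_representation_left[OF e]) blast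
  obtain k where k: "k \<noteq> 0" "\<And>u. u \<in> {u \<in> U. Re u < - M} \<Longrightarrow> Z x u - e = k * exp ((u - K (Z x u)) / of_nat (order e F))"
    using rep[OF x True] by blast
  let ?V = "{u \<in> U. Re u < - M}" and ?\<mu> = "of_nat (order e F) :: complex"
  have ord: "order e F > 0" using e F_nonzero order_root by blast
  have conn: "connected ?V" using convex_far_left[of M] M convex_connected by auto
  have cont\<l>: "continuous_on ?V \<l>" by (rule continuous_on_subset[OF \<l>(1)]) auto
  have contg: "continuous_on ?V (\<lambda>u. Ln k + (u - K (Z x u)) / ?\<mu>)"
    using contK[OF x True] ord by (intro continuous_intros) auto
  have eq: "exp (\<l> u) = exp (Ln k + (u - K (Z x u)) / ?\<mu>)" if "u \<in> ?V" for u
    using \<l>(2)[of u] k(2)[OF that] k(1) that by (simp add: exp_add)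
  have "\<l> (u + turn l) - \<l> u = of_bool (\<zeta> x = e) * turn l / ?\<mu>"
    if u: "u \<in> U" "Re u < - M" "u + turn l \<in> U" "(\<sigma> ^^ l) x = x" for u l
  proof -
    let ?v = "u + turn l"
    have "Z x ?v = Z x u" using left_shift_branch[OF x u(1,3)] u(2,4) M by simp
    moreover have "\<l> ?v - (Ln k + (?v - K (Z x ?v)) / ?\<mu>) = \<l> u - (Ln k + (u - K (Z x u)) / ?\<mu>)"
      by (rule log_difference_constant[OF conn cont\<l> contg eq]) (use u in auto)
    ultimately have "\<l> ?v - \<l> u = (?v - K (Z x u)) / ?\<mu> - (u - K (Z x u)) / ?\<mu>" by (simp add: algebra_simps)
    also have "\<dots> = turn l / ?\<mu>" by (simp flip: diff_divide_distrib)
    finally show ?thesis using True by simp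
  qed
  then show ?thesis using M by blast
next
  case False
  define r where "r = dist (\<zeta> x) e"
  have "r > 0" using False by (simp add: r_def)
  then obtain M where M: "M > 0" "\<forall>u\<in>U. Re u < - M \<longrightarrow> dist (Z x u) (\<zeta> x) < r"
    using root_end_near[OF x] by blast
  let ?V = "{u \<in> U. Re u < - M}"
  have conn: "connected ?V" using convex_far_left[of M] M(1) convex_connected by auto
  have cont\<l>: "continuous_on ?V \<l>" by (rule continuous_on_subset[OF \<l>(1)]) auto
  let ?g = "\<lambda>u. Ln (1 + (Z x u - \<zeta> x) / (\<zeta> x - e)) + Ln (\<zeta> x - e)"
  have contZ: "continuous_on ?V (Z x)" by (rule continuous_on_subset[OF continuous_branch[OF x]]) auto
  have re: "Re (1 + (Z x u - \<zeta> x) / (\<zeta> x - e)) > 0" if "u \<in> ?V" for u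
  proof -
    have "norm (Z x u - \<zeta> x) < norm (\<zeta> x - e)" using M(2) that by (auto simp: r_def dist_norm)
    then have "Re (1 - (- (Z x u - \<zeta> x)) / (\<zeta> x - e)) > 0" by (intro one_minus_quotient_Re_pos) (simp add: norm_minus_commute)
    then show ?thesis by (simp only: minus_divide_left[symmetric] diff_minus_eq_add)
  qed
  have contg: "continuous_on ?V ?g"
  proof -
    have "1 + (Z x u - \<zeta> x) / (\<zeta> x - e) \<notin> \<real>\<^sub>\<le>\<^sub>0" if "u \<in> ?V" for u
      using re[OF that] by (auto simp: complex_nonpos_Reals_iff)
    then show ?thesis using False by (intro continuous_intros contZ) auto
  qed
  have eq: "exp (\<l> u) = exp (?g u)" if "u \<in> ?V" for u
  proof -
    have "1 + (Z x u - \<zeta> x) / (\<zeta> x - e) \<noteq> 0" using re[OF that] by force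
    then have "exp (?g u) = (1 + (Z x u - \<zeta> x) / (\<zeta> x - e)) * (\<zeta> x - e)"
      using False by (simp add: exp_add)
    also have "\<dots> = Z x u - e" using False by (simp add: field_simps)
    finally show ?thesis using \<l>(2)[of u] that by simp
  qed
  have "\<l> (u + turn l) - \<l> u = of_bool (\<zeta> x = e) * turn l / of_nat (order e F)"
    if u: "u \<in> U" "Re u < - M" "u + turn l \<in> U" "(\<sigma> ^^ l) x = x" for u l
  proof -
    let ?v = "u + turn l"
    have "Z x ?v = Z x u" using left_shift_branch[OF x u(1,3)] u(2,4) M(1) by simp
    moreover have "\<l> ?v - ?g ?v = \<l> u - ?g u"
      by (rule log_difference_constant[OF conn cont\<l> contg eq]) (use u in auto)
    ultimately show ?thesis using False by simp
  qed
  then show ?thesis using M(1) by blast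
qed

lemma branch_minus_root_log:
  assumes x: "x \<in> X" and e: "poly F e = 0"
  obtains \<l> where "\<l> holomorphic_on U" "\<And>u. u \<in> U \<Longrightarrow> Z x u - e = exp (\<l> u)"
proof (rule simply_connected_imp_holomorphic_log[OF _ simply_connected_chart_dom[OF eps_pos]
      open_imp_locally_path_connected[OF open_chart_dom]])
  show "(\<lambda>u. Z x u - e) holomorphic_on U" by (intro holomorphic_intros holomorphic_branch[OF x])
  show "Z x u - e \<noteq> 0" if "u \<in> U" for u
  proof
    assume "Z x u - e = 0"
    then have "poly F (Z x u) = 0" using e by simp
    then show False using branch_value[OF x that] E_nonzero by metis
  qed
qed (use that in blast)

text \<open>
  The continuation of \<open>segment_log a a'\<close> along the branch, from large values to small ones, is the
  difference of the logarithms of \<open>Z x u - a'\<close> and \<open>Z x u - a\<close>.  Its increment under turns around 0 is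
  proportional to the weight of the branch.
\<close>
lemma continued_segment_log:
  assumes x: "x \<in> X" and roots: "poly F a = 0" "poly F a' = 0"
  obtains \<Lambda> M where "\<Lambda> holomorphic_on U" "M > 0"
    "\<And>u. \<lbrakk>u \<in> U; Re u > M\<rbrakk> \<Longrightarrow> \<Lambda> u = segment_log a a' (Z x u)"
    "\<And>u l. \<lbrakk>u \<in> U; Re u < - M; u + turn l \<in> U; (\<sigma> ^^ l) x = x\<rbrakk> \<Longrightarrow>
       of_nat (order a F * order a' F) * (\<Lambda> (u + turn l) - \<Lambda> u) =
         - turn l * of_int (end_weight F c \<epsilon> a a' x)"
proof -
  obtain \<l> where \<l>: "\<l> holomorphic_on U" "\<And>u. u \<in> U \<Longrightarrow> Z x u - a = exp (\<l> u)"
    using branch_minus_root_log[OF x roots(1)] by blast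
  obtain \<l>' where \<l>': "\<l>' holomorphic_on U" "\<And>u. u \<in> U \<Longrightarrow> Z x u - a' = exp (\<l>' u)"
    using branch_minus_root_log[OF x roots(2)] by blast
  note cont = holomorphic_on_imp_continuous_on[OF \<l>(1)] holomorphic_on_imp_continuous_on[OF \<l>'(1)]
  obtain M1 where M1: "M1 > 0" "\<And>u l. u \<in> U \<and> Re u < - M1 \<and> u + turn l \<in> U \<and> (\<sigma> ^^ l) x = x \<Longrightarrow>
     \<l> (u + turn l) - \<l> u = of_bool (\<zeta> x = a) * turn l / of_nat (order a F)"
    using branch_log_left_shift[OF x roots(1) cont(1) \<l>(2)] by blast
  obtain M2 where M2: "M2 > 0" "\<And>u l. u \<in> U \<and> Re u < - M2 \<and> u + turn l \<in> U \<and> (\<sigma> ^^ l) x = x \<Longrightarrow>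
     \<l>' (u + turn l) - \<l>' u = of_bool (\<zeta> x = a') * turn l / of_nat (order a' F)"
    using branch_log_left_shift[OF x roots(2) cont(2) \<l>'(2)] by blast
  obtain M3 where M3: "M3 > 0" "\<And>x u. \<lbrakk>x \<in> X; u \<in> U; Re u > M3\<rbrakk> \<Longrightarrow> norm (Z x u) > norm a + norm a'"
    using large_right[of "norm a + norm a'"] by metis
  let ?V = "{u \<in> U. Re u > M3}"
  have conn: "connected ?V" using convex_far_right[of M3] M3(1) convex_connected by auto
  have big: "norm a < norm (Z x u)" "norm a' < norm (Z x u)" if "u \<in> ?V" for u
    using M3(2)[OF x, of u] that norm_ge_zero[of a] norm_ge_zero[of a'] by (auto intro: order.strict_trans1[rotated])
  have contZ: "continuous_on ?V (Z x)" by (rule continuous_on_subset[OF continuous_branch[OF x]]) auto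
  have Zne: "Z x u \<noteq> 0" if "u \<in> ?V" for u using big[OF that] by force
  have slit: "1 - a / Z x u \<notin> \<real>\<^sub>\<le>\<^sub>0" "1 - a' / Z x u \<notin> \<real>\<^sub>\<le>\<^sub>0" if "u \<in> ?V" for u
    using one_minus_quotient_Re_pos[OF big(1)[OF that]] one_minus_quotient_Re_pos[OF big(2)[OF that]]
    by (auto simp: complex_nonpos_Reals_iff)
  have contS: "continuous_on ?V (\<lambda>u. segment_log a a' (Z x u))"
    unfolding segment_log_def using Zne slit by (intro continuous_intros contZ) auto
  have cont\<l>: "continuous_on ?V (\<lambda>u. \<l>' u - \<l> u)"
    by (intro continuous_on_diff continuous_on_subset[OF cont(1)] continuous_on_subset[OF cont(2)]) auto
  have eq: "exp (\<l>' u - \<l> u) = exp (segment_log a a' (Z x u))" if u: "u \<in> ?V" for u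
  proof -
    have nz: "1 - a / Z x u \<noteq> 0" "1 - a' / Z x u \<noteq> 0" using slit[OF u] by auto
    have "exp (segment_log a a' (Z x u)) = (1 - a' / Z x u) / (1 - a / Z x u)"
      using nz by (simp add: segment_log_def exp_diff)
    also have "\<dots> = (Z x u - a') / (Z x u - a)"
    proof -
      have "1 - a / Z x u = (Z x u - a) / Z x u" "1 - a' / Z x u = (Z x u - a') / Z x u"
        using Zne[OF u] by (simp_all add: diff_divide_distrib)
      then show ?thesis using Zne[OF u] by simp
    qed
    also have "\<dots> = exp (\<l>' u - \<l> u)" using \<l>(2)[of u] \<l>'(2)[of u] u by (simp add: exp_diff)
    finally show ?thesis by simp
  qed
  define u1 where "u1 = complex_of_real (M3 + 1)"
  have u1: "u1 \<in> ?V" using real_in_U[of "M3 + 1"] by (simp add: u1_def)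
  define k where "k = (\<l>' u1 - \<l> u1) - segment_log a a' (Z x u1)"
  define \<Lambda> where "\<Lambda> = (\<lambda>u. \<l>' u - \<l> u - k)"
  show ?thesis
  proof (rule that[of \<Lambda> "max M1 (max M2 M3)"])
    show "\<Lambda> holomorphic_on U" unfolding \<Lambda>_def by (intro holomorphic_intros \<l> \<l>')
    show "max M1 (max M2 M3) > 0" using M1(1) by simp
    show "\<Lambda> u = segment_log a a' (Z x u)" if "u \<in> U" "Re u > max M1 (max M2 M3)" for u
    proof -
      have "(\<l>' u - \<l> u) - segment_log a a' (Z x u) = k" unfolding k_def
        by (rule log_difference_constant[OF conn cont\<l> contS eq _ u1]) (use that in auto)
      then show ?thesis by (simp add: \<Lambda>_def algebra_simps)
    qed
    fix u l assume u: "u \<in> U" "Re u < - max M1 (max M2 M3)" "u + turn l \<in> U" "(\<sigma> ^^ l) x = x"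
    let ?p = "turn l"
    have ord: "order a F > 0" "order a' F > 0" using roots F_nonzero order_root by blast+
    have "\<Lambda> (u + ?p) - \<Lambda> u = (\<l>' (u + ?p) - \<l>' u) - (\<l> (u + ?p) - \<l> u)"
      by (simp add: \<Lambda>_def)
    also have "\<dots> = of_bool (\<zeta> x = a') * ?p / of_nat (order a' F) - of_bool (\<zeta> x = a) * ?p / of_nat (order a F)"
      using M1(2)[of u l] M2(2)[of u l] u by simp
    finally show "of_nat (order a F * order a' F) * (\<Lambda> (u + ?p) - \<Lambda> u) = - ?p * of_int (end_weight F c \<epsilon> a a' x)"
      using ord by (simp add: end_weight_def field_simps)
  qed
qed

lemma left_shift_finite_order:
  obtains n where "n > 0" "\<sigma> ^^ n = id"
  using permutation_is_nilpotent[of \<sigma>] permutation_permutes finite_X left_shift_permutes by blast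

text \<open>
  For large values the resolvent integral is 0, which is the relation \<open>\<Theta> = 0\<close> between the continued
  logarithms.  It persists over the whole chart.  Turns around 0 that restore all branches leave
  everything but the logarithms unchanged; the increments of the logarithms therefore satisfy a
  linear relation, which says that the derivative of the branch sum of \<open>g\<close> vanishes.  The constant
  value of this sum is its limit, a multiple of \<open>g a' - g a\<close>, which is the moment of exponent 0.
\<close>
lemma moments_imp_branch_sum_zero:
  assumes roots: "poly F a = 0" "poly F a' = 0"
    and g: "\<And>z. (g has_field_derivative poly q z) (at z)"
    and mom: "\<And>k. contour_integral (linepath a a') (\<lambda>w. poly F w ^ k * poly q w) = 0"
    and u: "u \<in> U"
  shows "(\<Sum>x\<in>X. of_int (end_weight F c \<epsilon> a a' x) * g (Z x u)) = 0"
proof -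
  let ?N = "\<lambda>x. of_int (end_weight F c \<epsilon> a a' x) :: complex"
  let ?r = "\<lambda>x u. poly q (Z x u) / poly (pderiv F) (Z x u)"
  have ord: "order a F > 0" "order a' F > 0" using roots F_nonzero order_root by blast+
  have "\<forall>x\<in>X. \<exists>\<Lambda> M. \<Lambda> holomorphic_on U \<and> M > 0 \<and>
    (\<forall>u. u \<in> U \<and> Re u > M \<longrightarrow> \<Lambda> u = segment_log a a' (Z x u)) \<and>
    (\<forall>u l. u \<in> U \<and> Re u < - M \<and> u + turn l \<in> U \<and> (\<sigma> ^^ l) x = x \<longrightarrow>
       of_nat (order a F * order a' F) * (\<Lambda> (u + turn l) - \<Lambda> u) = - turn l * ?N x)"
  proof
    fix x assume x: "x \<in> X"
    show "\<exists>\<Lambda> M. \<Lambda> holomorphic_on U \<and> M > 0 \<and>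
    (\<forall>u. u \<in> U \<and> Re u > M \<longrightarrow> \<Lambda> u = segment_log a a' (Z x u)) \<and>
    (\<forall>u l. u \<in> U \<and> Re u < - M \<and> u + turn l \<in> U \<and> (\<sigma> ^^ l) x = x \<longrightarrow>
       of_nat (order a F * order a' F) * (\<Lambda> (u + turn l) - \<Lambda> u) = - turn l * ?N x)"
      by (rule continued_segment_log[OF x roots]) blast
  qed
  then obtain \<Lambda> m where hol\<Lambda>: "\<And>x. x \<in> X \<Longrightarrow> \<Lambda> x holomorphic_on U" and m: "\<And>x. x \<in> X \<Longrightarrow> m x > 0"
    and right: "\<And>x u. \<lbrakk>x \<in> X; u \<in> U; Re u > m x\<rbrakk> \<Longrightarrow> \<Lambda> x u = segment_log a a' (Z x u)"
    and left: "\<And>x u l. \<lbrakk>x \<in> X; u \<in> U; Re u < - m x; u + turn l \<in> U; (\<sigma> ^^ l) x = x\<rbrakk> \<Longrightarrow>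
       of_nat (order a F * order a' F) * (\<Lambda> x (u + turn l) - \<Lambda> x u) = - turn l * ?N x"
    unfolding bchoice_iff by blast
  obtain P where P: "\<And>t. t \<notin> critical_values F \<Longrightarrow> (\<forall>z\<in>fiber F t. norm z > norm a \<and> norm z > norm a') \<Longrightarrow>
      contour_integral (linepath a a') (\<lambda>w. poly q w / (poly F w - t)) =
       poly P t + (\<Sum>z\<in>fiber F t. poly q z / poly (pderiv F) z * segment_log a a' z)"
    using resolvent_integral[OF degree_pos, of a a' q] by blast
  obtain B where B: "\<And>t. norm t > B \<Longrightarrow> contour_integral (linepath a a') (\<lambda>w. poly q w / (poly F w - t)) = 0"
    using vanishing_moments_resolvent[OF mom] by blast
  obtain M3 where M3: "M3 > 0" "\<And>x u. \<lbrakk>x \<in> X; u \<in> U; Re u > M3\<rbrakk> \<Longrightarrow> norm (Z x u) > norm a + norm a'"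
    using large_right[of "norm a + norm a'"] by metis
  define M where "M = Max (insert (max B M3) (m ` X))"
  have Mle: "m x \<le> M" if "x \<in> X" for x using that finite_X by (simp add: M_def)
  have "max B M3 \<le> M" unfolding M_def by (rule Max_ge) (use finite_X in auto)
  then have MB: "B \<le> M" "M3 \<le> M" "M > 0" using M3(1) by auto
  define \<Theta> where "\<Theta> = (\<lambda>u. poly P (E u) + (\<Sum>x\<in>X. ?r x u * \<Lambda> x u))"
  have holr: "?r x holomorphic_on U" if "x \<in> X" for x
    using derivative_nonzero[OF _ branch_value[OF that]] by (intro holomorphic_intros holomorphic_branch[OF that]) auto
  have hol\<Theta>: "\<Theta> holomorphic_on U" unfolding \<Theta>_def
    by (intro holomorphic_intros hol\<Lambda> holr)
  have \<Theta>right: "\<Theta> u = 0" if u: "u \<in> {u \<in> U. Re u > M}" for u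
  proof -
    have "Re u < exp (Re u)" using exp_ge_add_one_self[of "Re u"] by linarith
    then have "M < norm (E u)" unfolding norm_E using u by simp
    then have "contour_integral (linepath a a') (\<lambda>w. poly q w / (poly F w - E u)) = 0" using B MB by simp
    moreover have "\<forall>z\<in>fiber F (E u). norm z > norm a \<and> norm z > norm a'"
    proof
      fix z assume "z \<in> fiber F (E u)"
      then obtain x where "x \<in> X" "z = Z x u" using bij_branch[of u] u unfolding bij_betw_def by blast
      then show "norm z > norm a \<and> norm z > norm a'"
        using M3(2)[of x u] u MB norm_ge_zero[of a] norm_ge_zero[of a'] by (auto intro: order.strict_trans1[rotated])
    qed
    ultimately have "0 = poly P (E u) + (\<Sum>z\<in>fiber F (E u). poly q z / poly (pderiv F) z * segment_log a a' z)"
      using P[OF regular[of u]] u by simp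
    also have "(\<Sum>z\<in>fiber F (E u). poly q z / poly (pderiv F) z * segment_log a a' z) = (\<Sum>x\<in>X. ?r x u * segment_log a a' (Z x u))"
      by (rule sum.reindex_bij_betw[OF bij_branch, symmetric]) (use u in simp)
    also have "\<dots> = (\<Sum>x\<in>X. ?r x u * \<Lambda> x u)"
    proof (rule sum.cong[OF refl])
      fix x assume x: "x \<in> X"
      then show "?r x u * segment_log a a' (Z x u) = ?r x u * \<Lambda> x u" using right[of x u] u Mle[OF x] by simp
    qed
    finally show ?thesis by (simp add: \<Theta>_def)
  qed
  have \<Theta>0: "\<Theta> u = 0" if "u \<in> U" for u
  proof (rule analytic_continuation_open[of "{u \<in> U. Re u > M}" U \<Theta> "\<lambda>_. 0"])
    show "open {u \<in> U. Re u > M}"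
      using open_chart_dom by (simp add: open_halfspace_Re_gt open_Int Collect_conj_eq)
    have "complex_of_real (M + 1) \<in> {u \<in> U. Re u > M}" using real_in_U[of "M + 1"] by simp
    then show "{u \<in> U. Re u > M} \<noteq> {}" by blast
  qed (use open_chart_dom connected_chart_dom[OF eps_pos] hol\<Theta> \<Theta>right that in auto)
  \<comment> \<open>after \<open>n\<close> turns around 0 all branches return\<close>
  obtain n where n: "n > 0" "\<sigma> ^^ n = id" by (rule left_shift_finite_order)
  let ?p = "turn n"
  let ?W = "U \<inter> {u. Re u < - M} \<inter> (\<lambda>u. u + ?p) -` U"
  have zeroW: "(\<Sum>x\<in>X. ?N x * ?r x u) = 0" if u: "u \<in> ?W" for u
  proof -
    have Ep: "E (u + ?p) = E u" by (rule E_period)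
    have Zp: "Z x (u + ?p) = Z x u" if "x \<in> X" for x
      using left_shift_branch[OF that, of u n] u n(2) MB(3) by simp
    have "0 = of_nat (order a F * order a' F) * (\<Theta> (u + ?p) - \<Theta> u)" using \<Theta>0 u by simp
    also have "\<Theta> (u + ?p) - \<Theta> u = (\<Sum>x\<in>X. ?r x u * \<Lambda> x (u + ?p)) - (\<Sum>x\<in>X. ?r x u * \<Lambda> x u)"
      unfolding \<Theta>_def Ep using Zp by simp
    also have "\<dots> = (\<Sum>x\<in>X. ?r x u * (\<Lambda> x (u + ?p) - \<Lambda> x u))"
      by (simp only: sum_subtractf right_diff_distrib)
    also have "of_nat (order a F * order a' F) * \<dots> = (\<Sum>x\<in>X. ?r x u * (- ?p * ?N x))"
      unfolding sum_distrib_left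
    proof (rule sum.cong[OF refl])
      fix x assume x: "x \<in> X"
      have "of_nat (order a F * order a' F) * (\<Lambda> x (u + ?p) - \<Lambda> x u) = - ?p * ?N x"
        using u Mle[OF x] n(2) by (intro left[OF x]) auto
      then show "of_nat (order a F * order a' F) * (?r x u * (\<Lambda> x (u + ?p) - \<Lambda> x u)) = ?r x u * (- ?p * ?N x)"
        by (metis mult.left_commute)
    qed
    also have "\<dots> = - ?p * (\<Sum>x\<in>X. ?N x * ?r x u)"
      unfolding sum_distrib_left by (rule sum.cong[OF refl]) (simp only: mult_ac)
    finally show ?thesis using n(1) by simp
  qed
  have zero: "(\<Sum>x\<in>X. ?N x * ?r x u) = 0" if "u \<in> U" for u
  proof (rule analytic_continuation_open[of ?W U "\<lambda>u. \<Sum>x\<in>X. ?N x * ?r x u" "\<lambda>_. 0"])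
    have "open ((\<lambda>u. u + ?p) -` U)" by (rule open_vimage[OF open_chart_dom]) (intro continuous_intros)
    then show "open ?W" using open_chart_dom by (intro open_Int open_halfspace_Re_lt)
    obtain s where s: "complex_of_real s \<in> U" "s < - M" "complex_of_real s + ?p \<in> U"
      by (rule far_left_real)
    then have "complex_of_real s \<in> ?W" by simp
    then show "?W \<noteq> {}" by blast
    show "(\<lambda>u. \<Sum>x\<in>X. ?N x * ?r x u) holomorphic_on U" by (intro holomorphic_intros holr)
  qed (use open_chart_dom connected_chart_dom[OF eps_pos] zeroW that in auto)
  have "(\<lambda>u. \<Sum>x\<in>X. ?N x * g (Z x u)) constant_on U"
  proof (rule has_field_derivative_0_imp_constant_on[OF _ connected_chart_dom[OF eps_pos] open_chart_dom])
    fix u assume u: "u \<in> U"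
    have "(\<Sum>x\<in>X. ?N x * (poly q (Z x u) * (E u / poly (pderiv F) (Z x u)))) = E u * (\<Sum>x\<in>X. ?N x * ?r x u)"
      unfolding sum_distrib_left by (rule sum.cong[OF refl]) simp
    then have "(\<Sum>x\<in>X. ?N x * (poly q (Z x u) * (E u / poly (pderiv F) (Z x u)))) = 0" using zero[OF u] by simp
    then show "((\<lambda>u. \<Sum>x\<in>X. ?N x * g (Z x u)) has_field_derivative 0) (at u)"
      using derivative_of_branch_sum[OF g u, of ?N] by (simp only:)
  qed
  then obtain C where C: "\<And>u. u \<in> U \<Longrightarrow> (\<Sum>x\<in>X. ?N x * g (Z x u)) = C" unfolding constant_on_def by blast
  have "continuous_on UNIV g" using DERIV_isCont[OF g] by (simp add: continuous_on_eq_continuous_at)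
  then have "(\<Sum>x\<in>X. ?N x * g (\<zeta> x)) = C" using C by (rule limit_of_branch_sum)
  moreover have "(poly q has_contour_integral (g (pathfinish (linepath a a')) - g (pathstart (linepath a a')))) (linepath a a')"
    by (rule contour_integral_primitive[where S = UNIV]) (use g in auto)
  then have "g a' - g a = 0" using contour_integral_unique mom[of 0] by force
  ultimately have "C = 0" using sum_end_weight[OF roots, of g] by simp
  then show ?thesis using C[OF u] by simp
qed

end

section \<open>Cycle integrals as sums over nearby fibers\<close>

lemma root_branch_germ:
  assumes reg: "t0 \<notin> critical_values f" and z: "poly f z = t0"
  shows "root_branch f t0 z analytic_on {t0} \<and> root_branch f t0 z t0 = z \<and>
    (\<forall>\<^sub>F t in nhds t0. poly f (root_branch f t0 z t) = t)"
proof -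
  have "poly (pderiv f) z \<noteq> 0" using assms by (auto simp: critical_values_def)
  then obtain r where r: "r > 0" "inj_on (poly f) (ball z r)" using poly_locally_invertible by metis
  obtain g where g: "g holomorphic_on poly f ` ball z r" "\<And>w. w \<in> ball z r \<Longrightarrow> g (poly f w) = w"
    using holomorphic_has_inverse[OF poly_holomorphic_on[OF holomorphic_on_ident] open_ball r(2)] by metis
  have op: "open (poly f ` ball z r)"
    by (rule open_mapping_thm3[OF poly_holomorphic_on[OF holomorphic_on_ident] open_ball r(2)])
  have t0: "t0 \<in> poly f ` ball z r" using z r(1) by force
  have "g analytic_on {t0}" using g(1) op t0 by (meson analytic_on_analytic_at analytic_at empty_subsetI insert_subset)
  moreover have "g t0 = z" using g(2)[of z] z r(1) by simp
  moreover have "\<forall>\<^sub>F t in nhds t0. poly f (g t) = t"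
    using g(2) by (intro eventually_mono[OF eventually_nhds_in_open[OF op t0]]) auto
  ultimately have "\<exists>Z. Z analytic_on {t0} \<and> Z t0 = z \<and> (\<forall>\<^sub>F t in nhds t0. poly f (Z t) = t)" by blast
  then show ?thesis unfolding root_branch_def by (rule someI_ex)
qed

text \<open>
  The germs of the branches stay in disjoint balls around the points of the fiber, so their values at
  \<open>t\<close> are \<open>degree f\<close> distinct points of the fiber over \<open>t\<close>.
\<close>
lemma cycle_integral_eq_fiber_sum:
  assumes d: "degree f > 0" and reg: "t0 \<notin> critical_values f"
    and n: "\<And>z. z \<in> fiber f t0 \<Longrightarrow> \<forall>\<^sub>F w in nhds z. n w = n z"
  shows "\<forall>\<^sub>F t in nhds t0. cycle_integral f t0 n g t = (\<Sum>z\<in>fiber f t. of_int (n z) * poly g z)"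
proof -
  let ?W = "root_branch f t0"
  obtain r where r: "r > 0" "\<And>z. z \<in> fiber f t0 \<Longrightarrow> inj_on (poly f) (ball z r)"
    "\<And>z z'. \<lbrakk>z \<in> fiber f t0; z' \<in> fiber f t0; z \<noteq> z'\<rbrakk> \<Longrightarrow> ball z r \<inter> ball z' r = {}"
    using fiber_disjoint_invertible_balls[OF d reg] by blast
  have ev: "\<forall>\<^sub>F t in nhds t0. poly f (?W z t) = t \<and> ?W z t \<in> ball z r \<and> n (?W z t) = n z" if z: "z \<in> fiber f t0" for z
  proof -
    have W: "?W z analytic_on {t0}" "?W z t0 = z" "\<forall>\<^sub>F t in nhds t0. poly f (?W z t) = t"
      using root_branch_germ[OF reg] z by (auto simp: fiber_def)
    have "isCont (?W z) t0" using W(1) by (simp add: analytic_at_imp_isCont)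
    then have lim: "filterlim (?W z) (nhds z) (nhds t0)"
      using W(2) tendsto_at_iff_tendsto_nhds[of "?W z" t0] by (simp add: isCont_def)
    have "\<forall>\<^sub>F w in nhds z. w \<in> ball z r" using r(1) by (intro eventually_nhds_in_open) auto
    then have "\<forall>\<^sub>F t in nhds t0. ?W z t \<in> ball z r" using lim unfolding filterlim_iff by blast
    moreover have "\<forall>\<^sub>F t in nhds t0. n (?W z t) = n z" using n[OF z] lim unfolding filterlim_iff by blast
    ultimately show ?thesis using W(3) by eventually_elim blast
  qed
  have "\<forall>\<^sub>F t in nhds t0. \<forall>z\<in>fiber f t0. poly f (?W z t) = t \<and> ?W z t \<in> ball z r \<and> n (?W z t) = n z"
    by (rule eventually_ball_finite[OF finite_fiber[OF d]]) (use ev in blast)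
  moreover have "\<forall>\<^sub>F t in nhds t0. t \<in> - critical_values f"
    using reg finite_imp_closed[OF finite_critical_values[OF d]] by (intro eventually_nhds_in_open) auto
  ultimately show ?thesis
  proof eventually_elim
    case (elim t)
    have inj: "inj_on (\<lambda>z. ?W z t) (fiber f t0)"
      using elim(1) r(3) by (intro inj_onI) (metis IntI empty_iff)
    have im: "(\<lambda>z. ?W z t) ` fiber f t0 = fiber f t"
      by (rule inj_image_eq_if_card_le[OF finite_fiber[OF d] _ inj _ finite_fiber[OF d]])
        (use elim reg card_fiber_regular[OF d] in \<open>auto simp: fiber_def\<close>)
    have "cycle_integral f t0 n g t = (\<Sum>z\<in>fiber f t0. of_int (n (?W z t)) * poly g (?W z t))"
      unfolding cycle_integral_def using elim(1) by (intro sum.cong) auto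
    also have "\<dots> = (\<Sum>z\<in>(\<lambda>z. ?W z t) ` fiber f t0. of_int (n z) * poly g z)"
      by (simp add: sum.reindex[OF inj])
    finally show ?case by (simp only: im)
  qed
qed

text \<open>
  The weights of \<open>endpoint_cycle\<close>, for two arbitrary roots in place of 0 and 1.
\<close>
definition near_weight :: "complex poly \<Rightarrow> complex \<Rightarrow> complex \<Rightarrow> real \<Rightarrow> complex \<Rightarrow> int" where
  "near_weight F a a' r z =
     int (order a' F) * of_bool (dist z a < r) - int (order a F) * of_bool (dist z a' < r)"

lemma near_weight_locally_constant:
  assumes "dist z a \<noteq> r" "dist z a' \<noteq> r"
  shows "\<forall>\<^sub>F w in nhds z. near_weight F a a' r w = near_weight F a a' r z"
proof -
  have *: "\<forall>\<^sub>F w in nhds z. (dist w e < r) = (dist z e < r)" if "dist z e \<noteq> r" for e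
  proof (cases "dist z e < r")
    case True
    have "open {w. dist w e < r}" by (intro open_Collect_less continuous_intros)
    then have "\<forall>\<^sub>F w in nhds z. w \<in> {w. dist w e < r}" using True by (intro eventually_nhds_in_open) auto
    then show ?thesis by eventually_elim (use True in simp)
  next
    case False
    have "open {w. r < dist w e}" by (intro open_Collect_less continuous_intros)
    then have "\<forall>\<^sub>F w in nhds z. w \<in> {w. r < dist w e}" using False that by (intro eventually_nhds_in_open) auto
    then show ?thesis by eventually_elim (use False in simp)
  qed
  show ?thesis using *[OF assms(1)] *[OF assms(2)] by eventually_elim (simp add: near_weight_def)
qed

context slit_chart
begin

lemma base_point_exists:
  obtains \<rho> where "\<rho> > 0" "\<And>t. \<lbrakk>norm t < \<rho>; t \<notin> critical_values F\<rbrakk> \<Longrightarrow> \<exists>b. base_point t b"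
proof
  show "exp (- (pi / \<epsilon>)) > 0" by simp
  fix t assume t: "norm t < exp (- (pi / \<epsilon>))" "t \<notin> critical_values F"
  show "\<exists>b. base_point t b"
  proof (cases "t = 0")
    case True
    then show ?thesis using t(2) unfolding base_point_def by blast
  next
    case False
    define u where "u = Ln (t / c)"
    have tc: "t / c \<noteq> 0" using False c_nonzero by simp
    have Eu: "E u = t" using tc c_nonzero by (simp add: u_def)
    have "ln (norm t) < - (pi / \<epsilon>)" using t(1) False by (metis exp_less_cancel_iff exp_ln zero_less_norm_iff)
    moreover have "Re u = ln (norm t)" using tc norm_c by (simp add: u_def norm_divide)
    ultimately have "pi / \<epsilon> < \<bar>Re u\<bar>" by linarith
    then have "pi < \<epsilon> * \<bar>Re u\<bar>" using eps_pos by (simp add: divide_less_eq mult.commute)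
    moreover have "\<bar>Im u\<bar> \<le> pi" using mpi_less_Im_Ln[OF tc] Im_Ln_le_pi[OF tc] by (simp add: u_def abs_le_iff)
    ultimately have "u \<in> U" using eps_pos by (simp add: chart_dom_def distrib_left)
    then show ?thesis using Eu unfolding base_point_def by blast
  qed
qed

lemma base_point_near_root_end:
  assumes bp: "base_point t0 b" and "\<rho> \<le> 1" "0 < \<rho>" "0 < r"
    and near: "\<And>z. norm (poly F z) < \<rho> \<Longrightarrow> \<exists>a. poly F a = 0 \<and> dist z a < r"
    and sep: "\<And>a b. \<lbrakk>poly F a = 0; poly F b = 0; a \<noteq> b\<rbrakk> \<Longrightarrow> 2 * r \<le> dist a b"
    and small: "norm t0 < \<rho>" and x: "x \<in> X"
  shows "dist (b x) (\<zeta> x) < r"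
  using bp unfolding base_point_def
proof
  assume "t0 = 0 \<and> 0 \<notin> critical_values F \<and> b = \<zeta>"
  then show ?thesis using \<open>0 < r\<close> by simp
next
  assume "\<exists>u0\<in>U. t0 = E u0 \<and> b = (\<lambda>x. Z x u0)"
  then obtain u0 where u0: "u0 \<in> U" "t0 = E u0" "b = (\<lambda>x. Z x u0)" by blast
  have "dist (Z x u0) (\<zeta> x) < r"
    by (rule branch_near_root_end[OF x assms(2,3) near sep u0(1)]) (use small u0(2) in simp_all)
  then show ?thesis using u0(3) by simp
qed

text \<open>
  For small \<open>t0\<close>, a point of the fiber is within \<open>r\<close> of a root if and only if this root is the limit of
  its branch.  The cycle integral at \<open>t = E u\<close> is then the branch sum with the weights \<open>end_weight\<close>,
  and the statements about branch sums apply.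
\<close>
lemma two_root_cycle_near_value:
  assumes roots: "poly F a = 0" "poly F a' = 0" and r: "r > 0"
    and sep: "\<And>a b. \<lbrakk>poly F a = 0; poly F b = 0; a \<noteq> b\<rbrakk> \<Longrightarrow> 2 * r \<le> dist a b"
    and g: "\<And>z. (poly g has_field_derivative poly q z) (at z)"
  shows "\<forall>\<^sub>F t0 in nhds 0. t0 \<notin> critical_values F \<longrightarrow>
     is_cycle F t0 (near_weight F a a' r) \<and>
     ((\<forall>k. contour_integral (linepath a a') (\<lambda>w. poly F w ^ k * poly q w) = 0) \<longleftrightarrow>
       (\<forall>\<^sub>F t in nhds t0. cycle_integral F t0 (near_weight F a a' r) g t = 0)) \<and>
     totally_unbalanced F t0 (near_weight F a a' r)"
proof -
  let ?n = "near_weight F a a' r" and ?N = "end_weight F c \<epsilon> a a'"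
  obtain \<rho>1 where \<rho>1: "\<rho>1 > 0" "\<And>t. \<lbrakk>norm t < \<rho>1; t \<notin> critical_values F\<rbrakk> \<Longrightarrow> \<exists>b. base_point t b"
    by (rule base_point_exists) blast
  obtain \<rho>2 where \<rho>2: "\<rho>2 > 0" "\<And>z. norm (poly F z) < \<rho>2 \<Longrightarrow> \<exists>a. poly F a = 0 \<and> dist z a < r"
    using small_value_near_root[OF degree_pos r] by metis
  define \<rho> where "\<rho> = min 1 (min \<rho>1 \<rho>2)"
  have \<rho>: "\<rho> > 0" "\<rho> \<le> 1" "\<rho> \<le> \<rho>1" "\<rho> \<le> \<rho>2" using \<rho>1(1) \<rho>2(1) by (auto simp: \<rho>_def)
  have near: "\<exists>a. poly F a = 0 \<and> dist z a < r" if "norm (poly F z) < \<rho>" for z using \<rho>2(2) that \<rho>(4) by simp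
  have bx: "dist (b x) (\<zeta> x) < r" if "base_point t b" "norm t < \<rho>" "x \<in> X" for b t x
    by (rule base_point_near_root_end[OF that(1) \<rho>(2,1) r near sep that(2,3)])
  have side: "dist z e < r \<longleftrightarrow> y = e" "dist z e \<noteq> r"
    if "poly F e = 0" "poly F y = 0" "dist z y < r" for z e y
  proof -
    have "r < dist z e" if "y \<noteq> e"
      using sep[OF \<open>poly F y = 0\<close> \<open>poly F e = 0\<close> that] \<open>dist z y < r\<close> dist_triangle2[of y e z]
      by (simp add: dist_commute)
    then show "dist z e < r \<longleftrightarrow> y = e" "dist z e \<noteq> r" using \<open>dist z y < r\<close> by (cases "y = e"; force)+
  qed
  have nb: "?n (b x) = ?N x" and sphere: "dist (b x) a \<noteq> r" "dist (b x) a' \<noteq> r"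
    if "base_point t b" "norm t < \<rho>" "x \<in> X" for b t x
    using side[OF roots(1) root_end_root[OF that(3)] bx[OF that]] side[OF roots(2) root_end_root[OF that(3)] bx[OF that]]
    by (simp_all add: near_weight_def end_weight_def)
  define \<Psi> where "\<Psi> = (\<lambda>u. \<Sum>x\<in>X. of_int (?N x) * poly g (Z x u))"
  define \<Phi> where "\<Phi> = (\<lambda>t. \<Sum>z\<in>fiber F t. of_int (?n z) * poly g z)"
  have \<Phi>b: "\<Phi> t = (\<Sum>x\<in>X. of_int (?N x) * poly g (b x))" if "base_point t b" "norm t < \<rho>" for t b
  proof -
    have "\<Phi> t = (\<Sum>x\<in>X. of_int (?n (b x)) * poly g (b x))"
      unfolding \<Phi>_def by (rule sum.reindex_bij_betw[OF base_point_bij[OF that(1)], symmetric])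
    then show ?thesis using nb[OF that] by simp
  qed
  have \<Phi>E: "\<Phi> (E u) = \<Psi> u" if "u \<in> U" "norm (E u) < \<rho>" for u
  proof -
    have "base_point (E u) (\<lambda>x. Z x u)" using that(1) unfolding base_point_def by blast
    then show ?thesis using \<Phi>b that(2) by (simp add: \<Psi>_def)
  qed
  have moments: "(\<forall>k. contour_integral (linepath a a') (\<lambda>w. poly F w ^ k * poly q w) = 0) \<longleftrightarrow> (\<forall>u\<in>U. \<Psi> u = 0)"
    using moments_imp_branch_sum_zero[OF roots g] branch_sum_zero_imp_moments[OF roots g] unfolding \<Psi>_def by blast
  have contg: "continuous_on UNIV (poly g)" by (rule continuous_on_poly_fun)
  have germ: "(\<forall>\<^sub>F t in nhds t0. \<Phi> t = 0) \<longleftrightarrow> (\<forall>u\<in>U. \<Psi> u = 0)"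
    if t0: "norm t0 < \<rho>" "t0 \<notin> critical_values F" for t0
  proof
    assume "\<forall>\<^sub>F t in nhds t0. \<Phi> t = 0"
    then obtain O1 where O1: "open O1" "t0 \<in> O1" "\<And>t. t \<in> O1 \<Longrightarrow> \<Phi> t = 0" unfolding eventually_nhds by blast
    define O2 where "O2 = O1 \<inter> ball 0 \<rho>"
    have O2: "open O2" "t0 \<in> O2" using O1 t0(1) by (auto simp: O2_def)
    let ?W = "U \<inter> E -` O2"
    have "open ?W" by (intro open_Int open_chart_dom open_vimage O2 continuous_intros)
    moreover have "?W \<noteq> {}"
    proof (cases "t0 = 0")
      case True
      obtain e where e: "e > 0" "ball 0 e \<subseteq> O2" using O2 True unfolding open_contains_ball by blast
      have "norm (E (complex_of_real (ln e - 1))) < e"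
        unfolding norm_E using e(1) by (simp add: exp_diff divide_less_eq)
      then have "E (complex_of_real (ln e - 1)) \<in> O2" using e(2) by (intro subsetD[OF e(2)]) simp
      then show ?thesis using real_in_U by blast
    next
      case False
      obtain b where "base_point t0 b" using \<rho>1(2)[of t0] t0 \<rho>(3) by auto
      then obtain u0 where "u0 \<in> U" "t0 = E u0" using False unfolding base_point_def by blast
      then show ?thesis using O2(2) by blast
    qed
    moreover have "\<Psi> u = 0" if "u \<in> ?W" for u
      using \<Phi>E[of u] O1(3)[of "E u"] that by (simp add: O2_def)
    moreover have "\<Psi> holomorphic_on U" unfolding \<Psi>_def by (intro holomorphic_intros holomorphic_branch)
    ultimately show "\<forall>u\<in>U. \<Psi> u = 0"
      using analytic_continuation_open[of ?W U \<Psi> "\<lambda>_. 0"] open_chart_dom connected_chart_dom[OF eps_pos] by auto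
  next
    assume zero: "\<forall>u\<in>U. \<Psi> u = 0"
    have "\<forall>\<^sub>F t in nhds t0. t \<in> ball 0 \<rho> \<inter> (- critical_values F)"
      using t0 finite_imp_closed[OF finite_critical_values[OF degree_pos]] by (intro eventually_nhds_in_open) auto
    then show "\<forall>\<^sub>F t in nhds t0. \<Phi> t = 0"
    proof eventually_elim
      case (elim t)
      then obtain b where b: "base_point t b" using \<rho>1(2)[of t] \<rho>(3) by auto
      have "(\<Sum>x\<in>X. of_int (?N x) * poly g (b x)) = 0"
        using b unfolding base_point_def
      proof
        assume "t = 0 \<and> 0 \<notin> critical_values F \<and> b = \<zeta>"
        then show ?thesis using limit_of_branch_sum[OF contg, of "\<lambda>x. of_int (?N x)" 0] zero by (simp add: \<Psi>_def)
      next
        assume "\<exists>u0\<in>U. t = E u0 \<and> b = (\<lambda>x. Z x u0)"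
        then show ?thesis using zero by (auto simp: \<Psi>_def)
      qed
      then show ?case using \<Phi>b[OF b] elim by simp
    qed
  qed
  have "is_cycle F t0 ?n \<and>
     ((\<forall>k. contour_integral (linepath a a') (\<lambda>w. poly F w ^ k * poly q w) = 0) \<longleftrightarrow>
       (\<forall>\<^sub>F t in nhds t0. cycle_integral F t0 ?n g t = 0)) \<and>
     totally_unbalanced F t0 ?n"
    if t0: "norm t0 < \<rho>" "t0 \<notin> critical_values F" for t0
  proof (intro conjI)
    obtain b where b: "base_point t0 b" using \<rho>1(2)[of t0] t0 \<rho>(3) by auto
    have "(\<Sum>z\<in>fiber F t0. ?n z) = (\<Sum>x\<in>X. ?n (b x))"
      by (rule sum.reindex_bij_betw[OF base_point_bij[OF b], symmetric])
    also have "\<dots> = 0" using nb[OF b t0(1)] sum_end_weight_eq_0[OF roots] by simp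
    finally show "is_cycle F t0 ?n" by (simp add: is_cycle_def)
    show "totally_unbalanced F t0 ?n"
      by (rule two_root_cycle_totally_unbalanced[OF b roots nb[OF b t0(1)]])
    have "\<forall>\<^sub>F t in nhds t0. cycle_integral F t0 ?n g t = \<Phi> t"
      unfolding \<Phi>_def
    proof (rule cycle_integral_eq_fiber_sum[OF degree_pos t0(2)])
      fix z assume "z \<in> fiber F t0"
      then obtain x where "x \<in> X" "z = b x" using base_point_bij[OF b] unfolding bij_betw_def by blast
      then show "\<forall>\<^sub>F w in nhds z. ?n w = ?n z"
        using sphere[OF b t0(1)] by (intro near_weight_locally_constant) auto
    qed
    then have "(\<forall>\<^sub>F t in nhds t0. cycle_integral F t0 ?n g t = 0) \<longleftrightarrow> (\<forall>\<^sub>F t in nhds t0. \<Phi> t = 0)"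
      by (intro eventually_subst) (auto elim: eventually_mono)
    then show "(\<forall>k. contour_integral (linepath a a') (\<lambda>w. poly F w ^ k * poly q w) = 0) \<longleftrightarrow>
       (\<forall>\<^sub>F t in nhds t0. cycle_integral F t0 ?n g t = 0)"
      using germ[OF t0] moments by simp
  qed
  moreover have "\<forall>\<^sub>F t0 in nhds (0::complex). t0 \<in> ball 0 \<rho>" using \<rho>(1) by (intro eventually_nhds_in_open) auto
  ultimately show ?thesis by (auto elim!: eventually_mono)
qed

end

section \<open>The moment criterion\<close>

lemma primitive_has_derivative:
  fixes f p :: "complex poly"
  assumes "\<And>w. poly f w = contour_integral (linepath 0 w) (poly p)"
  shows "(poly f has_field_derivative poly p z) (at z)"
proof -
  obtain P where P: "\<And>z. (P has_field_derivative poly p z) (at z)"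
    using holomorphic_convex_primitive'[OF convex_UNIV open_UNIV poly_holomorphic_on[OF holomorphic_on_ident], of p] by auto
  have "poly f w = P w - P 0" for w
  proof -
    have "(poly p has_contour_integral (P (pathfinish (linepath 0 w)) - P (pathstart (linepath 0 w)))) (linepath 0 w)"
      by (rule contour_integral_primitive[OF P valid_path_linepath subset_UNIV])
    then show ?thesis using assms contour_integral_unique by force
  qed
  then have "poly f = (\<lambda>w. P w - P 0)" by blast
  then show ?thesis using P by (auto intro!: derivative_eq_intros)
qed

theorem proposition8p2:
  fixes p q f g :: "complex poly"
  assumes "p \<noteq> 0"
    and "\<And>w. poly f w = contour_integral (linepath 0 w) (poly p)"
    and "\<And>w. poly g w = contour_integral (linepath 0 w) (poly q)"
    and "poly f 0 = poly f 1"
  shows "\<forall>\<^sub>F r in at_right (0::real). \<forall>\<^sub>F t0 in nhds (poly f 0). t0 \<notin> critical_values f \<longrightarrow>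
           is_cycle f t0 (endpoint_cycle f r) \<and>
           ((\<forall>k::nat. contour_integral (linepath 0 1) (\<lambda>w. poly f w ^ k * poly q w) = 0) \<longleftrightarrow>
            (\<forall>\<^sub>F t in nhds t0. cycle_integral f t0 (endpoint_cycle f r) g t = 0)) \<and>
           totally_unbalanced f t0 (endpoint_cycle f r)"
proof -
  have f0: "poly f 0 = 0" using assms(2)[of 0] by simp
  have f1: "poly f 1 = 0" using f0 assms(4) by simp
  have "poly (pderiv f) z = poly p z" for z
    by (rule DERIV_unique[OF poly_DERIV primitive_has_derivative[OF assms(2)]])
  then have "pderiv f = p" by (intro poly_ext)
  then have deg: "degree f > 0" using assms(1) pderiv_eq_0_iff by blast
  obtain c \<epsilon> where c: "norm c = 1" "\<epsilon> > 0" "\<And>u. u \<in> chart_dom \<epsilon> \<Longrightarrow> c * exp u \<notin> critical_values f"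
    by (rule chart_dom_avoids_finite[OF finite_critical_values[OF deg]]) blast
  interpret slit_chart f c \<epsilon> using deg c by unfold_locales
  have fin: "finite {a. poly f a = 0}" using deg by (intro poly_roots_finite) auto
  obtain \<delta> where \<delta>: "\<delta> > 0" "\<And>a b. \<lbrakk>poly f a = 0; poly f b = 0; a \<noteq> b\<rbrakk> \<Longrightarrow> \<delta> \<le> dist a b"
    using finite_separated[OF fin] by auto
  have weight: "endpoint_cycle f r = near_weight f 0 1 r" for r
    by (rule ext) (simp add: endpoint_cycle_def near_weight_def endpoint_mult_def f0)
  show ?thesis
  \<comment> \<open>discs of radius at most \<open>\<delta> / 2\<close> around the roots are disjoint\<close>
  proof (rule eventually_at_rightI[of 0 "\<delta> / 2"])
    fix r assume r: "r \<in> {0<..<\<delta> / 2}"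
    have sep: "2 * r \<le> dist a b" if "poly f a = 0" "poly f b = 0" "a \<noteq> b" for a b
      using \<delta>(2)[OF that] r by auto
    have "r > 0" using r by simp
    then show "\<forall>\<^sub>F t0 in nhds (poly f 0). t0 \<notin> critical_values f \<longrightarrow>
           is_cycle f t0 (endpoint_cycle f r) \<and>
           ((\<forall>k::nat. contour_integral (linepath 0 1) (\<lambda>w. poly f w ^ k * poly q w) = 0) \<longleftrightarrow>
            (\<forall>\<^sub>F t in nhds t0. cycle_integral f t0 (endpoint_cycle f r) g t = 0)) \<and>
           totally_unbalanced f t0 (endpoint_cycle f r)"
      unfolding f0 weight by (rule two_root_cycle_near_value[OF f0 f1 _ sep primitive_has_derivative[OF assms(3)]])
  qed (use \<delta>(1) in simp)
qed

end
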